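(* Let $q$ be an odd prime power, $F=\mathbb{F}_q$, $G=\mathrm{PSL}_2(F)$ acting by conjugation on the space $V$ of trace-zero $2\times 2$ matrices over $F$, $R=S(V^* )=F[x_1,x_2,x_3]$, and $\Omega=R\otimes\Lambda(V^* )$, with $f_1,f_2,f_3,f_4\in R^G$, $\mathcal{A}=F[f_1,f_2,f_3]$ and $\phi$ as defined in the context. Then $\Omega^G$ is a Cohen–Macaulay $R^G$-module, freely generated over $\mathcal{A}$ by the set \begin{align*} S=\{&1,\ f_4,\\ &\mathrm{d}f_1,\ \mathrm{d}f_2,\ \mathrm{d}f_3,\ \phi(\mathrm{d}f_2\wedge \mathrm{d}f_3),\ \phi(\mathrm{d}f_3\wedge \mathrm{d}f_1),\ \phi(\mathrm{d}f_1\wedge \mathrm{d}f_2),\\ &\phi^{-1}(\mathrm{d}f_1),\ \phi^{-1}(\mathrm{d}f_2),\ \phi^{-1}(\mathrm{d}f_3),\ \mathrm{d}f_2\wedge \mathrm{d}f_3,\ \mathrm{d}f_3\wedge \mathrm{d}f_1,\ \mathrm{d}f_1\wedge \mathrm{d}f_2,\\ &\mathrm{d}x_1\wedge \mathrm{d}x_2\wedge \mathrm{d}x_3,\ f_4\,\mathrm{d}x_1\wedge \mathrm{d}x_2\wedge \mathrm{d}x_3\}.\end{align*}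
   Context: Let $F=\mathbb{F}_q$ with $q$ odd, let $V$ be the $F$-vector space of $2\times 2$ matrices of trace zero, with basis $v_1=\begin{pmatrix}0&-1\\0&0\end{pmatrix}$, $v_2=\begin{pmatrix}1&0\\0&-1\end{pmatrix}$, $v_3=\begin{pmatrix}0&0\\1&0\end{pmatrix}$, and let $x_1,x_2,x_3$ be the dual basis of $V^*$. $\mathrm{SL}_2(F)$ acts on $V$ by $g\cdot v=gvg^{-1}$ with kernel $\{\pm I\}$; $G=\mathrm{SL}_2(F)/\{\pm I\}=\mathrm{PSL}_2(F)$. $G$ acts on $V^*$ by $(g\cdot f)(v)=f(g^{-1}\cdot v)$, and on $R=S(V^* )=F[x_1,x_2,x_3]$ by algebra automorphisms; $R^G$ is the ring of invariants. $\Omega=\bigoplus_{i=0}^3\Omega^i$ with $\Omega^i=R\otimes\Lambda^i(V^* )$ is the algebra of differential forms, with the exterior product extended $R$-linearly, and the diagonal $G$-action $g\cdot(f\otimes w)=(g\cdot f)\otimes(g\cdot w)$. The $R$-basis of $\Omega^1$ corresponding to $x_1,x_2,x_3$ is written $\mathrm{d}x_1,\mathrm{d}x_2,\mathrm{d}x_3$, and for $f\in R$, $\mathrm{d}f=\sum_j \frac{\partial f}{\partial x_j}\mathrm{d}x_j$. $\Omega^G$ is the algebra of $G$-fixed points. Polynomials: $f_1=x_1x_3-x_2^2$; $f_2=x_1^qx_3+x_1x_3^q-2x_2^{q+1}$; $$f_3=\prod_{(b,c)\in L}(x_1+bx_2+cx_3),\qquad L=\{(b,c): b\in F,\ c\in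 F^*,\ b^2-4c \text{ is not a square in } F\},$$ an invariant of degree $\frac12q(q-1)$; $f_4$ is the determinant of the Jacobian matrix $\left(\partial f_i/\partial x_j\right)_{1\le i,j\le 3}$. $\mathcal{A}=F[f_1,f_2,f_3]\subseteq R^G$. (It is known that $f_1,f_2,f_3$ is a homogeneous system of parameters for $R^G$ and that $R^G$ is free over $\mathcal{A}$ with basis $1,f_4$.) $\phi:\Lambda^2(V^* )\to V^*=\Lambda^1(V^* )$ is the isomorphism of $FG$-modules given by $\phi(\mathrm{d}x_2\wedge \mathrm{d}x_3)=\mathrm{d}x_3$, $\phi(\mathrm{d}x_3\wedge \mathrm{d}x_1)=-2\,\mathrm{d}x_2$, $\phi(\mathrm{d}x_1\wedge \mathrm{d}x_2)=\mathrm{d}x_1$; extended $R$-linearly it gives an isomorphism $\Omega^2\to\Omega^1$, which restricts to an isomorphism of $R^G$-modules $(\Omega^2)^G\to(\Omega^1)^G$. All of these are denoted $\phi$. *)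

theory Defs
  imports
    "HOL-Analysis.Determinants"
    "HOL-Library.Poly_Mapping"
    "HOL-Library.Extended_Nat"
    "HOL-Algebra.Coset"
    "HOL-Algebra.QuotRing"
    "HOL-Algebra.Module"
begin

section \<open>Commutative algebra\<close>

text \<open>The ring record of a subset of a commutative ring given by a type class.\<close>

definition ring_on :: "'r::comm_ring_1 set \<Rightarrow> 'r ring" where
  "ring_on S = \<lparr>carrier = S, mult = (*), one = 1, zero = 0, add = (+)\<rparr>"

text \<open>Supremum of the lengths $n$ of chains $P_0 \subset \dots \subset P_n$ of prime ideals.\<close>

definition krull_dim :: "('r, 'x) ring_scheme \<Rightarrow> enat" where
  "krull_dim A = Sup {enat n | n. \<exists>P. (\<forall>i\<le>n. primeideal (P i) A) \<and> (\<forall>i<n. P i \<subset> P (Suc i))}"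

definition annihilator :: "('r, 'x) ring_scheme \<Rightarrow> ('r, 'm, 'y) module_scheme \<Rightarrow> 'r set" where
  "annihilator A M = {a \<in> carrier A. \<forall>m\<in>carrier M. a \<odot>\<^bsub>M\<^esub> m = \<zero>\<^bsub>M\<^esub>}"

definition module_dim :: "('r, 'x) ring_scheme \<Rightarrow> ('r, 'm, 'y) module_scheme \<Rightarrow> enat" where
  "module_dim A M = krull_dim (A Quot annihilator A M)"

text \<open>The submodule $(a_1,\dots,a_k)M$.\<close>

definition seq_times :: "'r list \<Rightarrow> ('r, 'm, 'y) module_scheme \<Rightarrow> 'm set" where
  "seq_times as M =
     {(\<Oplus>\<^bsub>M\<^esub>i\<in>{..<length as}. (as ! i) \<odot>\<^bsub>M\<^esub> m i) | m. \<forall>i<length as. m i \<in> carrier M}"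

text \<open>Injectivity of $a_{i+1}$ on $M/(a_1,\dots,a_i)M$ for all $i$, and $(a_1,\dots,a_n)M \neq M$.\<close>

definition regular_sequence :: "'r list \<Rightarrow> ('r, 'm, 'y) module_scheme \<Rightarrow> bool" where
  "regular_sequence as M \<longleftrightarrow>
     (\<forall>i<length as. \<forall>m\<in>carrier M.
        (as ! i) \<odot>\<^bsub>M\<^esub> m \<in> seq_times (take i as) M \<longrightarrow> m \<in> seq_times (take i as) M) \<and>
     seq_times as M \<noteq> carrier M"

definition depth :: "'r set \<Rightarrow> ('r, 'm, 'y) module_scheme \<Rightarrow> enat" where
  "depth I M = Sup {enat (length as) | as. set as \<subseteq> I \<and> regular_sequence as M}"

definition fin_gen_module :: "('r, 'x) ring_scheme \<Rightarrow> ('r, 'm, 'y) module_scheme \<Rightarrow> bool" where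
  "fin_gen_module A M \<longleftrightarrow> Module.module A M \<and>
     (\<exists>B. finite B \<and> B \<subseteq> carrier M \<and>
        (\<forall>m\<in>carrier M. \<exists>c\<in>B \<rightarrow> carrier A. m = (\<Oplus>\<^bsub>M\<^esub>b\<in>B. c b \<odot>\<^bsub>M\<^esub> b)))"

text \<open>
  Cohen--Macaulay modules in the graded sense: \<open>A\<close> is meant to be a Noetherian graded algebra with
  $A_0$ a field, \<open>\<mm>\<close> its homogeneous maximal ideal $A_+$, and \<open>M\<close> a graded \<open>A\<close>-module; the condition
  is $\mathrm{depth}(A_+, M) = \dim (A/\mathrm{Ann}\,M)$ for finitely generated \<open>M\<close>.
\<close>

definition cohen_macaulay ::
    "('r, 'x) ring_scheme \<Rightarrow> 'r set \<Rightarrow> ('r, 'm, 'y) module_scheme \<Rightarrow> bool" where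
  "cohen_macaulay A \<mm> M \<longleftrightarrow> fin_gen_module A M \<and> depth \<mm> M = module_dim A M"

text \<open>The members of the list \<open>bs\<close> (at different positions) form a basis of \<open>M\<close> over \<open>A\<close>.\<close>

definition freely_generated_by ::
    "('r, 'x) ring_scheme \<Rightarrow> ('r, 'm, 'y) module_scheme \<Rightarrow> 'm list \<Rightarrow> bool" where
  "freely_generated_by A M bs \<longleftrightarrow> Module.module A M \<and> set bs \<subseteq> carrier M \<and>
     (\<forall>m\<in>carrier M. \<exists>!c. c \<in> {..<length bs} \<rightarrow>\<^sub>E carrier A \<and>
        m = (\<Oplus>\<^bsub>M\<^esub>i\<in>{..<length bs}. c i \<odot>\<^bsub>M\<^esub> (bs ! i)))"


section \<open>The polynomial ring in three variables\<close>

text \<open>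
  A polynomial maps exponent vectors to coefficients.  Variables are indexed by the type \<open>3\<close>; its
  elements are \<open>1\<close>, \<open>2\<close> and \<open>3\<close>, where \<open>3 = 0\<close>.
\<close>

type_synonym 'a poly3 = "(3 \<Rightarrow>\<^sub>0 nat) \<Rightarrow>\<^sub>0 'a"

definition Cst :: "'a::comm_ring_1 \<Rightarrow> 'a poly3" where
  "Cst c = Poly_Mapping.single 0 c"

definition X :: "3 \<Rightarrow> 'a::comm_ring_1 poly3" where
  "X i = Poly_Mapping.single (Poly_Mapping.single i 1) 1"

text \<open>The algebra homomorphism $F[x_1,x_2,x_3] \to F[x_1,x_2,x_3]$, $x_i \mapsto \sigma_i$.\<close>

definition subst :: "(3 \<Rightarrow> 'a::comm_ring_1 poly3) \<Rightarrow> 'a poly3 \<Rightarrow> 'a poly3" where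
  "subst \<sigma> p =
     (\<Sum>m\<in>Poly_Mapping.keys p. Cst (Poly_Mapping.lookup p m) * (\<Prod>i\<in>UNIV. \<sigma> i ^ Poly_Mapping.lookup m i))"

definition partial :: "3 \<Rightarrow> 'a::comm_ring_1 poly3 \<Rightarrow> 'a poly3" where
  "partial j p = (\<Sum>m\<in>Poly_Mapping.keys p.
     Poly_Mapping.single (m - Poly_Mapping.single j 1)
       (of_nat (Poly_Mapping.lookup m j) * Poly_Mapping.lookup p m))"


section \<open>Differential forms\<close>

text \<open>
  $\Omega = R \otimes \Lambda(V^* )$ is the free $R$-module on the elements $dx_I$,
  $I \subseteq \{1,2,3\}$, where $dx_I$ is the product of the $dx_i$, $i \in I$, in the order $1,2,3$
  of the indices.  The component of \<open>\<omega>\<close> at $dx_I$ is \<open>\<omega> $ I\<close>, and \<open>*s\<close> is multiplication by elements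
  of $R$.
\<close>

type_synonym 'a form = "'a poly3 ^ (3 set)"

definition scalar :: "'a::comm_ring_1 poly3 \<Rightarrow> 'a form" where
  "scalar f = axis {} f"

definition dx :: "3 \<Rightarrow> 'a::comm_ring_1 form" where
  "dx i = axis {i} 1"

text \<open>
  For disjoint \<open>I\<close>, \<open>J\<close>: $dx_I \wedge dx_J = (-1)^n dx_{I \cup J}$, where $n$ is the number of pairs
  $(i,j) \in I \times J$ with $j$ before $i$.
\<close>

definition wedge_sign :: "3 set \<Rightarrow> 3 set \<Rightarrow> 'a::comm_ring_1 poly3" where
  "wedge_sign I J = (-1) ^ card ((J \<times> I) \<inter> {(1,2), (1,3), (2,3)})"

definition wedge :: "'a::comm_ring_1 form \<Rightarrow> 'a form \<Rightarrow> 'a form"  (infixl \<open>\<and>\<^sub>\<Omega>\<close> 75) where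
  "\<omega> \<and>\<^sub>\<Omega> \<eta> = (\<chi> K. \<Sum>I\<in>Pow K. wedge_sign I (K - I) * (\<omega> $ I) * (\<eta> $ (K - I)))"

definition forms_of_degree :: "nat \<Rightarrow> 'a::comm_ring_1 form set" where
  "forms_of_degree k = {\<omega>. \<forall>I. card I \<noteq> k \<longrightarrow> \<omega> $ I = 0}"

definition d :: "'a::comm_ring_1 poly3 \<Rightarrow> 'a form" where
  "d f = (\<Sum>j\<in>UNIV. partial j f *s dx j)"


section \<open>The action of \<open>PSL\<^sub>2(F)\<close>\<close>

definition SL2 :: "('a::field^2^2) monoid" where
  "SL2 = \<lparr>carrier = {g. det g = 1}, mult = (**), one = mat 1\<rparr>"

definition PSL2 :: "('a::field^2^2) set monoid" where
  "PSL2 = SL2 Mod {mat 1, - mat 1}"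

definition trace_zero :: "('a::field^2^2) set" where
  "trace_zero = {v. trace v = 0}"

definition basis_V :: "3 \<Rightarrow> 'a::field^2^2" where
  "basis_V i = (vector
     [vector [vector [0, -1], vector [0, 0]],
      vector [vector [1, 0], vector [0, -1]],
      vector [vector [0, 0], vector [1, 0]]] :: 'a^2^2^3) $ i"

text \<open>The basis of $V^*$ dual to \<open>basis_V\<close>; see the two lemmas that follow.\<close>

definition dual_basis :: "3 \<Rightarrow> 'a::field^2^2 \<Rightarrow> 'a" where
  "dual_basis j v = vector [- (v $ 1 $ 2), v $ 1 $ 1, v $ 2 $ 1] $ j"

lemma dual_basis_basis_V: "dual_basis j (basis_V i) = (if i = j then 1 else 0)"
  using exhaust_3[of i] exhaust_3[of j] by (auto simp: dual_basis_def basis_V_def)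

lemma trace_zero_expansion:
  "v \<in> trace_zero \<longleftrightarrow> v = (\<Sum>i\<in>UNIV. mat (dual_basis i v) ** basis_V i)"
  unfolding trace_zero_def
  by (auto simp: vec_eq_iff forall_2 sum_3 sum_2 dual_basis_def basis_V_def trace_def
        matrix_matrix_mult_def mat_def add_eq_0_iff add_eq_0_iff2)

definition conj_act :: "'a::field^2^2 \<Rightarrow> 'a^2^2 \<Rightarrow> 'a^2^2" where
  "conj_act g v = g ** v ** matrix_inv g"

text \<open>
  Elements of $V^*$ are represented by functions on $2 \times 2$ matrices, of which only the
  restriction to $V$ matters.
\<close>

definition dual_act :: "'a::field^2^2 \<Rightarrow> ('a^2^2 \<Rightarrow> 'a) \<Rightarrow> ('a^2^2 \<Rightarrow> 'a)" where
  "dual_act g \<phi> v = \<phi> (conj_act (matrix_inv g) v)"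

text \<open>
  The embeddings $V^* = R_1 \subseteq R$ and $V^* = \Lambda^1(V^* ) \subseteq \Omega^1$, using
  $\phi = \sum_i \phi(v_i) x_i$.
\<close>

definition dual_to_poly :: "('a::field^2^2 \<Rightarrow> 'a) \<Rightarrow> 'a poly3" where
  "dual_to_poly \<phi> = (\<Sum>i\<in>UNIV. Cst (\<phi> (basis_V i)) * X i)"

definition dual_to_form :: "('a::field^2^2 \<Rightarrow> 'a) \<Rightarrow> 'a form" where
  "dual_to_form \<phi> = (\<Sum>i\<in>UNIV. Cst (\<phi> (basis_V i)) *s dx i)"

definition poly_act :: "'a::field^2^2 \<Rightarrow> 'a poly3 \<Rightarrow> 'a poly3" where
  "poly_act g = subst (\<lambda>j. dual_to_poly (dual_act g (dual_basis j)))"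

text \<open>The element $g \cdot dx_I = (g \cdot dx_{i_1}) \wedge \dots \wedge (g \cdot dx_{i_k})$.\<close>

definition basis_form_act :: "'a::field^2^2 \<Rightarrow> 3 set \<Rightarrow> 'a form" where
  "basis_form_act g I =
     foldr (\<and>\<^sub>\<Omega>) (map (\<lambda>i. dual_to_form (dual_act g (dual_basis i))) (filter (\<lambda>i. i \<in> I) [1, 2, 3]))
       (scalar 1)"

definition form_act :: "'a::field^2^2 \<Rightarrow> 'a form \<Rightarrow> 'a form" where
  "form_act g \<omega> = (\<Sum>I\<in>UNIV. poly_act g (\<omega> $ I) *s basis_form_act g I)"

text \<open>
  An element of \<open>PSL2\<close> is a coset of $\{\pm I\}$; all its members act in the same way, because
  $\{\pm I\}$ acts trivially.
\<close>

definition inv_polys :: "'a::field poly3 set" where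
  "inv_polys = {f. \<forall>C\<in>carrier PSL2. \<forall>g\<in>C. poly_act g f = f}"

definition inv_forms :: "'a::field form set" where
  "inv_forms = {\<omega>. \<forall>C\<in>carrier PSL2. \<forall>g\<in>C. form_act g \<omega> = \<omega>}"

definition RG :: "'a::field poly3 ring" where
  "RG = ring_on inv_polys"

text \<open>The ideal of invariants without constant term.\<close>

definition RG_plus :: "'a::field poly3 set" where
  "RG_plus = {f \<in> inv_polys. Poly_Mapping.lookup f 0 = 0}"

text \<open>$\Omega^G$ as a module over subrings of $R^G$.\<close>

definition OmegaG :: "('a::field poly3, 'a form) module" where
  "OmegaG = \<lparr>carrier = inv_forms, mult = (\<and>\<^sub>\<Omega>), one = scalar 1, zero = 0, add = (+), smult = (*s)\<rparr>"


section \<open>The invariants and the isomorphism \<open>\<phi>\<close>\<close>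

definition f1 :: "'a::{field,finite} poly3" where
  "f1 = X 1 * X 3 - X 2 ^ 2"

definition f2 :: "'a::{field,finite} poly3" where
  "f2 = X 1 ^ CARD('a) * X 3 + X 1 * X 3 ^ CARD('a) - 2 * X 2 ^ (CARD('a) + 1)"

definition L :: "('a::{field,finite} \<times> 'a) set" where
  "L = {(b, c). c \<noteq> 0 \<and> (\<nexists>s. b ^ 2 - 4 * c = s ^ 2)}"

definition f3 :: "'a::{field,finite} poly3" where
  "f3 = (\<Prod>(b, c)\<in>L. X 1 + Cst b * X 2 + Cst c * X 3)"

definition f123 :: "3 \<Rightarrow> 'a::{field,finite} poly3" where
  "f123 i = vector [f1, f2, f3] $ i"

definition f4 :: "'a::{field,finite} poly3" where
  "f4 = det (\<chi> i j. partial j (f123 i))"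

text \<open>The subalgebra $F[f_1,f_2,f_3]$.\<close>

definition \<A> :: "'a::{field,finite} poly3 ring" where
  "\<A> = ring_on (range (subst f123))"

text \<open>
  The $R$-linear map $\Omega^2 \to \Omega^1$ with the values given in \<open>phi_basis\<close> below; the basis
  element of $\Omega^2$ belonging to \<open>{1, 3}\<close> is $dx_1 \wedge dx_3 = - dx_3 \wedge dx_1$.
\<close>

definition phi :: "'a::field form \<Rightarrow> 'a form" where
  "phi \<omega> = (\<omega> $ {2, 3}) *s dx 3 + (- (\<omega> $ {1, 3})) *s (Cst (-2) *s dx 2) + (\<omega> $ {1, 2}) *s dx 1"

lemma phi_basis:
  "phi (dx 2 \<and>\<^sub>\<Omega> dx 3) = dx 3"
  "phi (dx 3 \<and>\<^sub>\<Omega> dx 1) = Cst (-2) *s dx 2"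
  "phi (dx 1 \<and>\<^sub>\<Omega> dx 2) = dx 1"
proof -
  have P: "Pow {a, b} = {{}, {a}, {b}, {a, b}}" for a b :: 3 by auto
  have Q: "({i, j} = {k :: 3}) = (i = k \<and> j = k)" "({k} = {i, j}) = (i = k \<and> j = k)" for i j k
    by auto
  have R: "{2,3} - {2::3} = {3}" "{2,3} - {3::3} = {2}" "{1,3} - {1::3} = {3}" "{1,3} - {3::3} = {1}"
    "{1,2} - {1::3} = {2}" "{1,2} - {2::3} = {1}" by auto
  show "phi (dx 2 \<and>\<^sub>\<Omega> dx 3) = dx 3" "phi (dx 3 \<and>\<^sub>\<Omega> dx 1) = Cst (-2) *s dx 2"
    "phi (dx 1 \<and>\<^sub>\<Omega> dx 2) = dx 1"
    by (simp_all add: phi_def wedge_def dx_def axis_def P Q R wedge_sign_def)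
qed

definition phi_inv :: "'a::field form \<Rightarrow> 'a form" where
  "phi_inv = inv_into (forms_of_degree 2) phi"

end

theory Submission
  imports Defs "HOL-Computational_Algebra.Polynomial_Factorial"
begin

text \<open>
  Let $\rho$ be the reflection $x_2 \mapsto -x_2$; it normalises $G$, fixes $f_1, f_2, f_3$ and negates
  $f_4$.  Restriction to the cone $f_1 = 0$, parametrised by $(s^2, st, t^2)$, turns invariants
  of $G$ into binary forms invariant under $\mathrm{SL}_2(F)$, with $f_1 \mapsto 0$,
  $f_2 \mapsto (s^q t - s t^q)^2$, and $f_3$ going to the product of all monic irreducible quadratic
  forms.  An invariant form that is even in $s$ is a polynomial in these two (subtract a power of the
  second to kill the leading coefficient, then divide by the square), and the kernel of the
  restriction is generated by $f_1$; so the invariants fixed by $\rho$ are exactly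
  $\mathcal{A} = F[f_1,f_2,f_3]$.  An invariant negated by $\rho$ vanishes on the $q$ planes
  $x_2 = b x_1$, hence restricts to a multiple of $(s^q t - s t^q)^q$, which up to a nonzero factor
  is the restriction of $f_4$; so it lies in $f_4\mathcal{A}$.  Thus
  $R^G = \mathcal{A} \oplus f_4 \mathcal{A}$.

  For a $1$-form $\omega$, Cramer's rule gives $f_4\omega = \sum_i g_i\,\mathrm{d}f_i$ with
  $g_i \in R^G$; removing the $f_4\mathcal{A}$-parts of the $g_i$ leaves an $\omega'$ with
  $f_4 \omega' = \sum_i p_i\,\mathrm{d}f_i$, $p_i \in \mathcal{A}$.  The coefficients of $\omega'$ with
  respect to the forms $\phi(\mathrm{d}f_j \wedge \mathrm{d}f_k)$, which are dual to the
  $\mathrm{d}f_i$ up to the factor $-2 f_4$ under the invariant bilinear form on $V^*$, then lie in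
  $\mathcal{A}$, because $\mathcal{A} \cap f_4 \mathcal{A} = 0$.

  Dimension and depth are both bounded by $3$ since any four elements of $R^G$ are algebraically
  dependent, by counting polynomials of bounded degree over the finite field.
\<close>

text \<open>The characteristic divides the order of G, so averaging over G is impossible; the only
  averaging is over the reflection \<rho>, of order 2, and q is odd. The reflection enters because
  the product 2 (q + 1) q (q - 1)/2 of the degrees of f_1, f_2, f_3 is twice the order of G, as it
  must be if they generate the invariants of the group that \<rho> and G generate. The cone serves
  because an invariant becomes there a single polynomial p(z), on which the group acts through z ->
  z + b, z -> a^2 z and the reversal of coefficients. A translation-invariant p with p(0) = 0
  vanishes on all of F, so z^q - z divides it; divisibility and degree bounds then do the work of
  representation theory. The delicate point is that f_4 does not vanish on the cone. Its restriction
  is, up to sign, (z^q - z)^2 times the derivative of the restriction of f_3, and in characteristic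
  p this derivative might vanish; it does not, because the restriction of f_3 is a product of
  distinct irreducible quadratics. A degree count then leaves only a constant cofactor.\<close>

abbreviation lookup where "lookup \<equiv> Poly_Mapping.lookup"
abbreviation keys where "keys \<equiv> Poly_Mapping.keys"
abbreviation single where "single \<equiv> Poly_Mapping.single"

section \<open>Evaluation, homogeneity and derivatives of polynomials\<close>

text \<open>A predicate on plain functions between type-class rings, so that \<open>Cst\<close>,
  substitutions, evaluations, \<open>pcompose\<close> and their composites share the one rule list
  \<open>rhom_simps\<close>.\<close>

definition rhom :: "('a::comm_ring_1 \<Rightarrow> 'b::comm_ring_1) \<Rightarrow> bool" where
  "rhom h \<longleftrightarrow> h 1 = 1 \<and> (\<forall>x y. h (x + y) = h x + h y) \<and> (\<forall>x y. h (x * y) = h x * h y)"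

lemma rhomI:
  assumes "h 1 = 1" "\<And>x y. h (x + y) = h x + h y" "\<And>x y. h (x * y) = h x * h y"
  shows "rhom h"
  using assms by (auto simp: rhom_def)

lemma rhom_one: "rhom h \<Longrightarrow> h 1 = 1"
  and rhom_add: "rhom h \<Longrightarrow> h (x + y) = h x + h y"
  and rhom_mult: "rhom h \<Longrightarrow> h (x * y) = h x * h y"
  by (auto simp: rhom_def)

lemma rhom_zero: "rhom h \<Longrightarrow> h 0 = 0"
  using rhom_add[of h 0 0] by simp

lemma rhom_uminus: "rhom h \<Longrightarrow> h (- x) = - h x"
  using rhom_add[of h x "- x"] by (simp add: rhom_zero eq_neg_iff_add_eq_0 add.commute)

lemma rhom_diff: "rhom h \<Longrightarrow> h (x - y) = h x - h y"
  using rhom_add[of h x "- y"] by (simp add: rhom_uminus)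

lemma rhom_power: "rhom h \<Longrightarrow> h (x ^ n) = h x ^ n"
  by (induction n) (simp_all add: rhom_one rhom_mult)

lemma rhom_sum: "rhom h \<Longrightarrow> h (sum f A) = (\<Sum>x\<in>A. h (f x))"
  by (induction A rule: infinite_finite_induct) (simp_all add: rhom_zero rhom_add)

lemma rhom_prod: "rhom h \<Longrightarrow> h (prod f A) = (\<Prod>x\<in>A. h (f x))"
  by (induction A rule: infinite_finite_induct) (simp_all add: rhom_one rhom_mult)

lemma rhom_of_nat: "rhom h \<Longrightarrow> h (of_nat n) = of_nat n"
  by (induction n) (simp_all add: rhom_zero rhom_one rhom_add)

lemma rhom_numeral: "rhom h \<Longrightarrow> h (numeral n) = numeral n"
  using rhom_of_nat[of h "numeral n"] by simp

lemmas rhom_simps = rhom_zero rhom_one rhom_add rhom_mult rhom_uminus rhom_diff rhom_power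
  rhom_sum rhom_prod rhom_numeral

lemma rhom_id: "rhom (\<lambda>x. x)"
  by (rule rhomI) auto

lemma rhom_comp: "rhom g \<Longrightarrow> rhom h \<Longrightarrow> rhom (\<lambda>x. g (h x))"
  by (rule rhomI) (auto simp: rhom_one rhom_add rhom_mult)

lemma rhom_det:
  fixes M :: "'a::comm_ring_1^3^3"
  assumes "rhom h"
  shows "h (det M) = det (\<chi> i j. h (M $ i $ j))"
  by (simp add: det_3 rhom_simps[OF assms])

lemma rhom_Cst: "rhom Cst"
  by (rule rhomI) (auto simp: Cst_def single_add mult_single)

lemmas Cst_simps = rhom_simps[OF rhom_Cst]

section \<open>Evaluation of polynomials in three variables\<close>

definition mon :: "(3 \<Rightarrow> 'b::comm_ring_1) \<Rightarrow> (3 \<Rightarrow>\<^sub>0 nat) \<Rightarrow> 'b" where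
  "mon \<sigma> m = (\<Prod>i\<in>UNIV. \<sigma> i ^ lookup m i)"

text \<open>Like \<open>subst\<close>, but with the target ring and the map on coefficients left
  free: substitutions, the restriction to the cone, evaluations in two-variable polynomial rings and
  the constant term are all instances.\<close>

definition ins :: "('a::comm_ring_1 \<Rightarrow> 'b::comm_ring_1) \<Rightarrow> (3 \<Rightarrow> 'b) \<Rightarrow> 'a poly3 \<Rightarrow> 'b" where
  "ins h \<sigma> p = (\<Sum>m\<in>keys p. h (lookup p m) * mon \<sigma> m)"

lemma subst_eq_ins: "subst \<sigma> = ins Cst \<sigma>"
  by (auto simp: subst_def ins_def mon_def)

lemma prod_3: "(\<Prod>i\<in>UNIV. f (i::3)) = f 1 * f 2 * (f 3 :: 'b::comm_monoid_mult)"
  unfolding UNIV_3 by (simp add: ac_simps)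

lemma mon_zero [simp]: "mon \<sigma> 0 = 1"
  by (simp add: mon_def)

lemma mon_add: "mon \<sigma> (m + n) = mon \<sigma> m * mon \<sigma> n"
  by (simp add: mon_def lookup_add power_add prod.distrib)

lemma poly3_expand:
  "p = (\<Sum>m\<in>keys p. single m (lookup p m))"
  by (rule poly_mapping_eqI)
    (auto simp: lookup_sum lookup_single when_def sum.delta in_keys_iff)

lemma poly3_induct [case_names single add]:
  fixes p :: "'a::comm_ring_1 poly3"
  assumes "\<And>m c. P (single m c)" "\<And>p q. P p \<Longrightarrow> P q \<Longrightarrow> P (p + q)"
  shows "P p"
proof -
  have "P (\<Sum>m\<in>A. single m (lookup p m))" if "finite A" for A
    using that
  proof induction
    case empty
    then show ?case using assms(1)[of 0 0] by simp
  qed (use assms in auto)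
  from this[OF finite_keys[of p]] show ?thesis by (subst poly3_expand)
qed

lemma ins_superset:
  assumes "rhom h" "finite K" "keys p \<subseteq> K"
  shows "ins h \<sigma> p = (\<Sum>m\<in>K. h (lookup p m) * mon \<sigma> m)"
  unfolding ins_def
  by (rule sum.mono_neutral_left) (use assms in \<open>auto simp: in_keys_iff rhom_zero\<close>)

lemma ins_single:
  assumes "rhom h"
  shows "ins h \<sigma> (single m c) = h c * mon \<sigma> m"
  by (subst ins_superset[of h "{m}"]) (use assms in auto)

lemma ins_add:
  assumes "rhom h"
  shows "ins h \<sigma> (p + q) = ins h \<sigma> p + ins h \<sigma> q"
proof -
  let ?K = "keys p \<union> keys q"
  have "ins h \<sigma> r = (\<Sum>m\<in>?K. h (lookup r m) * mon \<sigma> m)" if "r \<in> {p, q, p + q}" for r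
    using that keys_add[of p q] by (intro ins_superset[OF assms]) auto
  then show ?thesis
    by (simp add: lookup_add rhom_add[OF assms] algebra_simps sum.distrib)
qed

lemma ins_one: "rhom h \<Longrightarrow> ins h \<sigma> 1 = 1"
  using ins_single[of h \<sigma> 0 1] by (simp add: rhom_one)

lemma ins_mult:
  assumes "rhom h"
  shows "ins h \<sigma> (p * q) = ins h \<sigma> p * ins h \<sigma> q"
proof (induction p rule: poly3_induct)
  case (single m c)
  show ?case
  proof (induction q rule: poly3_induct)
    case (single n e)
    show ?case
      by (simp add: mult_single ins_single[OF assms] rhom_mult[OF assms] mon_add algebra_simps)
  qed (simp add: ring_distribs ins_add[OF assms])
qed (simp add: ring_distribs ins_add[OF assms])

lemma rhom_ins: "rhom h \<Longrightarrow> rhom (ins h \<sigma>)"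
  by (rule rhomI) (auto simp: ins_one ins_add ins_mult)

lemma ins_Cst: "rhom h \<Longrightarrow> ins h \<sigma> (Cst c) = h c"
  by (simp add: Cst_def ins_single)

lemma mon_single: "mon \<sigma> (single i k) = \<sigma> i ^ k"
proof -
  have "mon \<sigma> (single i k) = (\<Prod>j\<in>UNIV. if i = j then \<sigma> j ^ k else 1)"
    unfolding mon_def by (rule prod.cong) (auto simp: lookup_single when_def)
  then show ?thesis by simp
qed

lemma ins_X: "rhom h \<Longrightarrow> ins h \<sigma> (X i) = \<sigma> i"
  by (simp add: X_def ins_single mon_single rhom_one)

lemma mon_X: "mon X m = single m 1"
proof -
  have *: "X i ^ k = single (single i k) 1" for i k
    by (induction k) (auto simp: X_def mult_single single_add[symmetric] add.commute)
  have "m = single 1 (lookup m 1) + single 2 (lookup m 2)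
     + single 3 (lookup m 3)"
  proof (rule poly_mapping_eqI)
    fix k :: 3
    show "lookup m k = lookup (single 1 (lookup m 1) + single 2 (lookup m 2)
     + single 3 (lookup m 3)) k"
      using exhaust_3[of k] by (auto simp: lookup_add lookup_single)
  qed
  then have "single m (1::'a) = single (single 1 (lookup m 1) + single 2 (lookup m 2)
     + single 3 (lookup m 3)) 1"
    by (rule arg_cong)
  also have "\<dots> = single (single 1 (lookup m 1)) 1
     * single (single 2 (lookup m 2)) 1
     * single (single 3 (lookup m 3)) (1::'a)"
    by (simp add: mult_single)
  also have "\<dots> = mon X m"
    by (simp only: mon_def prod_3 *)
  finally show ?thesis ..
qed

lemma single_eq_mon: "single m c = Cst c * mon X m"
  by (simp add: mon_X Cst_def mult_single)

text \<open>Universal property of the polynomial ring; composites of evaluations are compared by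
  looking at constants and variables only.\<close>

lemma rhom_eq_ins:
  assumes "rhom \<phi>"
  shows "\<phi> p = ins (\<lambda>c. \<phi> (Cst c)) (\<lambda>i. \<phi> (X i)) p"
proof -
  have h: "rhom (\<lambda>c. \<phi> (Cst c))" by (rule rhom_comp[OF assms rhom_Cst])
  show ?thesis
  proof (induction p rule: poly3_induct)
    case (single m c)
    show ?case
      by (simp add: ins_single[OF h]) (simp add: single_eq_mon rhom_simps[OF assms] mon_def)
  qed (simp add: rhom_add[OF assms] ins_add[OF h])
qed

lemma rhom_ext:
  assumes "rhom \<phi>" "rhom \<psi>" "\<And>c. \<phi> (Cst c) = \<psi> (Cst c)" "\<And>i. \<phi> (X i) = \<psi> (X i)"
  shows "\<phi> p = \<psi> p"
  using rhom_eq_ins[OF assms(1), of p] rhom_eq_ins[OF assms(2), of p] assms(3,4) by simp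

lemma ins_ins:
  assumes "rhom h" "rhom k"
  shows "ins h \<sigma> (ins k \<tau> p) = ins (\<lambda>c. ins h \<sigma> (k c)) (\<lambda>i. ins h \<sigma> (\<tau> i)) p"
  using rhom_eq_ins[OF rhom_comp[OF rhom_ins[OF assms(1)] rhom_ins[OF assms(2)]], of \<sigma> \<tau> p] assms
  by (simp add: ins_Cst ins_X)

lemma ins_subst:
  assumes "rhom h"
  shows "ins h \<sigma> (subst \<tau> p) = ins h (\<lambda>i. ins h \<sigma> (\<tau> i)) p"
  by (simp add: subst_eq_ins ins_ins assms rhom_Cst ins_Cst)

lemma rhom_subst: "rhom (subst \<sigma>)"
  by (simp add: subst_eq_ins rhom_ins rhom_Cst)

lemmas subst_simps = rhom_simps[OF rhom_subst]

lemma subst_Cst [simp]: "subst \<sigma> (Cst c) = Cst c"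
  and subst_X [simp]: "subst \<sigma> (X i) = \<sigma> i"
  by (simp_all add: subst_eq_ins ins_Cst ins_X rhom_Cst)

lemma subst_subst: "subst \<sigma> (subst \<tau> p) = subst (\<lambda>i. subst \<sigma> (\<tau> i)) p"
  using ins_subst[OF rhom_Cst, of \<sigma> \<tau> p] by (simp add: subst_eq_ins)

lemma subst_X_id: "subst X p = p"
  using rhom_eq_ins[OF rhom_id, of p] by (simp add: subst_eq_ins)

lemma poly3_ring_induct [case_names Cst X add mult]:
  fixes p :: "'a::comm_ring_1 poly3"
  assumes C: "\<And>c. P (Cst c)" and V: "\<And>i. P (X i)"
    and A: "\<And>p q. P p \<Longrightarrow> P q \<Longrightarrow> P (p + q)" and M: "\<And>p q. P p \<Longrightarrow> P q \<Longrightarrow> P (p * q)"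
  shows "P p"
proof (induction p rule: poly3_induct)
  case (single m c)
  have pw: "P (X i ^ k)" for i k
    by (induction k) (use C[of 1] V M in \<open>auto simp: Cst_simps\<close>)
  show ?case
    unfolding single_eq_mon mon_def prod_3 using C pw M by auto
qed (use A in auto)

subsection \<open>Homogeneous components\<close>

definition mdeg :: "(3 \<Rightarrow>\<^sub>0 nat) \<Rightarrow> nat" where
  "mdeg m = (\<Sum>i\<in>UNIV. lookup m i)"

definition homog :: "nat \<Rightarrow> 'a::comm_ring_1 poly3 \<Rightarrow> bool" where
  "homog n p \<longleftrightarrow> (\<forall>m\<in>keys p. mdeg m = n)"

definition hcomp :: "nat \<Rightarrow> 'a::comm_ring_1 poly3 \<Rightarrow> 'a poly3" where
  "hcomp n p = (\<Sum>m\<in>{m\<in>keys p. mdeg m = n}. single m (lookup p m))"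

lemma mdeg_zero [simp]: "mdeg 0 = 0"
  and mdeg_add: "mdeg (m + n) = mdeg m + mdeg n"
  by (simp_all add: mdeg_def lookup_add sum.distrib)

lemma mdeg_single [simp]: "mdeg (single i k) = k"
  using exhaust_3[of i] by (auto simp: mdeg_def lookup_single sum_3)

lemma lookup_hcomp: "lookup (hcomp n p) m = (if mdeg m = n then lookup p m else 0)"
  by (auto simp: hcomp_def lookup_sum lookup_single when_def sum.delta in_keys_iff)

lemma homog_hcomp: "homog n (hcomp n p)"
  by (auto simp: homog_def in_keys_iff lookup_hcomp split: if_splits)

lemma hcomp_add: "hcomp n (p + q) = hcomp n p + hcomp n q"
  by (rule poly_mapping_eqI) (auto simp: lookup_hcomp lookup_add)

lemma homog_iff_hcomp: "homog n p \<longleftrightarrow> hcomp n p = p"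
proof
  assume "homog n p"
  then show "hcomp n p = p"
    by (intro poly_mapping_eqI) (auto simp: homog_def in_keys_iff lookup_hcomp)
next
  assume "hcomp n p = p"
  then show "homog n p" using homog_hcomp[of n p] by simp
qed

lemma hcomp_homog: "homog k p \<Longrightarrow> hcomp n p = (if n = k then p else 0)"
  by (rule poly_mapping_eqI) (auto simp: homog_def in_keys_iff lookup_hcomp)

lemma homog_zero [simp]: "homog n 0"
  by (simp add: homog_def)

lemma homog_add: "homog n p \<Longrightarrow> homog n q \<Longrightarrow> homog n (p + q)"
  by (simp add: homog_iff_hcomp hcomp_add)

lemma homog_uminus: "homog n p \<Longrightarrow> homog n (- p)"
  by (auto simp: homog_def in_keys_iff)

lemma homog_diff: "homog n p \<Longrightarrow> homog n q \<Longrightarrow> homog n (p - q)"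
  using homog_add[of n p "- q"] homog_uminus by auto

lemma homog_sum: "(\<And>x. x \<in> A \<Longrightarrow> homog n (f x)) \<Longrightarrow> homog n (sum f A)"
  by (induction A rule: infinite_finite_induct) (auto intro: homog_add)

lemma homog_mult: "homog n p \<Longrightarrow> homog k q \<Longrightarrow> homog (n + k) (p * q)"
  using keys_mult[of p q] by (fastforce simp: homog_def mdeg_add)

lemma homog_single: "homog (mdeg m) (single m c)"
  by (auto simp: homog_def)

lemma homog_Cst: "homog 0 (Cst c)"
  using homog_single[of 0 c] by (simp add: Cst_def)

lemma homog_Cst_mult: "homog n p \<Longrightarrow> homog n (Cst c * p)"
  using homog_mult[OF homog_Cst] by fastforce

lemma homog_X: "homog 1 (X i)"
  using homog_single[of "single i 1" 1] by (simp add: X_def)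

lemma homog_one: "homog 0 1"
  using homog_Cst[of 1] by (simp add: Cst_simps)

lemma homog_power: "homog n p \<Longrightarrow> homog (n * k) (p ^ k)"
  by (induction k) (auto simp: homog_one intro: homog_mult)

lemma homog_prod: "(\<And>x. x \<in> A \<Longrightarrow> homog (e x) (f x)) \<Longrightarrow> finite A \<Longrightarrow> homog (sum e A) (prod f A)"
  by (induction A rule: infinite_finite_induct) (auto simp: homog_one intro: homog_mult)

lemma hcomp_sum_eq: "finite (mdeg ` keys p) \<Longrightarrow> (\<Sum>n\<in>mdeg ` keys p. hcomp n p) = p"
  by (rule poly_mapping_eqI) (auto simp: lookup_sum lookup_hcomp in_keys_iff)

lemma homog_induct [case_names homog add]:
  fixes p :: "'a::comm_ring_1 poly3"
  assumes "\<And>n p. homog n p \<Longrightarrow> P p" "\<And>p q. P p \<Longrightarrow> P q \<Longrightarrow> P (p + q)"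
  shows "P p"
  by (induction p rule: poly3_induct) (use assms homog_single in blast)+

lemma sum_hcomp:
  obtains A where "finite A" "p = (\<Sum>n\<in>A. hcomp n p)"
  using that[of "mdeg ` keys p"] hcomp_sum_eq[of p] by auto

lemma homog_mon: "(\<And>i. homog 1 (\<sigma> i)) \<Longrightarrow> homog (mdeg m) (mon \<sigma> m)"
  unfolding mon_def mdeg_def
  by (rule homog_prod) (use homog_power[of 1] in force)+

lemma homog_subst:
  assumes "\<And>i. homog 1 (\<sigma> i)" "homog n p"
  shows "homog n (subst \<sigma> p)"
  unfolding subst_eq_ins ins_def
  by (rule homog_sum, rule homog_Cst_mult) (use assms(2) homog_mon[OF assms(1)] in \<open>auto simp: homog_def[of _ p]\<close>)

lemma hcomp_subst:
  assumes "\<And>i. homog 1 (\<sigma> i)"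
  shows "hcomp n (subst \<sigma> p) = subst \<sigma> (hcomp n p)"
  by (induction p rule: homog_induct)
    (auto simp: hcomp_add subst_simps hcomp_homog dest: homog_subst[OF assms] simp: hcomp_homog[OF homog_subst[OF assms]])

lemma ins_scale:
  assumes "rhom h" "homog n f"
  shows "ins h (\<lambda>i. k * \<sigma> i) f = k ^ n * ins h \<sigma> f"
proof -
  have "mon (\<lambda>i. k * \<sigma> i) m = k ^ mdeg m * mon \<sigma> m" for m
    by (simp add: mon_def mdeg_def power_mult_distrib prod.distrib power_sum)
  then show ?thesis
    using assms(2) by (auto simp: ins_def homog_def sum_distrib_left algebra_simps intro!: sum.cong)
qed

subsection \<open>Partial derivatives\<close>

lemma partial_superset:
  assumes "finite K" "keys p \<subseteq> K"
  shows "partial j p = (\<Sum>m\<in>K. single (m - single j 1)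
     (of_nat (lookup m j) * lookup p m))"
  unfolding partial_def
  by (rule sum.mono_neutral_left) (use assms in \<open>auto simp: in_keys_iff\<close>)

lemma partial_add: "partial j (p + q) = partial j p + partial j q"
proof -
  let ?K = "keys p \<union> keys q"
  have "partial j r = (\<Sum>m\<in>?K. single (m - single j 1)
     (of_nat (lookup m j) * lookup r m))" if "r \<in> {p, q, p + q}" for r
    using that keys_add[of p q] by (intro partial_superset) auto
  then show ?thesis
    by (simp add: lookup_add algebra_simps single_add sum.distrib)
qed

lemma partial_single: "partial j (single m c) =
    single (m - single j 1) (of_nat (lookup m j) * c)"
  by (subst partial_superset[of "{m}"]) auto

lemma shift_single:
  fixes m n :: "3 \<Rightarrow>\<^sub>0 nat"
  assumes "lookup m j \<noteq> 0"
  shows "m - single j 1 + n = m + n - single j 1"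
  by (rule poly_mapping_eqI) (use assms in \<open>auto simp: lookup_add lookup_minus lookup_single when_def\<close>)

lemma partial_mult: "partial j (p * q) = partial j p * q + p * partial j q"
proof (induction p rule: poly3_induct)
  case (single m c)
  show ?case
  proof (induction q rule: poly3_induct)
    case (single n e)
    \<comment> \<open>Subtraction of exponents is truncated, but where it truncates the coefficient
      is 0.\<close>
    have 1: "single (m - single j 1 + n) (of_nat (lookup m j) * c * e)
      = single (m + n - single j 1) (of_nat (lookup m j) * c * e)"
      using shift_single[of m j n] by (cases "lookup m j = 0") auto
    have 2: "single (m + (n - single j 1)) (c * (of_nat (lookup n j) * e))
      = single (m + n - single j 1) (c * (of_nat (lookup n j) * e))"
      using shift_single[of n j m] by (cases "lookup n j = 0") (auto simp: add.commute)
    have "partial j (single (m + n) (c * e))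
      = single (m + n - single j 1) (of_nat (lookup m j) * c * e)
      + single (m + n - single j 1) (c * (of_nat (lookup n j) * e))"
      unfolding partial_single single_add[symmetric]
      by (rule arg_cong) (simp add: lookup_add algebra_simps)
    then show ?case
      by (simp only: mult_single partial_single 1 2)
  qed (simp add: ring_distribs partial_add)
qed (simp add: ring_distribs partial_add)

lemma partial_Cst [simp]: "partial j (Cst c) = 0"
  by (simp add: Cst_def partial_single)

lemma partial_X: "partial j (X i) = (if i = j then 1 else 0)"
proof -
  have "partial j (X i) = single (single i 1 - single j 1) (if i = j then 1 else 0)"
    by (auto simp: X_def partial_single lookup_single)
  then show ?thesis by auto
qed

lemma partial_uminus: "partial j (- p) = - partial j p"
proof -
  have "partial j (- p + p) = 0" using partial_Cst[of j 0] by (simp only: Cst_simps left_minus)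
  then show ?thesis by (simp only: partial_add eq_neg_iff_add_eq_0)
qed

lemma partial_diff: "partial j (p - q) = partial j p - partial j q"
  using partial_add[of j p "- q"] by (simp add: partial_uminus)

lemma partial_one: "partial j 1 = 0"
  using partial_Cst[of j 1] by (simp add: Cst_simps)

lemma partial_power: "partial j (p ^ n) = of_nat n * p ^ (n - 1) * partial j p"
proof (induction n)
  case (Suc n)
  then show ?case
    by (cases n) (simp_all add: partial_mult algebra_simps)
qed (simp add: partial_one)

text \<open>For an arbitrary derivation \<open>\<delta>\<close> that kills the constants: it is
  applied to partial derivatives after a linear substitution and to \<open>pderiv\<close> along the
  cone.\<close>

lemma chain_rule:
  assumes h: "rhom h" and add: "\<And>x y. \<delta> (x + y) = \<delta> x + \<delta> y"
    and mult: "\<And>x y. \<delta> (x * y) = \<delta> x * y + x * \<delta> y" and const: "\<And>c. \<delta> (h c) = 0"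
  shows "\<delta> (ins h \<sigma> f) = (\<Sum>j\<in>UNIV. ins h \<sigma> (partial j f) * \<delta> (\<sigma> j))"
proof (induction f rule: poly3_ring_induct)
  case (X i)
  have "(\<Sum>j\<in>UNIV. ins h \<sigma> (partial j (X i)) * \<delta> (\<sigma> j)) = (\<Sum>j\<in>UNIV. if i = j then \<delta> (\<sigma> j) else 0)"
    by (rule sum.cong) (auto simp: partial_X rhom_simps[OF rhom_ins[OF h]])
  then show ?case by (simp add: ins_X h)
qed (simp_all add: ins_Cst h const rhom_simps[OF rhom_ins[OF h]] add mult partial_add partial_mult
      algebra_simps sum.distrib sum_distrib_left)

lemma homog_partial:
  assumes "homog n f" shows "homog (n - 1) (partial j f)"
  unfolding partial_def
proof (rule homog_sum)
  fix m assume m: "m \<in> keys f"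
  let ?t = "single (m - single j 1) (of_nat (lookup m j) * lookup f m)"
  show "homog (n - 1) ?t"
  proof (cases "lookup m j = 0")
    case False
    have "mdeg (m - single j 1) = n - 1"
    proof -
      have "m = (m - single j 1) + single j 1"
        using shift_single[OF False, of "single j 1"] by simp
      then have "mdeg m = mdeg (m - single j 1) + 1" by (metis mdeg_add mdeg_single)
      then show ?thesis using assms m by (auto simp: homog_def)
    qed
    then show ?thesis by (metis homog_single)
  qed simp
qed

text \<open>Meant for \<open>f3\<close>, whose degree is 0 in F, so that the relation between its
  partial derivatives becomes homogeneous.\<close>

lemma euler:
  assumes "homog n f"
  shows "(\<Sum>j\<in>UNIV. X j * partial j f) = of_nat n * f"
proof -
  have *: "X j * partial j (single m c) = single m (of_nat (lookup m j) * c)" for j m c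
  proof (cases "lookup m j = 0")
    case False
    have "single j 1 + (m - single j 1) = m"
      using shift_single[OF False, of "single j 1"] by (simp add: add.commute)
    then show ?thesis by (simp add: X_def partial_single mult_single del: One_nat_def)
  qed (simp add: partial_single)
  have single: "(\<Sum>j\<in>UNIV. X j * partial j (single m c)) = of_nat (mdeg m) * single m c" for m and c :: 'a
  proof -
    have "of_nat (mdeg m) * single m c = single m (of_nat (mdeg m) * c)"
      by (simp only: single_of_nat[symmetric] mult_single add_0)
    then show ?thesis
      by (simp only: * mdeg_def sum_3 of_nat_add distrib_right single_add)
  qed
  have "(\<Sum>j\<in>UNIV. X j * partial j (\<Sum>m\<in>A. single m (lookup f m)))
      = of_nat n * (\<Sum>m\<in>A. single m (lookup f m))"
    if "finite A" "A \<subseteq> keys f" for A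
    using that
  proof (induction A)
    case empty
    have "partial j 0 = (0::'a poly3)" for j using partial_Cst[of j 0] by (simp add: Cst_simps)
    then show ?case by simp
  next
    case (insert m A)
    then show ?case using assms
      by (simp add: partial_add ring_distribs sum.distrib single homog_def)
  qed
  from this[OF finite_keys order_refl] show ?thesis by (simp flip: poly3_expand)
qed

section \<open>Finite fields\<close>

lemma finite_field_pow_card:
  fixes x :: "'a::{field,finite}"
  shows "x ^ CARD('a) = x"
proof (cases "x = 0")
  case False
  let ?U = "UNIV - {0::'a}"
  have bij: "bij_betw ((*) x) ?U ?U"
    by (rule bij_betw_byWitness[where f' = "\<lambda>y. y / x"]) (use False in auto)
  have "(\<Prod>y\<in>?U. y) = (\<Prod>y\<in>?U. x * y)"
    using prod.reindex_bij_betw[OF bij, of "\<lambda>y. y"] by simp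
  also have "\<dots> = x ^ card ?U * (\<Prod>y\<in>?U. y)"
    by (simp add: prod.distrib)
  finally have "x ^ card ?U = 1" by simp
  moreover have "CARD('a) = Suc (card ?U)"
    by (rule card.remove) auto
  ultimately show ?thesis by (simp only: power_Suc mult_1_right)
qed simp

lemma card_field_gt_1: "CARD('a::{field,finite}) > 1"
  using card_mono[of "UNIV :: 'a set" "{0, 1}"] by simp

lemma poly_eq_0_if_card_roots:
  fixes p :: "'a::idom poly"
  assumes "\<And>a. a \<in> A \<Longrightarrow> poly p a = 0" "degree p < card A"
  shows "p = 0"
proof (rule ccontr)
  assume "p \<noteq> 0"
  then have "card {x. poly p x = 0} \<le> degree p" "finite {x. poly p x = 0}"
    by (auto intro: card_poly_roots_bound poly_roots_finite)
  moreover from this have "card A \<le> card {x. poly p x = 0}"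
    using assms(1) by (intro card_mono) auto
  ultimately show False using assms(2) by simp
qed

text \<open>The polynomial $(T + 1)^q - T^q - 1$ has degree less than $q$ and vanishes at all
  elements of the field.\<close>

lemma finite_field_binomial:
  assumes "0 < i" "i < CARD('a::{field,finite})"
  shows "of_nat (CARD('a) choose i) = (0::'a)"
proof -
  let ?q = "CARD('a)"
  define p where "p = [:1, 1:] ^ ?q - monom (1::'a) ?q - 1"
  have q: "?q > 1" by (rule card_field_gt_1)
  have coeff: "coeff p j = of_nat (?q choose j) - (if j = ?q then 1 else 0) - (if j = 0 then 1 else 0)" if "j \<le> ?q" for j
    using that by (simp add: p_def coeff_linear_poly_power)
  have "coeff p j = 0" if "j \<ge> ?q" for j
  proof (cases "j = ?q")
    case False
    have "degree ([:1, 1:] ^ ?q :: 'a poly) \<le> ?q" using degree_power_le[of "[:1, 1:]" ?q] by simp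
    with that False q show ?thesis by (simp add: p_def coeff_eq_0)
  qed (use q in \<open>simp add: coeff\<close>)
  then have "degree p < ?q"
    using q by (intro degree_lessI) auto
  moreover have "poly p a = 0" for a
    by (simp add: p_def poly_monom finite_field_pow_card)
  ultimately have "p = 0" by (intro poly_eq_0_if_card_roots[of UNIV]) auto
  then show ?thesis using coeff[of i] assms by simp
qed

text \<open>The binomial coefficients vanish in F and are carried along \<open>h\<close>; the map
  \<open>h\<close> only records that the target ring lies over F.\<close>

lemma frobenius_add:
  fixes h :: "'a::{field,finite} \<Rightarrow> 'b::comm_ring_1"
  assumes "rhom h"
  shows "(x + y) ^ CARD('a) = x ^ CARD('a) + (y ^ CARD('a) :: 'b)"
proof -
  let ?q = "CARD('a)"
  have 0: "of_nat (?q choose i) = (0::'b)" if "0 < i" "i < ?q" for i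
    using finite_field_binomial[OF that] rhom_of_nat[OF assms, of "?q choose i"] rhom_zero[OF assms] by simp
  have "(x + y) ^ ?q = (\<Sum>i\<le>?q. of_nat (?q choose i) * x ^ i * y ^ (?q - i))"
    by (rule binomial_ring)
  also have "\<dots> = (\<Sum>i\<in>{0, ?q}. of_nat (?q choose i) * x ^ i * y ^ (?q - i))"
  proof (rule sum.mono_neutral_right)
    show "\<forall>i\<in>{..?q} - {0, ?q}. of_nat (?q choose i) * x ^ i * y ^ (?q - i) = 0"
    proof
      fix i assume "i \<in> {..?q} - {0, ?q}"
      then have "0 < i" "i < ?q" by auto
      then show "of_nat (?q choose i) * x ^ i * y ^ (?q - i) = 0" by (simp add: 0)
    qed
  qed auto
  also have "\<dots> = x ^ ?q + y ^ ?q"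
    by (simp add: add.commute)
  finally show ?thesis .
qed

lemma of_nat_card_eq_0: "of_nat CARD('a::{field,finite}) = (0::'a)"
  using finite_field_binomial[of 1, where 'a = 'a] card_field_gt_1[where 'a = 'a] by simp

lemma two_neq_0:
  assumes "odd CARD('a::{field,finite})"
  shows "(2::'a) \<noteq> 0"
proof
  assume 2: "(2::'a) = 0"
  obtain k where k: "CARD('a) = 2 * k + 1" using assms by (rule oddE)
  have "(0::'a) = 2 * of_nat k + 1" using of_nat_card_eq_0[where 'a = 'a] by (simp add: k add.commute)
  then show False by (simp add: 2)
qed

lemma card_field_ge_3: "odd CARD('a::{field,finite}) \<Longrightarrow> CARD('a) \<ge> 3"
  using card_field_gt_1[where 'a = 'a] by (cases "CARD('a) = 2") auto

section \<open>Linear substitutions and the action\<close>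

definition linact :: "'a::comm_ring_1^3^3 \<Rightarrow> 3 \<Rightarrow> 'a poly3" where
  "linact M i = (\<Sum>j\<in>UNIV. Cst (M $ i $ j) * X j)"

lemma homog_linact: "homog 1 (linact M i)"
  unfolding linact_def by (intro homog_sum homog_Cst_mult homog_X)

text \<open>Row i of the matrix is the image of x_i, so the matrix of the inner substitution
  multiplies from the left.\<close>

lemma subst_linact: "subst (linact M) (linact N i) = linact (N ** M) i"
  by (simp add: linact_def subst_simps matrix_matrix_mult_def Cst_simps sum_3 algebra_simps)

lemma subst_linact_linact: "subst (linact M) (subst (linact N) p) = subst (linact (N ** M)) p"
  by (simp add: subst_subst subst_linact)

lemma linact_mat_1: "linact (mat 1) = X"
proof
  fix i show "linact (mat 1) i = (X i :: 'a poly3)"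
    using exhaust_3[of i] by (auto simp: linact_def mat_def sum_3 Cst_simps)
qed

text \<open>The matrix of g = (a b; c e) on x_1, x_2, x_3 when g has determinant 1. It is the
  symmetric square of s -> e s - b t, t -> a t - c s, with (x_1, x_2, x_3) behaving like (s^2, s t,
  t^2); hence the parametrisation of the cone is equivariant.\<close>

definition slm :: "'a::field \<Rightarrow> 'a \<Rightarrow> 'a \<Rightarrow> 'a \<Rightarrow> 'a^3^3" where
  "slm a b c e = vector [vector [e\<^sup>2, - 2 * b * e, b\<^sup>2],
     vector [- c * e, a * e + b * c, - a * b], vector [c\<^sup>2, - 2 * a * c, a\<^sup>2]]"

definition refl_mat :: "'a::field^3^3" where
  "refl_mat = vector [vector [1, 0, 0], vector [0, - 1, 0], vector [0, 0, 1]]"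

lemma slm_mult:
  "slm a b c e ** slm a' b' c' d' =
     slm (a' * a + b' * c) (a' * b + b' * e) (c' * a + d' * c) (c' * b + d' * e)"
  by (simp add: vec_eq_iff forall_3 matrix_matrix_mult_def sum_3 slm_def vector_3)
    (simp add: power2_eq_square algebra_simps)

lemma det_slm: "det (slm a b c e) = (a * e - b * c) ^ 3"
  by (simp add: det_3 slm_def vector_3) (simp add: power2_eq_square power3_eq_cube algebra_simps)

lemma det_refl: "det (refl_mat :: 'a::field^3^3) = - 1"
  by (simp add: det_3 refl_mat_def vector_3)

section \<open>The action in coordinates and a criterion for invariance\<close>

lemma matrix_inv_2:
  fixes g :: "'a::field^2^2"
  assumes "det g = 1"
  shows "matrix_inv g = vector [vector [g $ 2 $ 2, - (g $ 1 $ 2)], vector [- (g $ 2 $ 1), g $ 1 $ 1]]"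
proof -
  define h :: "'a^2^2" where
    "h = vector [vector [g $ 2 $ 2, - (g $ 1 $ 2)], vector [- (g $ 2 $ 1), g $ 1 $ 1]]"
  have h: "g ** h = mat 1" "h ** g = mat 1"
    using assms
    by (auto simp: h_def vec_eq_iff forall_2 matrix_matrix_mult_def sum_2 mat_def det_2 algebra_simps)
  then have "g ** matrix_inv g = mat 1"
    unfolding matrix_inv_def by (metis (mono_tags, lifting) someI)
  then have "matrix_inv g = h"
    by (metis h(2) matrix_mul_assoc matrix_mul_lid matrix_mul_rid)
  then show ?thesis by (simp add: h_def)
qed

lemma det_matrix_inv_2:
  fixes g :: "'a::field^2^2"
  assumes "det g = 1"
  shows "det (matrix_inv g) = 1"
  using assms by (simp add: matrix_inv_2 det_2 vector_2 algebra_simps)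

lemma dual_act_dual_basis:
  fixes g :: "'a::field^2^2"
  assumes "det g = 1"
  shows "dual_act g (dual_basis i) (basis_V j) = slm (g $ 1 $ 1) (g $ 1 $ 2) (g $ 2 $ 1) (g $ 2 $ 2) $ i $ j"
proof -
  define h where "h = matrix_inv g"
  have h: "h = vector [vector [g $ 2 $ 2, - (g $ 1 $ 2)], vector [- (g $ 2 $ 1), g $ 1 $ 1]]"
    by (simp add: h_def matrix_inv_2[OF assms])
  have "matrix_inv h = g"
    unfolding h_def matrix_inv_2[OF det_matrix_inv_2[OF assms]]
    by (simp add: matrix_inv_2[OF assms] vec_eq_iff forall_2)
  then have "dual_act g (dual_basis i) (basis_V j) = dual_basis i (h ** basis_V j ** g)"
    by (simp add: dual_act_def conj_act_def h_def)
  then show ?thesis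
    using exhaust_3[of i] exhaust_3[of j]
    by (auto simp: h dual_basis_def basis_V_def sum_2
        matrix_matrix_mult_def slm_def power2_eq_square algebra_simps)
qed

lemma poly_act_eq:
  assumes "det g = 1"
  shows "poly_act g = subst (linact (slm (g $ 1 $ 1) (g $ 1 $ 2) (g $ 2 $ 1) (g $ 2 $ 2)))"
  unfolding poly_act_def dual_to_poly_def linact_def
  by (simp add: dual_act_dual_basis[OF assms])

text \<open>Both members of a coset have determinant 1, so invariance under PSL_2 is a condition on
  all matrices of determinant 1.\<close>

lemma Union_PSL2: "(\<Union>C\<in>carrier PSL2. C) = {g::'a::field^2^2. det g = 1}"
proof -
  have "det (- mat 1 :: 'a^2^2) = 1" by (simp add: det_2 mat_def)
  then have "det (- g) = det g" for g :: "'a^2^2"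
    by (simp add: det_2)
  then show ?thesis
    by (auto simp: PSL2_def FactGroup_def RCOSETS_def r_coset_def SL2_def det_mul det_I)
qed

lemma ball_PSL2:
  "(\<forall>C\<in>carrier PSL2. \<forall>g\<in>C. P g) \<longleftrightarrow> (\<forall>g::'a::field^2^2. det g = 1 \<longrightarrow> P g)"
  using Union_PSL2[where 'a = 'a] by blast

lemma ball_SL2_entries:
  "(\<forall>g::'a::field^2^2. det g = 1 \<longrightarrow> P (slm (g $ 1 $ 1) (g $ 1 $ 2) (g $ 2 $ 1) (g $ 2 $ 2)))
    \<longleftrightarrow> (\<forall>a b c d. a * d - b * c = 1 \<longrightarrow> P (slm a b c d))" (is "?l = ?r")
proof
  assume l: ?l
  show ?r
  proof (intro allI impI)
    fix a b c d :: 'a assume "a * d - b * c = 1"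
    then show "P (slm a b c d)"
      using l[rule_format, of "vector [vector [a, b], vector [c, d]]"] by (simp add: det_2 vector_2)
  qed
qed (simp add: det_2)

lemma inv_polys_iff:
  fixes f :: "'a::field poly3"
  shows "f \<in> inv_polys \<longleftrightarrow> (\<forall>a b c d. a * d - b * c = 1 \<longrightarrow> subst (linact (slm a b c d)) f = f)"
proof -
  have "f \<in> inv_polys \<longleftrightarrow> (\<forall>g::'a^2^2. det g = 1 \<longrightarrow>
      subst (linact (slm (g $ 1 $ 1) (g $ 1 $ 2) (g $ 2 $ 1) (g $ 2 $ 2))) f = f)"
    unfolding inv_polys_def mem_Collect_eq ball_PSL2 by (simp add: poly_act_eq)
  then show ?thesis
    using ball_SL2_entries[of "\<lambda>M. subst (linact M) f = f"] by simp
qed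

text \<open>$\mathrm{SL}_2$ is generated by the upper unipotent matrices and the Weyl element $w$, and
  the lower unipotent matrices are conjugate under $w$ to upper ones.\<close>

lemma inv_polys_criterion:
  fixes f :: "'a::field poly3"
  assumes U: "\<And>t. subst (linact (slm 1 t 0 1)) f = f"
    and W: "subst (linact (slm 0 1 (- 1) 0)) f = Cst \<kappa> * f" and "\<kappa> \<noteq> 0"
  shows "f \<in> inv_polys"
proof -
  \<comment> \<open>The constant \<open>\<kappa>\<close> cancels under conjugation by w. From here
    on only unipotent matrices are used, and these already generate SL_2.\<close>
  have lower: "subst (linact (slm 1 0 t 1)) f = f" for t
  proof -
    have "slm 1 (- t) 0 1 ** slm 0 1 (- 1) 0 = slm 0 1 (- 1) t"
      "slm 0 1 (- 1) 0 ** slm 1 0 t 1 = slm 0 1 (- 1) t"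
      by (simp_all add: slm_mult)
    then have "subst (linact (slm 1 0 t 1)) (subst (linact (slm 0 1 (- 1) 0)) f)
      = subst (linact (slm 0 1 (- 1) 0)) (subst (linact (slm 1 (- t) 0 1)) f)"
      by (simp add: subst_linact_linact)
    then have "Cst \<kappa> * subst (linact (slm 1 0 t 1)) f = Cst \<kappa> * f"
      by (simp add: U W subst_simps)
    then have "Cst (inverse \<kappa> * \<kappa>) * subst (linact (slm 1 0 t 1)) f = Cst (inverse \<kappa> * \<kappa>) * f"
      unfolding Cst_simps mult.assoc by (rule arg_cong)
    then show ?thesis using \<open>\<kappa> \<noteq> 0\<close> by (simp add: Cst_simps)
  qed
  \<comment> \<open>For c \<noteq> 0 the matrix is a product of an upper, a lower and an upper
    unipotent matrix; \<open>p\<close> and \<open>r\<close> are forced by the diagonal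
    entries.\<close>
  have c: "subst (linact (slm a b c d)) f = f" if "a * d - b * c = 1" "c \<noteq> 0" for a b c d
  proof -
    have b: "b = (a * d - 1) / c" using that by (simp add: field_simps)
    define p r where "p = (d - 1) / c" and "r = (a - 1) / c"
    have "1 + r * c = a" "c * p + 1 = d" using \<open>c \<noteq> 0\<close> by (simp_all add: p_def r_def)
    moreover have "a * p + r = b" using \<open>c \<noteq> 0\<close> by (simp add: b p_def r_def field_simps)
    ultimately have "slm a b c d = slm 1 p 0 1 ** (slm 1 0 c 1 ** slm 1 r 0 1)"
      by (simp add: slm_mult)
    then show ?thesis
      by (simp add: U lower flip: subst_linact_linact)
  qed
  show ?thesis
    unfolding inv_polys_iff
  proof (intro allI impI)
    fix a b c d :: 'a assume det: "a * d - b * c = 1"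
    show "subst (linact (slm a b c d)) f = f"
    proof (cases "c = 0")
      case True
      then have "a \<noteq> 0" using det by auto
      \<comment> \<open>A lower unipotent factor brings the nonzero entry a into the lower left
        corner.\<close>
      have "slm a b c d = slm a b (a + c) (b + d) ** slm 1 0 (- 1) 1"
        by (simp add: slm_mult)
      moreover have "subst (linact (slm a b (a + c) (b + d))) f = f"
        by (rule c) (use True \<open>a \<noteq> 0\<close> det in \<open>auto simp: algebra_simps\<close>)
      ultimately show ?thesis by (simp add: lower flip: subst_linact_linact)
    qed (use c det in auto)
  qed
qed

lemma linact_slm:
  "linact (slm a b c e) 1 = Cst (e\<^sup>2) * X 1 - Cst (2 * b * e) * X 2 + Cst (b\<^sup>2) * X 3"
  "linact (slm a b c e) 2 = Cst (a * e + b * c) * X 2 - Cst (c * e) * X 1 - Cst (a * b) * X 3"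
  "linact (slm a b c e) 3 = Cst (c\<^sup>2) * X 1 - Cst (2 * a * c) * X 2 + Cst (a\<^sup>2) * X 3"
  by (simp_all add: linact_def slm_def vector_3 sum_3 Cst_simps)

lemma linact_refl: "linact refl_mat 1 = X 1" "linact refl_mat 2 = - X 2" "linact refl_mat 3 = X 3"
  by (simp_all add: linact_def refl_mat_def vector_3 sum_3 Cst_simps)

lemma inv_polys_Cst: "Cst c \<in> inv_polys"
  and inv_polys_add: "f \<in> inv_polys \<Longrightarrow> g \<in> inv_polys \<Longrightarrow> f + g \<in> inv_polys"
  and inv_polys_diff: "f \<in> inv_polys \<Longrightarrow> g \<in> inv_polys \<Longrightarrow> f - g \<in> inv_polys"
  and inv_polys_uminus: "f \<in> inv_polys \<Longrightarrow> - f \<in> inv_polys"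
  and inv_polys_mult: "f \<in> inv_polys \<Longrightarrow> g \<in> inv_polys \<Longrightarrow> f * g \<in> inv_polys"
  and inv_polys_power: "f \<in> inv_polys \<Longrightarrow> f ^ n \<in> inv_polys"
  by (auto simp: inv_polys_iff subst_simps)

lemma inv_polys_hcomp: "f \<in> inv_polys \<Longrightarrow> hcomp n f \<in> inv_polys"
  by (auto simp: inv_polys_iff hcomp_subst[OF homog_linact, symmetric])

section \<open>The invariants\<close>

lemma f1_inv: "f1 \<in> inv_polys"
proof (rule inv_polys_criterion[of _ 1])
  show "subst (linact (slm 1 t 0 1)) f1 = f1" for t :: 'a
    by (simp add: f1_def subst_simps linact_slm Cst_simps) (simp add: power2_eq_square algebra_simps)
qed (simp_all add: f1_def subst_simps linact_slm Cst_simps algebra_simps)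

lemma Cst_frobenius: "Cst t ^ CARD('a) = Cst (t::'a::{field,finite})"
  by (metis Cst_simps(7) finite_field_pow_card)

lemma f2_inv:
  assumes "odd CARD('a::{field,finite})"
  shows "(f2 :: 'a poly3) \<in> inv_polys"
proof (rule inv_polys_criterion[of _ 1])
  let ?q = "CARD('a)"
  note frob = frobenius_add[OF rhom_Cst[where 'a = 'a]]
  have frob_diff: "(x - y) ^ ?q = x ^ ?q - (y ^ ?q :: 'a poly3)" for x y
    using frob[of x "- y"] assms by simp
  have two: "(2 :: 'a poly3) ^ ?q = 2" using Cst_frobenius[of "2::'a"] by (simp add: Cst_simps)
  show "subst (linact (slm 1 t 0 1)) f2 = f2" for t :: 'a
    apply (simp add: f2_def subst_simps linact_slm Cst_simps frob frob_diff power_mult_distrib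
        Cst_frobenius two power2_eq_square)
    apply (simp add: algebra_simps)
    done
  show "subst (linact (slm 0 1 (- 1) 0)) f2 = Cst 1 * (f2 :: 'a poly3)"
    using assms by (simp add: f2_def subst_simps linact_slm Cst_simps mult.commute)
qed auto

text \<open>For c = 0 the discriminant is the square b^2. In this form membership depends on the
  discriminant alone, which translations preserve.\<close>

lemma L_alt: "L = {(b, c). \<nexists>s::'a::{field,finite}. b\<^sup>2 - 4 * c = s\<^sup>2}"
  by (auto simp: L_def)

text \<open>A factor corresponds to the quadratic z^2 + b z + c without roots in F. Upper unipotent
  matrices translate z and permute these quadratics. The element w reverses the coefficients and
  changes the sign of z, and making the result monic costs a factor c; this is why the criterion
  admits a constant.\<close>

lemma f3_inv: "(f3 :: 'a::{field,finite} poly3) \<in> inv_polys"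
proof (rule inv_polys_criterion)
  fix t :: 'a
  let ?h = "\<lambda>t::'a. \<lambda>(b, c). (b - 2 * t, t\<^sup>2 - b * t + c)"
  have disc: "(b - 2 * t)\<^sup>2 - 4 * (t\<^sup>2 - b * t + c) = b\<^sup>2 - 4 * c" for b c t :: 'a
    by (simp add: power2_eq_square algebra_simps)
  have hL: "?h t x \<in> L" if "x \<in> L" for x t
  proof -
    obtain b c where x: "x = (b, c)" by force
    show ?thesis using that unfolding x L_alt mem_Collect_eq prod.case disc .
  qed
  have hh: "?h (- t) (?h t x) = x" "?h t (?h (- t) x) = x" for x
    by (auto simp: power2_eq_square algebra_simps split: prod.splits)
  have "subst (linact (slm 1 t 0 1)) f3 = (\<Prod>(b, c)\<in>L. X 1 + Cst (b - 2 * t) * X 2 + Cst (t\<^sup>2 - b * t + c) * X 3)"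
    by (simp add: f3_def subst_simps split_def linact_slm Cst_simps algebra_simps)
  also have "\<dots> = f3"
    unfolding f3_def
    by (rule prod.reindex_bij_witness[where i = "?h (- t)" and j = "?h t"])
      (use hL[of _ t] hL[of _ "- t"] hh in \<open>auto\<close>)
  finally show "subst (linact (slm 1 t 0 1)) f3 = f3" .
next
  let ?h = "\<lambda>(b, c). (- b / c, 1 / c :: 'a)"
  have hL: "?h x \<in> L" if "x \<in> L" for x
  proof -
    obtain b c where x: "x = (b, c)" by force
    have c: "c \<noteq> 0" and ns: "b\<^sup>2 - 4 * c \<noteq> s\<^sup>2" for s using that by (auto simp: x L_def)
    have "(- b / c)\<^sup>2 - 4 * (1 / c) \<noteq> s\<^sup>2" for s
    proof
      assume "(- b / c)\<^sup>2 - 4 * (1 / c) = s\<^sup>2"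
      then have "b\<^sup>2 - 4 * c = (s * c)\<^sup>2"
        using c by (simp add: field_simps power2_eq_square)
      then show False using ns by blast
    qed
    then show ?thesis using c by (auto simp: x L_def)
  qed
  have hh: "?h (?h x) = x" if "x \<in> L" for x
    using that by (auto simp: L_def)
  have "subst (linact (slm 0 1 (- 1) 0)) f3 = (\<Prod>(b, c)\<in>L. X 3 - Cst b * X 2 + Cst c * X 1 :: 'a poly3)"
    by (simp add: f3_def subst_simps split_def linact_slm Cst_simps)
  also have "\<dots> = (\<Prod>(b, c)\<in>L. Cst c * (X 1 + Cst (- b / c) * X 2 + Cst (1 / c) * X 3))"
  proof (rule prod.cong, simp, clarify)
    fix b c :: 'a assume "(b, c) \<in> L"
    then have "c \<noteq> 0" by (auto simp: L_def)
    then have "Cst c * (X 1 + Cst (- b / c) * X 2 + Cst (1 / c) * X 3)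
       = Cst c * X 1 + Cst (c * (- b / c)) * X 2 + Cst (c * (1 / c)) * X 3"
      unfolding Cst_simps by (simp add: algebra_simps)
    with \<open>c \<noteq> 0\<close> show "X 3 - Cst b * X 2 + Cst c * X 1 = Cst c * (X 1 + Cst (- b / c) * X 2 + Cst (1 / c) * X 3)"
      by (simp add: Cst_simps algebra_simps)
  qed
  also have "\<dots> = Cst (\<Prod>(b, c)\<in>L. c) * (\<Prod>(b, c)\<in>L. X 1 + Cst (- b / c) * X 2 + Cst (1 / c) * X 3)"
    by (simp add: split_def prod.distrib Cst_simps)
  also have "(\<Prod>(b, c)\<in>L. X 1 + Cst (- b / c) * X 2 + Cst (1 / c) * X 3) = (f3 :: 'a poly3)"
    unfolding f3_def
    by (rule prod.reindex_bij_witness[where i = ?h and j = ?h]) (use hL hh in auto)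
  finally show "subst (linact (slm 0 1 (- 1) 0)) f3 = Cst (\<Prod>(b, c)\<in>L. c) * (f3 :: 'a poly3)" .
  show "(\<Prod>(b, c)\<in>L. c) \<noteq> (0::'a)"
    by (auto simp: L_def)
qed

lemma f1_refl: "subst (linact refl_mat) f1 = f1"
  by (simp add: f1_def subst_simps linact_refl)

lemma f2_refl:
  assumes "odd CARD('a::{field,finite})"
  shows "subst (linact refl_mat) f2 = (f2 :: 'a poly3)"
  using assms by (simp add: f2_def subst_simps linact_refl)

lemma f3_refl: "subst (linact refl_mat) f3 = (f3 :: 'a::{field,finite} poly3)"
proof -
  have "subst (linact refl_mat) f3 = (\<Prod>(b, c)\<in>L. X 1 + Cst (- b) * X 2 + Cst c * X 3 :: 'a poly3)"
    by (simp add: f3_def subst_simps split_def linact_refl Cst_simps)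
  also have "\<dots> = f3"
    unfolding f3_def
    by (rule prod.reindex_bij_witness[where i = "\<lambda>(b, c). (- b, c)" and j = "\<lambda>(b, c). (- b, c)"])
      (auto simp: L_def)
  finally show ?thesis .
qed

lemma homog_f1: "homog 2 f1"
proof -
  have "homog (1 + 1) (X 1 * X 3 :: 'a poly3)" by (intro homog_mult homog_X)
  moreover have "homog (1 * 2) (X 2 ^ 2 :: 'a poly3)" by (intro homog_power homog_X)
  ultimately show ?thesis by (simp add: f1_def homog_diff numeral_2_eq_2)
qed

lemma homog_f2: "homog (CARD('a) + 1) (f2 :: 'a::{field,finite} poly3)"
proof -
  have 1: "homog (1 * CARD('a) + 1) (X i ^ CARD('a) * X j :: 'a poly3)" for i j
    by (intro homog_mult homog_power homog_X)
  have "homog (1 * (CARD('a) + 1)) (X 2 ^ (CARD('a) + 1) :: 'a poly3)"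
    by (intro homog_power homog_X)
  then have "homog (CARD('a) + 1) (Cst 2 * X 2 ^ (CARD('a) + 1) :: 'a poly3)"
    by (simp add: homog_Cst_mult)
  then show ?thesis
    using 1[of 1 3] 1[of 3 1]
    by (simp add: f2_def homog_diff homog_add Cst_simps mult.commute)
qed

lemma homog_f3: "homog (card (L :: ('a \<times> 'a) set)) (f3 :: 'a::{field,finite} poly3)"
proof -
  have "homog (\<Sum>x\<in>(L :: ('a \<times> 'a) set). 1) (f3 :: 'a poly3)"
    unfolding f3_def by (rule homog_prod) (auto intro!: homog_add homog_Cst_mult homog_X[unfolded One_nat_def])
  then show ?thesis by simp
qed

section \<open>The Jacobian determinant under linear substitutions\<close>

lemma partial_linact:
  "partial k (subst (linact M) f) = (\<Sum>j\<in>UNIV. subst (linact M) (partial j f) * Cst (M $ j $ k))"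
proof -
  have "partial k (linact M j) = Cst (M $ j $ k)" for j
    using exhaust_3[of k] by (auto simp: linact_def sum_3 partial_add partial_mult partial_X)
  then show ?thesis
    unfolding subst_eq_ins
    using chain_rule[of Cst "partial k" "linact M" f] rhom_Cst
    by (simp add: partial_add partial_mult)
qed

lemma f123_simps: "f123 1 = f1" "f123 2 = f2" "f123 3 = f3"
  by (simp_all add: f123_def vector_3)

text \<open>By the chain rule the Jacobian matrix of fixed polynomials is its own substitution times
  M. One identity thus gives the invariance of \<open>f4\<close> under G, where det M = 1, and its
  sign under the reflection.\<close>

lemma jacobian_linact:
  fixes M :: "'a::{field,finite}^3^3"
  assumes "\<And>i. subst (linact M) (f123 i) = f123 i"
  shows "f4 = subst (linact M) f4 * Cst (det M)"
proof -
  define J where "J = (\<chi> i j. partial j (f123 i :: 'a poly3))"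
  let ?J = "\<chi> i j. subst (linact M) (J $ i $ j)" and ?C = "\<chi> i j. Cst (M $ i $ j)"
  have "J $ i $ k = (?J ** ?C) $ i $ k" for i k
    using partial_linact[of k M "f123 i"] assms[of i]
    by (simp add: J_def matrix_matrix_mult_def)
  then have "J = ?J ** ?C"
    by (intro vec_eq_iff[THEN iffD2] allI)
  then have "det J = det (?J ** ?C)"
    by (rule arg_cong)
  also have "\<dots> = det ?J * det ?C"
    by (rule det_mul)
  also have "det ?J = subst (linact M) (det J)"
    by (rule rhom_det[OF rhom_subst, symmetric])
  also have "det ?C = Cst (det M)"
    by (rule rhom_det[OF rhom_Cst, symmetric])
  finally have "det J = subst (linact M) (det J) * Cst (det M)" .
  then show ?thesis by (simp add: f4_def J_def)
qed

lemma f4_inv: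
  assumes "odd CARD('a::{field,finite})"
  shows "(f4 :: 'a poly3) \<in> inv_polys"
  unfolding inv_polys_iff
proof (intro allI impI)
  fix a b c d :: 'a assume det: "a * d - b * c = 1"
  have "subst (linact (slm a b c d)) (f123 i) = f123 i" for i
    using exhaust_3[of i] f1_inv[where 'a = 'a] f2_inv[OF assms] f3_inv[where 'a = 'a] det unfolding inv_polys_iff
    by (auto simp: f123_simps)
  from jacobian_linact[of "slm a b c d", OF this] show "subst (linact (slm a b c d)) f4 = f4"
    by (simp add: det_slm det Cst_simps)
qed

lemma f4_refl:
  assumes "odd CARD('a::{field,finite})"
  shows "subst (linact refl_mat) (f4 :: 'a poly3) = - f4"
proof -
  have "subst (linact refl_mat) (f123 i) = (f123 i :: 'a poly3)" for i
    using exhaust_3[of i] f1_refl f2_refl[OF assms] f3_refl by (auto simp: f123_simps)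
  from jacobian_linact[of "refl_mat :: 'a^3^3", OF this] show ?thesis
    by (simp add: det_refl Cst_simps equation_minus_iff)
qed

section \<open>Counting squares\<close>

text \<open>In odd characteristic, squaring is two-to-one on the nonzero elements.\<close>

lemma card_nonsquares:
  assumes "odd CARD('a::{field,finite})"
  shows "2 * card {e::'a. \<nexists>s. e = s\<^sup>2} = CARD('a) - 1"
proof -
  let ?U = "UNIV - {0::'a}" and ?N = "{e::'a. \<nexists>s. e = s\<^sup>2}"
  define S where "S = (\<lambda>x::'a. x\<^sup>2) ` ?U"
  have fib: "card {x \<in> ?U. x\<^sup>2 = y} = 2" if "y \<in> S" for y
  proof -
    obtain x where x: "x \<noteq> 0" "y = x\<^sup>2" using \<open>y \<in> S\<close> by (auto simp: S_def)
    have "x \<noteq> - x" using x two_neq_0[OF assms] by (simp add: eq_neg_iff_add_eq_0 flip: mult_2)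
    moreover have "{x \<in> ?U. x\<^sup>2 = y} = {x, - x}" using x by (auto simp: power2_eq_iff)
    ultimately show ?thesis by simp
  qed
  have "card ?U = (\<Sum>x\<in>?U. 1)" by simp
  also have "\<dots> = (\<Sum>y\<in>S. \<Sum>x\<in>{x \<in> ?U. x\<^sup>2 = y}. 1)"
    unfolding S_def by (rule sum.image_gen) simp
  also have "\<dots> = (\<Sum>y\<in>S. 2)" by (rule sum.cong[OF refl]) (simp only: card_eq_sum[symmetric] fib)
  finally have 1: "card ?U = 2 * card S" by simp
  have U: "card ?U = CARD('a) - 1" by (rule card_Diff_singleton) simp
  have N: "?N = ?U - S" by (auto simp: S_def)
  have "S \<subseteq> ?U" by (auto simp: S_def)
  then have "card ?N = card ?U - card S" unfolding N by (intro card_Diff_subset) auto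
  then show ?thesis using 1 U by linarith
qed

text \<open>Since 4 is invertible, a pair is the same as an arbitrary b together with a nonsquare
  discriminant.\<close>

lemma card_L:
  assumes "odd CARD('a::{field,finite})"
  shows "2 * card (L :: ('a \<times> 'a) set) = CARD('a) * (CARD('a) - 1)"
proof -
  let ?N = "{e::'a. \<nexists>s. e = s\<^sup>2}"
  have 4: "(4::'a) \<noteq> 0"
    using two_neq_0[OF assms] by (metis mult_2 mult_eq_0_iff numeral_Bit0)
  have "bij_betw (\<lambda>(b, c). (b, b\<^sup>2 - 4 * c)) L (UNIV \<times> ?N)"
    by (rule bij_betw_byWitness[where f' = "\<lambda>(b, e). (b, b\<^sup>2 / 4 - e / 4)"])
      (use 4 in \<open>auto simp: L_alt diff_divide_distrib\<close>)
  then have "card (L :: ('a \<times> 'a) set) = card ((UNIV :: 'a set) \<times> ?N)" by (rule bij_betw_same_card)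
  then show ?thesis
    using card_nonsquares[OF assms] by (simp add: card_cartesian_product)
qed

section \<open>Univariate polynomials and translations\<close>

text \<open>z^q - z, the dehomogenisation of the Dickson form s^q t - s t^q, which is the product of
  all linear forms over F up to scalars.\<close>

definition upoly :: "'a::{field,finite} poly" where
  "upoly = monom 1 CARD('a) - monom 1 1"

lemma rhom_const: "rhom (\<lambda>c. [:c::'a::comm_ring_1:])"
  by (rule rhomI) auto

lemma pcompose_one: "pcompose 1 r = (1 :: 'a::comm_ring_1 poly)"
  by (simp add: one_pCons)

lemma rhom_pcompose: "rhom (\<lambda>p. pcompose p (r :: 'a::comm_ring_1 poly))"
  by (rule rhomI) (auto simp: pcompose_add pcompose_mult pcompose_one)

lemma pcompose_monom: "pcompose (monom c n) r = smult c (r ^ n)" for r :: "'a::comm_ring_1 poly"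
  by (induction n) (auto simp: monom_0 monom_Suc pcompose_pCons)

lemma coeff_pcompose_scale: "coeff (pcompose p [:0, k:]) n = k ^ n * coeff p n" for p :: "'a::comm_ring_1 poly"
proof (induction p arbitrary: n)
  case (pCons a p)
  then show ?case
    by (cases n) (auto simp: pcompose_pCons)
qed simp

lemma upoly_alt: "upoly = [:0, 1:] * (monom 1 (CARD('a) - 1) - 1 :: 'a::{field,finite} poly)"
proof -
  have "CARD('a) = Suc (CARD('a) - 1)" using card_field_gt_1[where 'a = 'a] by linarith
  then have "monom (1::'a) CARD('a) = pCons 0 (monom 1 (CARD('a) - 1))" by (metis monom_Suc)
  moreover have "monom (1::'a) 1 = pCons 0 1" by (metis One_nat_def monom_Suc monom_eq_1)
  ultimately show ?thesis by (simp add: upoly_def)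
qed

lemma degree_monom_minus:
  assumes "degree p < n"
  shows "degree (monom (1::'a::field) n - p) = n"
  using degree_add_eq_left[of "- p" "monom 1 n"] assms by (simp add: degree_monom_eq)

lemma degree_upoly: "degree (upoly :: 'a::{field,finite} poly) = CARD('a)"
  unfolding upoly_def
  by (rule degree_monom_minus) (use card_field_gt_1[where 'a = 'a] in \<open>auto simp: degree_monom_eq\<close>)

lemma upoly_neq_0: "(upoly :: 'a::{field,finite} poly) \<noteq> 0"
  using degree_upoly[where 'a = 'a] by auto

lemma poly_upoly: "poly upoly (x::'a::{field,finite}) = 0"
  by (simp add: upoly_def poly_monom finite_field_pow_card)

text \<open>The remainder modulo \<open>upoly\<close> has degree less than q and vanishes at all q
  elements of F.\<close>

lemma upoly_dvd:
  fixes p :: "'a::{field,finite} poly"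
  assumes "\<And>x. poly p x = 0"
  shows "upoly dvd p"
proof -
  have "degree (p mod upoly) < CARD('a)"
    using degree_mod_less[OF upoly_neq_0, of p] degree_upoly[where 'a = 'a] by auto
  moreover have "poly (p mod upoly) x = 0" for x
  proof -
    have "poly p x = poly (upoly * (p div upoly) + p mod upoly) x" by simp
    then show ?thesis using assms[of x] poly_upoly[of x] by (simp only: poly_add poly_mult mult_zero_left add_0)
  qed
  ultimately have "p mod upoly = 0" by (intro poly_eq_0_if_card_roots[of UNIV]) auto
  then show ?thesis by (simp add: mod_eq_0_iff_dvd)
qed

lemma pcompose_upoly_shift: "pcompose upoly [:b, 1:] = (upoly :: 'a::{field,finite} poly)"
proof -
  have "[:b, 1:] = [:b:] + [:0, 1:]" by simp
  then have "[:b, 1:] ^ CARD('a) = [:b:] ^ CARD('a) + [:0, 1:] ^ CARD('a)"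
    using frobenius_add[OF rhom_const[where 'a = 'a], of "[:b:]" "[:0, 1:]"] by simp
  then show ?thesis
    by (simp add: upoly_def pcompose_diff pcompose_monom poly_const_pow finite_field_pow_card)
      (simp add: monom_altdef)
qed

lemma pcompose_upoly_scale: "pcompose upoly [:0, k:] = smult k (upoly :: 'a::{field,finite} poly)"
  by (rule poly_eqI) (auto simp: coeff_pcompose_scale upoly_def finite_field_pow_card)

lemma poly_shift_invariant:
  fixes p :: "'a::comm_ring_1 poly"
  assumes "\<And>b. pcompose p [:b, 1:] = p"
  shows "poly p x = poly p 0"
  using arg_cong[OF assms[of x], of "\<lambda>p. poly p 0"] by (simp add: poly_pcompose)

lemma shift_invariant_quotient:
  fixes p :: "'a::{field,finite} poly"
  assumes "\<And>b. pcompose (upoly * p) [:b, 1:] = upoly * p"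
  shows "pcompose p [:b, 1:] = p"
  using assms[of b] upoly_neq_0[where 'a = 'a] by (simp add: pcompose_mult pcompose_upoly_shift)

text \<open>A translation-invariant p is constant on F, so p - p(0) is a multiple of
  \<open>upoly\<close>. The cofactor is again translation-invariant and its degree is smaller by q;
  iterated, this makes p a polynomial in z^q - z.\<close>

lemma shift_invariant_degree:
  fixes p :: "'a::{field,finite} poly"
  assumes "\<And>b. pcompose p [:b, 1:] = p"
  shows "CARD('a) dvd degree p"
  using assms
proof (induction "degree p" arbitrary: p rule: less_induct)
  case less
  let ?r = "p - [:poly p 0:]"
  have "upoly dvd ?r"
  proof (rule upoly_dvd)
    fix x
    have "poly p x = poly p 0" by (rule poly_shift_invariant[OF less.prems])
    then show "poly ?r x = 0" by simp
  qed
  then obtain p' where p': "?r = upoly * p'" by (elim dvdE)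
  show ?case
  proof (cases "p' = 0")
    case True
    then have "p = [:poly p 0:]" using p' by simp
    then have "degree p = 0" by (metis degree_pCons_0)
    then show ?thesis by simp
  next
    case False
    have p: "p = upoly * p' + [:poly p 0:]" using p' by (simp add: algebra_simps)
    have deg: "degree (upoly * p') = CARD('a) + degree p'"
      using False upoly_neq_0[where 'a = 'a] by (simp add: degree_mult_eq degree_upoly)
    have degp: "degree p = CARD('a) + degree p'"
      by (subst p, subst degree_add_eq_left) (simp_all add: deg)
    have "pcompose (upoly * p') [:b, 1:] = upoly * p'" for b
      using less.prems[of b] unfolding p'[symmetric] by (simp add: pcompose_diff)
    then have "pcompose p' [:b, 1:] = p'" for b by (rule shift_invariant_quotient)
    then have "CARD('a) dvd degree p'" using degp by (intro less.hyps) auto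
    then show ?thesis using degp by simp
  qed
qed

text \<open>Reduce n modulo q - 1: a nonzero remainder r would give z^r - 1 more roots than its
  degree, namely all q - 1 nonzero elements.\<close>

lemma exponent_dvd:
  assumes "\<And>a::'a::{field,finite}. a \<noteq> 0 \<Longrightarrow> a ^ n = 1"
  shows "(CARD('a) - 1) dvd n"
proof -
  let ?r = "n mod (CARD('a) - 1)"
  have q: "CARD('a) - 1 > 0" using card_field_gt_1[where 'a = 'a] by simp
  have r: "a ^ ?r = 1" if "a \<noteq> 0" for a :: 'a
  proof -
    have "a * a ^ (CARD('a) - 1) = a"
      using finite_field_pow_card[of a] q by (simp flip: power_Suc)
    then have 1: "a ^ (CARD('a) - 1) = 1" using that by simp
    have "a ^ n = a ^ ((CARD('a) - 1) * (n div (CARD('a) - 1)) + ?r)" by simp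
    also have "\<dots> = a ^ ?r" unfolding power_add power_mult 1 by simp
    finally show ?thesis using assms[OF that] by simp
  qed
  have "?r = 0"
  proof (rule ccontr)
    assume r0: "?r \<noteq> 0"
    have "monom 1 ?r - 1 = (0 :: 'a poly)"
    proof (rule poly_eq_0_if_card_roots[of "UNIV - {0}"])
      have "degree (monom 1 ?r - 1 :: 'a poly) \<le> ?r"
        by (rule degree_diff_le) (auto simp: degree_monom_eq)
      also have "\<dots> < card (UNIV - {0::'a})"
        using q by (simp add: card_Diff_singleton)
      finally show "degree (monom 1 ?r - 1 :: 'a poly) < card (UNIV - {0::'a})" .
      show "poly (monom 1 ?r - 1) a = 0" if "a \<in> UNIV - {0}" for a :: 'a
        using r[of a] that by (simp add: poly_monom)
    qed
    then have "coeff (monom 1 ?r - 1 :: 'a poly) ?r = 0" by simp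
    then show False using r0 by simp
  qed
  then show ?thesis by auto
qed

subsection \<open>Dehomogenised invariant binary forms\<close>

text \<open>The polynomials $p(z) = h(z, 1)$ for binary forms $h$ of degree \<open>N\<close> that are invariant under
  $\mathrm{SL}_2(F)$ and satisfy $h(-s, t) = \varepsilon h(s, t)$.\<close>

definition inv_form :: "'a::{field,finite} \<Rightarrow> nat \<Rightarrow> 'a poly \<Rightarrow> bool" where
  "inv_form \<epsilon> N p \<longleftrightarrow> degree p \<le> N \<and> (\<forall>b. pcompose p [:b, 1:] = p) \<and>
     (\<forall>a. a \<noteq> 0 \<longrightarrow> pcompose p [:0, a\<^sup>2:] = smult (a ^ N) p) \<and>
     pcompose p [:0, - 1:] = smult \<epsilon> p \<and> (\<forall>k\<le>N. coeff p (N - k) = \<epsilon> * coeff p k)"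

lemma inv_form_diff: "inv_form \<epsilon> N p \<Longrightarrow> inv_form \<epsilon> N r \<Longrightarrow> inv_form \<epsilon> N (p - r)"
  by (auto simp: inv_form_def pcompose_diff degree_diff_le smult_diff_right algebra_simps)

lemma inv_form_smult: "inv_form \<epsilon> N p \<Longrightarrow> inv_form \<epsilon> N (smult c p)"
  by (auto simp: inv_form_def pcompose_smult mult.left_commute mult.commute intro: degree_smult_le order_trans)

text \<open>The reversal of a form of degree N is multiplicative when expressed through
  \<open>reflect_poly\<close>, so in this shape the symmetry passes to quotients.\<close>

lemma palindromic_iff:
  fixes p :: "'a::idom poly"
  assumes "degree p \<le> N"
  shows "(\<forall>k\<le>N. coeff p (N - k) = \<epsilon> * coeff p k) \<longleftrightarrow> monom 1 (N - degree p) * reflect_poly p = smult \<epsilon> p"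
proof -
  let ?l = "monom 1 (N - degree p) * reflect_poly p"
  have c: "coeff ?l k = (if k \<le> N then coeff p (N - k) else 0)" for k
  proof (cases "k < N - degree p")
    case True
    then have "degree p < N - k" by linarith
    then show ?thesis using True by (simp add: coeff_monom_mult coeff_eq_0)
  next
    case False
    then show ?thesis using assms
      by (auto simp: coeff_monom_mult coeff_reflect_poly)
  qed
  show ?thesis
  proof
    assume *: "\<forall>k\<le>N. coeff p (N - k) = \<epsilon> * coeff p k"
    show "?l = smult \<epsilon> p"
      by (rule poly_eqI) (use * assms in \<open>auto simp: c coeff_eq_0\<close>)
  next
    assume "?l = smult \<epsilon> p"
    then have "coeff ?l k = \<epsilon> * coeff p k" for k by simp
    then show "\<forall>k\<le>N. coeff p (N - k) = \<epsilon> * coeff p k" unfolding c by (metis (full_types))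
  qed
qed

lemma reflect_monom_minus_one:
  assumes "n > 0"
  shows "reflect_poly (monom (1::'a::field) n - 1) = - (monom 1 n - 1)"
proof -
  have deg: "degree (monom (1::'a) n - 1) = n"
    by (rule degree_monom_minus) (use assms in auto)
  show ?thesis
  proof (rule poly_eqI)
    fix k
    show "coeff (reflect_poly (monom (1::'a) n - 1)) k = coeff (- (monom 1 n - 1)) k"
      using assms by (auto simp: coeff_reflect_poly deg)
  qed
qed

text \<open>Exchanging s and t negates s^q t - s t^q. The factor z is there because that form has
  degree q + 1 while \<open>upoly\<close> has degree q.\<close>

lemma reflect_upoly:
  "[:0, 1:] * reflect_poly (upoly :: 'a::{field,finite} poly) = - upoly"
proof -
  let ?v = "monom 1 (CARD('a) - 1) - 1 :: 'a poly"
  have q: "CARD('a) - 1 > 0" using card_field_gt_1[where 'a = 'a] by simp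
  have "reflect_poly ?v = - ?v" by (rule reflect_monom_minus_one[OF q])
  moreover have "reflect_poly [:0, 1::'a:] = 1"
    by (rule poly_eqI) (auto simp: coeff_reflect_poly coeff_pCons split: nat.splits)
  ultimately show ?thesis
    by (simp only: upoly_alt reflect_poly_mult mult_1_left mult_minus_right)
qed

text \<open>By translation invariance p vanishes on F, and by the reversal symmetry its vanishing
  constant term is also a zero at infinity. So the whole Dickson form, of degree q + 1, splits off.
  That form is odd in s and alternating, so the cofactor has the opposite sign
  \<open>- \<epsilon>\<close>.\<close>

lemma inv_form_step:
  fixes p :: "'a::{field,finite} poly"
  assumes q: "odd CARD('a)" and p: "inv_form \<epsilon> N p" "coeff p 0 = 0" "p \<noteq> 0"
  obtains p' where "p = upoly * p'" "CARD('a) + 1 \<le> N" "inv_form (- \<epsilon>) (N - (CARD('a) + 1)) p'"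
proof -
  let ?q = "CARD('a)"
  have deg: "degree p \<le> N" and shift: "pcompose p [:b, 1:] = p"
    and torus: "a \<noteq> 0 \<Longrightarrow> pcompose p [:0, a\<^sup>2:] = smult (a ^ N) p"
    and sgn: "pcompose p [:0, - 1:] = smult \<epsilon> p"
    and pal: "monom 1 (N - degree p) * reflect_poly p = smult \<epsilon> p"
    and pal': "\<forall>k\<le>N. coeff p (N - k) = \<epsilon> * coeff p k" for a b
    using p by (auto simp: inv_form_def palindromic_iff)
  have "poly p x = 0" for x
    using poly_shift_invariant[OF shift, of x] p(2) by (simp add: poly_0_coeff_0)
  then obtain p' where p': "p = upoly * p'" by (metis upoly_dvd dvdE)
  then have "p' \<noteq> 0" using p(3) by auto
  then have degp: "degree p = ?q + degree p'"
    using upoly_neq_0[where 'a = 'a] by (simp add: p' degree_mult_eq degree_upoly)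
  have "degree p \<noteq> N"
  proof
    assume "degree p = N"
    then have "lead_coeff p = 0" using pal' p(2) by force
    then show False using p(3) by simp
  qed
  then have N: "?q + 1 \<le> N" and degp': "degree p' \<le> N - (?q + 1)" using deg degp by auto
  have "inv_form (- \<epsilon>) (N - (?q + 1)) p'"
    unfolding inv_form_def palindromic_iff[OF degp']
  proof (intro conjI allI impI)
    show "degree p' \<le> N - (?q + 1)" by (rule degp')
    show "pcompose p' [:b, 1:] = p'" for b
      by (rule shift_invariant_quotient) (use shift in \<open>simp add: p'\<close>)
    show "pcompose p' [:0, a\<^sup>2:] = smult (a ^ (N - (?q + 1))) p'" if a: "a \<noteq> 0" for a
    proof -
      \<comment> \<open>Under z -> a^2 z the polynomial \<open>upoly\<close> is multiplied by a^2,
        which equals a^(q + 1) in F; so the torus weight stays equal to the degree.\<close>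
      have "a ^ N = a ^ (N - (?q + 1)) * a ^ (?q + 1)"
        using N by (metis le_add_diff_inverse2 power_add)
      also have "a ^ (?q + 1) = a\<^sup>2" by (simp add: finite_field_pow_card power2_eq_square)
      finally have "upoly * smult (a\<^sup>2) (pcompose p' [:0, a\<^sup>2:])
          = upoly * smult (a\<^sup>2) (smult (a ^ (N - (?q + 1))) p')"
        using torus[OF a] by (simp add: p' pcompose_mult pcompose_upoly_scale mult.commute)
      then have "smult (a\<^sup>2) (pcompose p' [:0, a\<^sup>2:]) = smult (a\<^sup>2) (smult (a ^ (N - (?q + 1))) p')"
        using upoly_neq_0[where 'a = 'a] by (simp only: mult_cancel_left) simp
      then show ?thesis using a by (simp add: poly_eq_iff)
    qed
    show "pcompose p' [:0, - 1:] = smult (- \<epsilon>) p'"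
    proof -
      have "upoly * pcompose p' [:0, - 1:] = upoly * smult (- \<epsilon>) p'"
        using sgn by (simp add: p' pcompose_mult pcompose_upoly_scale minus_equation_iff)
      then show ?thesis using upoly_neq_0[where 'a = 'a] by (simp only: mult_cancel_left) simp
    qed
    \<comment> \<open>The additional factor z, coming from the zero at infinity, is the one that
      \<open>reflect_upoly\<close> asks for.\<close>
    have "N - degree p = Suc (N - (?q + 1) - degree p')" using N degp degp' by linarith
    then have "[:0, 1:] * monom 1 (N - (?q + 1) - degree p') * reflect_poly p = smult \<epsilon> p"
      using pal by (simp add: monom_Suc)
    then have "([:0, 1:] * reflect_poly upoly) * (monom 1 (N - (?q + 1) - degree p') * reflect_poly p') = smult \<epsilon> p"
      by (simp only: p' reflect_poly_mult) (simp only: mult_ac)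
    then have "upoly * (monom 1 (N - (?q + 1) - degree p') * reflect_poly p') = upoly * smult (- \<epsilon>) p'"
      unfolding reflect_upoly p' by (simp add: minus_equation_iff)
    then show "monom 1 (N - (?q + 1) - degree p') * reflect_poly p' = smult (- \<epsilon>) p'"
      using upoly_neq_0[where 'a = 'a] by (simp only: mult_cancel_left) simp
  qed
  with p' N show ?thesis by (rule that)
qed

lemma order_upoly: "order 0 (upoly :: 'a::{field,finite} poly) = 1"
proof -
  have q: "CARD('a) - 1 > 0" using card_field_gt_1[where 'a = 'a] by simp
  let ?v = "monom 1 (CARD('a) - 1) - 1 :: 'a poly"
  have "poly ?v 0 \<noteq> 0" using q by (simp add: poly_monom power_0_left)
  then have "order 0 ?v = 0" by (metis order_root)
  moreover have "order 0 [:0, 1::'a:] = 1" using order_power_n_n[of "0::'a" 1] by simp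
  ultimately show ?thesis
    using upoly_neq_0[where 'a = 'a] unfolding upoly_alt by (subst order_mult) auto
qed

text \<open>\<open>upoly\<close> has a simple zero at 0, so the division can be repeated as often as
  the order of the zero of p permits, with a change of sign each time.\<close>

lemma inv_form_divide_power:
  fixes p :: "'a::{field,finite} poly"
  assumes q: "odd CARD('a)" and "inv_form \<epsilon> N p" "p \<noteq> 0" "k \<le> order 0 p"
  shows "\<exists>p'. p = upoly ^ k * p' \<and> k * (CARD('a) + 1) \<le> N \<and>
     inv_form ((- 1) ^ k * \<epsilon>) (N - k * (CARD('a) + 1)) p'"
  using assms(4)
proof (induction k)
  case (Suc k)
  then obtain p' where p': "p = upoly ^ k * p'" "k * (CARD('a) + 1) \<le> N"
    "inv_form ((- 1) ^ k * \<epsilon>) (N - k * (CARD('a) + 1)) p'" by auto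
  then have "p' \<noteq> 0" using \<open>p \<noteq> 0\<close> by auto
  have "order 0 (upoly ^ k :: 'a poly) = k"
    by (induction k) (use upoly_neq_0[where 'a = 'a] in \<open>auto simp: order_mult order_upoly order_root\<close>)
  then have "order 0 p = k + order 0 p'"
    using \<open>p \<noteq> 0\<close> p'(1) by (simp add: order_mult)
  then have "order 0 p' \<noteq> 0" using Suc.prems by simp
  then have "coeff p' 0 = 0" by (metis order_root poly_0_coeff_0)
  from inv_form_step[OF q p'(3) this \<open>p' \<noteq> 0\<close>] obtain p'' where
    "p' = upoly * p''" "CARD('a) + 1 \<le> N - k * (CARD('a) + 1)"
    "inv_form (- ((- 1) ^ k * \<epsilon>)) (N - k * (CARD('a) + 1) - (CARD('a) + 1)) p''" .
  then show ?case using p'(1,2) by (intro exI[of _ p'']) (auto simp: algebra_simps)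
qed (use assms in auto)

text \<open>Degree exactly N means no zero at infinity. Translations then yield q | N. Comparing
  leading coefficients under z -> a^2 z yields a^(2 N) = a^N for all nonzero a, hence q - 1 |
  N.\<close>

lemma inv_form_degree:
  fixes p :: "'a::{field,finite} poly"
  assumes "inv_form \<epsilon> N p" "p \<noteq> 0" "degree p = N"
  shows "CARD('a) * (CARD('a) - 1) dvd N"
proof (rule divides_mult)
  show "CARD('a) dvd N"
    using shift_invariant_degree[of p] assms by (auto simp: inv_form_def)
  show "(CARD('a) - 1) dvd N"
  proof (rule exponent_dvd)
    fix a :: 'a assume a: "a \<noteq> 0"
    have "coeff (pcompose p [:0, a\<^sup>2:]) N = coeff (smult (a ^ N) p) N"
      using assms(1) a by (simp add: inv_form_def)
    then have "(a\<^sup>2) ^ N * lead_coeff p = a ^ N * lead_coeff p"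
      using assms(3) by (simp add: coeff_pcompose_scale)
    then have "a ^ N * a ^ N = a ^ N"
      using assms(2) by (simp flip: power_mult power_add) (simp add: mult_2)
    then show "a ^ N = 1" using a by simp
  qed
  show "coprime CARD('a) (CARD('a) - 1)"
    using card_field_gt_1[where 'a = 'a] by (intro coprime_diff_one_right_nat) simp
qed

subsection \<open>Restriction to the cone $f_1 = 0$\<close>

definition cpt :: "3 \<Rightarrow> 'a::comm_ring_1 poly" where
  "cpt i = vector [monom 1 2, monom 1 1, 1] $ i"

text \<open>The cone $x_1 x_3 = x_2^2$ is parametrised by $(s^2, st, t^2)$; here $s = z$ and $t = 1$.\<close>

definition cone :: "'a::comm_ring_1 poly3 \<Rightarrow> 'a poly" where
  "cone = ins (\<lambda>c. [:c:]) cpt"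

lemma rhom_cone: "rhom cone"
  unfolding cone_def by (rule rhom_ins[OF rhom_const])

lemmas cone_simps = rhom_simps[OF rhom_cone]

lemma cone_Cst [simp]: "cone (Cst c) = [:c:]"
  by (simp add: cone_def ins_Cst rhom_const)

lemma cpt_simps [simp]: "cpt 1 = monom 1 2" "cpt 2 = monom 1 1" "cpt 3 = 1"
  by (simp_all add: cpt_def)

lemma cone_X [simp]: "cone (X i) = cpt i"
  by (simp add: cone_def ins_X rhom_const)

lemma cone_f2: "cone f2 = (upoly :: 'a::{field,finite} poly)\<^sup>2"
  by (simp add: f2_def cone_simps monom_power upoly_def power2_eq_square mult_monom algebra_simps
      mult_2_right numeral_2_eq_2)

lemma cone_f3: "cone f3 = (\<Prod>(b, c)\<in>L. [:c, b, 1::'a::{field,finite}:])"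
  by (simp add: f3_def cone_simps split_def)
    (simp add: monom_altdef power2_eq_square)

lemma cone_f3_monic: "lead_coeff (cone f3 :: 'a::{field,finite} poly) = 1"
  and degree_cone_f3: "degree (cone f3 :: 'a::{field,finite} poly) = 2 * card (L :: ('a \<times> 'a) set)"
proof -
  show "lead_coeff (cone f3 :: 'a poly) = 1"
    by (simp add: cone_f3 lead_coeff_prod split_def)
  show "degree (cone f3 :: 'a poly) = 2 * card (L :: ('a \<times> 'a) set)"
    unfolding cone_f3 by (subst degree_prod_eq_sum_degree) (auto simp: split_def)
qed

lemma cone_f3_neq_0: "(cone f3 :: 'a::{field,finite} poly) \<noteq> 0"
  using cone_f3_monic[where 'a = 'a] by auto

lemma mon_monom:
  "mon (\<lambda>i. vector [monom 1 j, monom 1 k, monom 1 l] $ i) m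
    = monom (1::'a::comm_ring_1) (j * lookup m 1 + k * lookup m 2 + l * lookup m 3)"
  by (simp add: mon_def prod_3 monom_power mult_monom)

lemma mon_cpt: "mon cpt m = monom 1 (2 * lookup m 1 + lookup m 2)"
  by (simp add: mon_def prod_3 monom_power mult_monom)

lemma coeff_cone:
  "coeff (cone f) k = (\<Sum>m\<in>keys f. if 2 * lookup m 1 + lookup m 2 = k
     then lookup f m else 0)"
  by (simp add: cone_def ins_def coeff_sum mon_cpt if_distrib cong: if_cong)

lemma mdeg_alt: "mdeg m = lookup m 1 + lookup m 2 + lookup m 3"
  by (simp add: mdeg_def sum_3)

lemma degree_cone: "homog n f \<Longrightarrow> degree (cone f) \<le> 2 * n"
  by (rule degree_le) (auto simp: coeff_cone homog_def mdeg_alt intro!: sum.neutral)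

lemma cone_subst: "cone (subst \<tau> f) = ins (\<lambda>c. [:c:]) (\<lambda>i. cone (\<tau> i)) f"
  unfolding cone_def by (rule ins_subst[OF rhom_const])

lemma pcompose_cone: "pcompose (cone f) r = ins (\<lambda>c. [:c:]) (\<lambda>i. pcompose (cpt i) r) f"
  using rhom_eq_ins[OF rhom_comp[OF rhom_pcompose[of r] rhom_cone], of f] by simp

text \<open>Every symmetry of z comes from a substitution: translations from upper unipotent
  matrices, z -> a^2 z from diagonal matrices after a scalar is pulled out by homogeneity, z -> - z
  from the reflection, and the reversal from w together with the reflection.\<close>

lemma inv_form_cone:
  fixes f :: "'a::{field,finite} poly3"
  assumes inv: "f \<in> inv_polys" and hom: "homog n f" and sgn: "subst (linact refl_mat) f = Cst \<epsilon> * f"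
  shows "inv_form \<epsilon> (2 * n) (cone f)"
  unfolding inv_form_def
proof (intro conjI allI impI)
  have I: "subst (linact (slm a b c e)) f = f" if "a * e - b * c = 1" for a b c e
    using inv that unfolding inv_polys_iff by blast
  show "degree (cone f) \<le> 2 * n" by (rule degree_cone[OF hom])
  show "pcompose (cone f) [:b, 1:] = cone f" for b
  proof -
    have "pcompose (cpt i) [:b, 1:] = cone (linact (slm 1 (- b) 0 1) i)" for i
      using exhaust_3[of i]
      by (auto simp: linact_slm cone_simps pcompose_monom pcompose_one) (simp_all add: monom_altdef power2_eq_square)
    then have "pcompose (cone f) [:b, 1:] = cone (subst (linact (slm 1 (- b) 0 1)) f)"
      by (simp add: pcompose_cone cone_subst)
    also have "\<dots> = cone f" by (subst I) simp_all
    finally show ?thesis .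
  qed
  show "pcompose (cone f) [:0, a\<^sup>2:] = smult (a ^ (2 * n)) (cone f)" if a: "a \<noteq> 0" for a
  proof -
    \<comment> \<open>The diagonal matrix sends (z^2, z, 1) to (a^2 z^2, z, a^(- 2)); multiplying by
      a^2 restores the last coordinate 1.\<close>
    have "pcompose (cpt i) [:0, a\<^sup>2:] = [:a\<^sup>2:] * cone (linact (slm (1 / a) 0 0 a) i)" for i
      using exhaust_3[of i] a
      by (auto simp: linact_slm cone_simps pcompose_monom pcompose_one) (simp_all add: monom_altdef power2_eq_square power4_eq_xxxx mult.assoc)
    then have "pcompose (cone f) [:0, a\<^sup>2:] = [:a\<^sup>2:] ^ n * cone (subst (linact (slm (1 / a) 0 0 a)) f)"
      by (simp only: pcompose_cone cone_subst ins_scale[OF rhom_const hom])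
    also have "subst (linact (slm (1 / a) 0 0 a)) f = f" by (rule I) (use a in simp)
    also have "[:a\<^sup>2:] ^ n = [:a ^ (2 * n):]" by (simp add: poly_const_pow power_mult)
    finally show ?thesis by simp
  qed
  show "pcompose (cone f) [:0, - 1:] = smult \<epsilon> (cone f)"
  proof -
    have "pcompose (cpt i) [:0, - 1:] = (cone (linact refl_mat i) :: 'a poly)" for i
      using exhaust_3[of i]
      by (auto simp: linact_refl cone_simps pcompose_monom pcompose_one) (simp_all add: monom_altdef power2_eq_square)
    then have "pcompose (cone f) [:0, - 1:] = cone (subst (linact refl_mat) f)"
      by (simp add: pcompose_cone cone_subst)
    then show ?thesis by (simp add: sgn cone_simps)
  qed
  \<comment> \<open>The cone with s and t exchanged. The element w exchanges them only up to x_2 ->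
    - x_2; correcting this by the reflection brings in \<open>\<epsilon>\<close>.\<close>
  let ?w = "\<lambda>i::3. vector [monom 1 0, monom 1 1, monom 1 2] $ i :: 'a poly"
  have rev: "ins (\<lambda>c. [:c:]) ?w f = smult \<epsilon> (cone f)"
  proof -
    have "?w i = cone (subst (linact refl_mat) (linact (slm 0 1 (- 1) 0) i))" for i
      using exhaust_3[of i]
      by (auto simp: linact_slm subst_simps linact_refl cone_simps)
    then have "ins (\<lambda>c. [:c:]) ?w f = cone (subst (linact refl_mat) (subst (linact (slm 0 1 (- 1) 0)) f))"
      by (simp add: subst_subst cone_subst)
    also have "subst (linact (slm 0 1 (- 1) 0)) f = f" by (rule I) simp
    finally show ?thesis by (simp add: sgn cone_simps)
  qed
  show "coeff (cone f) (2 * n - k) = \<epsilon> * coeff (cone f) k" if "k \<le> 2 * n" for k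
  proof -
    have "\<epsilon> * coeff (cone f) k = coeff (ins (\<lambda>c. [:c:]) ?w f) k" unfolding rev by simp
    also have "\<dots> = (\<Sum>m\<in>keys f. if lookup m 2 + 2 * lookup m 3 = k
       then lookup f m else 0)"
      by (simp only: ins_def mon_monom) (simp add: coeff_sum if_distrib cong: if_cong)
    also have "\<dots> = coeff (cone f) (2 * n - k)"
      unfolding coeff_cone using hom that
      by (intro sum.cong) (auto simp: homog_def mdeg_alt)
    finally show ?thesis ..
  qed
qed

section \<open>The invariants of the group generated by $G$ and a reflection\<close>

definition Aset :: "'a::{field,finite} poly3 set" where
  "Aset = range (subst f123)"

lemma Aset_Cst: "Cst c \<in> Aset"
  and Aset_0: "0 \<in> Aset"
  and Aset_1: "1 \<in> Aset"
  and Aset_add: "x \<in> Aset \<Longrightarrow> y \<in> Aset \<Longrightarrow> x + y \<in> Aset"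
  and Aset_diff: "x \<in> Aset \<Longrightarrow> y \<in> Aset \<Longrightarrow> x - y \<in> Aset"
  and Aset_uminus: "x \<in> Aset \<Longrightarrow> - x \<in> Aset"
  and Aset_mult: "x \<in> Aset \<Longrightarrow> y \<in> Aset \<Longrightarrow> x * y \<in> Aset"
  and Aset_power: "x \<in> Aset \<Longrightarrow> x ^ n \<in> Aset"
proof -
  note s = subst_simps[symmetric, where \<sigma> = f123]
  show "Cst c \<in> Aset" unfolding Aset_def by (metis rangeI subst_Cst)
  show "0 \<in> Aset" "1 \<in> Aset" unfolding Aset_def by (metis rangeI subst_simps(1)) (metis rangeI subst_simps(2))
  show "x \<in> Aset \<Longrightarrow> y \<in> Aset \<Longrightarrow> x + y \<in> Aset" "x \<in> Aset \<Longrightarrow> y \<in> Aset \<Longrightarrow> x - y \<in> Aset"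
    "x \<in> Aset \<Longrightarrow> - x \<in> Aset" "x \<in> Aset \<Longrightarrow> y \<in> Aset \<Longrightarrow> x * y \<in> Aset" "x \<in> Aset \<Longrightarrow> x ^ n \<in> Aset"
    unfolding Aset_def by (auto simp: s simp del: subst_Cst)
qed

lemma Aset_f: "f1 \<in> Aset" "f2 \<in> Aset" "f3 \<in> Aset"
  unfolding Aset_def by (metis f123_simps rangeI subst_X)+

lemma Aset_induct [consumes 1, case_names Cst f add mult]:
  assumes "x \<in> Aset" "\<And>c. P (Cst c)" "P f1" "P f2" "P f3"
    "\<And>p r. P p \<Longrightarrow> P r \<Longrightarrow> P (p + r)" "\<And>p r. P p \<Longrightarrow> P r \<Longrightarrow> P (p * r)"
  shows "P x"
proof -
  obtain y where y: "x = subst f123 y" using assms(1) by (auto simp: Aset_def)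
  have "P (subst f123 y)"
  proof (induction y rule: poly3_ring_induct)
    case (X i)
    then show ?case using exhaust_3[of i] assms by (auto simp: f123_simps)
  qed (use assms in \<open>auto simp: subst_simps\<close>)
  then show ?thesis by (simp add: y)
qed

lemma Aset_inv:
  assumes "odd CARD('a::{field,finite})" "x \<in> (Aset :: 'a poly3 set)"
  shows "x \<in> inv_polys"
  using assms(2)
  by (induction rule: Aset_induct)
    (auto intro: inv_polys_Cst f1_inv f2_inv[OF assms(1)] f3_inv inv_polys_add inv_polys_mult)

lemma Aset_refl:
  assumes "odd CARD('a::{field,finite})" "x \<in> (Aset :: 'a poly3 set)"
  shows "subst (linact refl_mat) x = x"
  using assms(2)
  by (induction rule: Aset_induct) (auto simp: f1_refl f2_refl[OF assms(1)] f3_refl subst_simps)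

lemma inv_form_lift:
  fixes p :: "'a::{field,finite} poly"
  assumes q: "odd CARD('a)" and p: "inv_form 1 (2 * n) p"
  shows "\<exists>P\<in>Aset. homog n P \<and> cone P = p"
  using p
proof (induction n arbitrary: p rule: less_induct)
  case (less n)
  let ?q = "CARD('a)"
  have low: "\<exists>P\<in>Aset. homog n P \<and> cone P = p" if p: "inv_form 1 (2 * n) p" and c: "coeff p (2 * n) = 0" for p :: "'a poly"
  proof (cases "p = 0")
    case True
    then show ?thesis by (intro bexI[of _ 0]) (auto simp: Aset_0 cone_simps)
  next
    case False
    have "coeff p 0 = 0"
      using p c unfolding inv_form_def by (metis diff_self_eq_0 le_refl mult_1)
    from inv_form_step[OF q p this False] obtain p' where p': "p = upoly * p'" "?q + 1 \<le> 2 * n"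
      "inv_form (- 1) (2 * n - (?q + 1)) p'" .
    have "p' \<noteq> 0" using False p'(1) by auto
    \<comment> \<open>After one division the cofactor is odd in z, so it vanishes at 0 as well. A
      second division follows, and the two together remove \<open>upoly\<close> squared, the
      restriction of \<open>f2\<close>.\<close>
    have "poly (pcompose p' [:0, - 1:]) 0 = poly (smult (- 1) p') 0"
      using p'(3) by (simp add: inv_form_def)
    then have "2 * coeff p' 0 = 0" by (simp add: poly_pcompose poly_0_coeff_0 eq_neg_iff_add_eq_0)
    then have "coeff p' 0 = 0" using two_neq_0[OF q] by simp
    from inv_form_step[OF q p'(3) this \<open>p' \<noteq> 0\<close>] obtain p'' where p'': "p' = upoly * p''"
      "?q + 1 \<le> 2 * n - (?q + 1)" "inv_form (- (- 1)) (2 * n - (?q + 1) - (?q + 1)) p''" .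
    have eq: "2 * n - (?q + 1) - (?q + 1) = 2 * (n - (?q + 1))" by linarith
    have "\<exists>P\<in>Aset. homog (n - (?q + 1)) P \<and> cone P = p''"
      by (rule less.IH) (use p'' eq in auto)
    then obtain P where P: "P \<in> Aset" "homog (n - (?q + 1)) P" "cone P = p''" by blast
    have "homog (?q + 1 + (n - (?q + 1))) (f2 * P)" by (rule homog_mult[OF homog_f2 P(2)])
    moreover have "?q + 1 + (n - (?q + 1)) = n" using p''(2) by linarith
    ultimately have "homog n (f2 * P)" by simp
    moreover have "cone (f2 * P) = p"
      by (simp add: cone_simps cone_f2 P p'(1) p''(1) power2_eq_square)
    ultimately show ?thesis using Aset_mult[OF Aset_f(2) P(1)] by blast
  qed
  show ?case
  proof (cases "coeff p (2 * n) = 0")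
    case False
    then have "p \<noteq> 0" "degree p = 2 * n"
      using less.prems le_degree[OF False] by (auto simp: inv_form_def)
    \<comment> \<open>q (q - 1) is twice the degree of \<open>f3\<close>, so n is a multiple of that
      degree and a power of \<open>f3\<close>, whose restriction is monic of degree 2 n, can kill
      the top coefficient.\<close>
    then have "?q * (?q - 1) dvd 2 * n"
      using inv_form_degree[OF less.prems] by simp
    then have "card (L :: ('a \<times> 'a) set) dvd n"
      using card_L[OF q] by (metis dvd_mult_cancel_left nat_mult_dvd_cancel_disj zero_neq_numeral)
    then obtain k where k: "n = card (L :: ('a \<times> 'a) set) * k" by (elim dvdE)
    let ?c = "coeff p (2 * n)" and ?g = "f3 ^ k :: 'a poly3"
    have g: "homog n ?g" "?g \<in> Aset"
      unfolding k by (auto intro: homog_power homog_f3 Aset_power Aset_f)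
    have "inv_form 1 (2 * n) (cone ?g)"
      by (rule inv_form_cone) (use g Aset_inv[OF q g(2)] Aset_refl[OF q g(2)] in \<open>auto simp: Cst_simps\<close>)
    then have 1: "inv_form 1 (2 * n) (p - smult ?c (cone ?g))"
      by (intro inv_form_diff inv_form_smult less.prems)
    have "degree (cone ?g) = 2 * n"
      by (simp add: cone_simps k degree_power_eq[OF cone_f3_neq_0] degree_cone_f3)
    moreover have "lead_coeff (cone ?g) = 1"
      by (simp only: cone_simps lead_coeff_power cone_f3_monic power_one)
    ultimately have "coeff (p - smult ?c (cone ?g)) (2 * n) = 0" by auto
    from low[OF 1 this] obtain P where P: "P \<in> Aset" "homog n P" "cone P = p - smult ?c (cone ?g)" by blast
    show ?thesis
      by (rule bexI[of _ "P + Cst ?c * ?g"])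
        (use P g in \<open>auto simp: cone_simps intro: homog_add homog_Cst_mult Aset_add Aset_mult Aset_Cst\<close>)
  qed (use low less.prems in blast)
qed

lemma Cst_eq_0_iff: "Cst c = 0 \<longleftrightarrow> c = 0"
  unfolding Cst_def by (metis lookup_single_eq lookup_zero single_zero)

lemma poly3_two_neq_0:
  assumes "odd CARD('a::{field,finite})"
  shows "(2 :: 'a poly3) \<noteq> 0"
  using Cst_eq_0_iff[of "2::'a"] two_neq_0[OF assms] by (simp add: Cst_simps)

lemma poly3_eq_uminus_self:
  assumes "odd CARD('a::{field,finite})" "x = - (x :: 'a poly3)"
  shows "x = 0"
proof -
  have "2 * x = 0" using assms(2) unfolding eq_neg_iff_add_eq_0 by (simp only: mult_2)
  then show ?thesis using poly3_two_neq_0[OF assms(1)] by simp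
qed

lemma X_neq_0: "X i \<noteq> (0 :: 'a::idom poly3)"
  unfolding X_def by (metis lookup_single_eq lookup_zero zero_neq_one)

lemma homog_unique: "homog a f \<Longrightarrow> homog b f \<Longrightarrow> f \<noteq> 0 \<Longrightarrow> a = b"
  by (metis hcomp_homog)

lemma f1_neq_0: "(f1 :: 'a::{field,finite} poly3) \<noteq> 0"
proof
  assume "(f1 :: 'a poly3) = 0"
  then have "ins (\<lambda>c. c) (\<lambda>i. 1 - (if i = 2 then 1 else 0)) (f1 :: 'a poly3) = 0"
    by (simp add: rhom_zero[OF rhom_ins[OF rhom_id]])
  then show False
    by (simp add: f1_def rhom_simps[OF rhom_ins[OF rhom_id]] ins_X rhom_id)
qed

subsection \<open>The kernel of the restriction to the cone\<close>

text \<open>Normal forms modulo \<open>f1\<close>: for each k \<le> 2 n the monomial of degree n, at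
  most linear in x_2, that restricts to z^k.\<close>

definition ubase :: "nat \<Rightarrow> nat \<Rightarrow> 'a::comm_ring_1 poly3" where
  "ubase n k = X 1 ^ (k div 2) * X 2 ^ (k mod 2) * X 3 ^ (n - k div 2 - k mod 2)"

lemma homog_X_power: "homog k (X i ^ k)"
  using homog_power[OF homog_X, of k i] by simp

lemma power_diff_multiple:
  "\<exists>h. homog (2 * (e - 1)) h \<and> (X 1 * X 3) ^ e - (X 2 ^ 2) ^ e = (f1 :: 'a::{field,finite} poly3) * h"
proof (cases e)
  case 0
  then show ?thesis by (intro exI[of _ 0]) auto
next
  case (Suc k)
  have "homog 2 (X 1 * X 3 :: 'a poly3)" "homog 2 (X 2 ^ 2 :: 'a poly3)"
    using homog_mult[OF homog_X[of 1] homog_X[of 3], where 'a = 'a] homog_X_power[of 2 2, where 'a = 'a]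
    by (simp_all add: numeral_2_eq_2)
  then have "homog (2 * k) (\<Sum>p<Suc k. (X 1 * X 3) ^ p * (X 2 ^ 2 :: 'a poly3) ^ (k - p))"
  proof (intro homog_sum)
    fix p assume h: "homog 2 (X 1 * X 3 :: 'a poly3)" "homog 2 (X 2 ^ 2 :: 'a poly3)" "p \<in> {..<Suc k}"
    have "homog (2 * p + 2 * (k - p)) ((X 1 * X 3) ^ p * (X 2 ^ 2 :: 'a poly3) ^ (k - p))"
      by (intro homog_mult homog_power h)
    moreover have "2 * p + 2 * (k - p) = 2 * k" using h(3) by auto
    ultimately show "homog (2 * k) ((X 1 * X 3) ^ p * (X 2 ^ 2 :: 'a poly3) ^ (k - p))" by simp
  qed
  then show ?thesis
    unfolding Suc diff_power_eq_sum f1_def by auto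
qed

text \<open>Replacing x_2^2 by x_1 x_3 changes a monomial by a multiple of \<open>f1\<close> and
  preserves its image on the cone.\<close>

lemma mon_reduce:
  assumes "mdeg m = n"
  shows "\<exists>g. homog (n - 2) g \<and>
    mon X m = (f1 :: 'a::{field,finite} poly3) * g + ubase n (2 * lookup m 1 + lookup m 2)"
proof -
  define a b c where "a = lookup m 1" and "b = lookup m 2" and "c = lookup m 3"
  define e r where "e = b div 2" and "r = b mod 2"
  have b: "b = 2 * e + r" by (simp add: e_def r_def)
  have n: "n = a + b + c" using assms by (simp add: mdeg_alt a_def b_def c_def)
  obtain h where h: "homog (2 * (e - 1)) h" "(X 1 * X 3) ^ e - (X 2 ^ 2) ^ e = (f1 :: 'a poly3) * h"
    using power_diff_multiple by blast
  let ?t = "X 1 ^ a * X 2 ^ r * X 3 ^ c :: 'a poly3"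
  have "X 2 ^ b = X 2 ^ r * (X 2 ^ 2 :: 'a poly3) ^ e"
    unfolding b power_add power_mult by (rule mult.commute)
  then have "mon X m = ?t * (X 2 ^ 2) ^ e"
    by (simp add: mon_def prod_3 a_def[symmetric] b_def[symmetric] c_def[symmetric] algebra_simps)
  also have "(X 2 ^ 2) ^ e = (X 1 * X 3) ^ e - (f1 :: 'a poly3) * h"
    by (simp flip: h(2))
  finally have "mon X m = f1 * (- (h * ?t)) + X 1 ^ (a + e) * X 2 ^ r * X 3 ^ (c + e)"
    by (simp add: algebra_simps power_mult_distrib power_add)
  moreover have "X 1 ^ (a + e) * X 2 ^ r * X 3 ^ (c + e) = (ubase n (2 * a + b) :: 'a poly3)"
  proof -
    have "r < 2" by (simp add: r_def)
    have "(2 * a + b) div 2 = a + e" "(2 * a + b) mod 2 = r" by (simp_all add: e_def r_def)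
    moreover have "n - (a + e) - r = c + e" by (simp add: n b)
    ultimately show ?thesis by (simp add: ubase_def)
  qed
  \<comment> \<open>As n - 2 is truncated, e = 0 is separate: there the cofactor is 0. For e > 0 the
    degree n is at least 2.\<close>
  moreover have "homog (n - 2) (- (h * ?t))"
  proof (cases "e = 0")
    case True
    then have "f1 * h = 0" using h(2) by simp
    then have "h = 0" using f1_neq_0[where 'a = 'a] by simp
    then show ?thesis by simp
  next
    case False
    have "homog (2 * (e - 1) + (a + r + c)) (h * ?t)"
      by (intro homog_mult h homog_X_power)
    moreover have "2 * (e - 1) + (a + r + c) = n - 2" using False by (simp add: n b)
    ultimately show ?thesis by (simp add: homog_uminus)
  qed
  ultimately show ?thesis unfolding a_def b_def by metis
qed

text \<open>The coefficients of the normal form are exactly those of the restriction, so the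
  restriction can vanish only on multiples of \<open>f1\<close>.\<close>

lemma cone_reduce:
  assumes "homog n f"
  shows "\<exists>g. homog (n - 2) g \<and>
    f = (f1 :: 'a::{field,finite} poly3) * g + (\<Sum>k\<le>2 * n. Cst (coeff (cone f) k) * ubase n k)"
proof -
  let ?s = "\<lambda>f. \<Sum>k\<le>2 * n. Cst (coeff (cone f) k) * ubase n k :: 'a poly3"
  let ?Q = "\<lambda>f. \<exists>g. homog (n - 2) g \<and> f = f1 * g + ?s f"
  have add: "?Q (p + r)" if "?Q p" "?Q r" for p r
  proof -
    from that obtain g h where "homog (n - 2) g" "p = f1 * g + ?s p" "homog (n - 2) h" "r = f1 * h + ?s r" by blast
    moreover have "?s (p + r) = ?s p + ?s r"
      by (simp add: cone_simps Cst_simps ring_distribs sum.distrib)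
    ultimately have "p + r = (f1 * g + ?s p) + (f1 * h + ?s r)" "?s (p + r) = ?s p + ?s r" "homog (n - 2) (g + h)"
      by (simp_all only: homog_add)
    then have "p + r = f1 * (g + h) + ?s (p + r)" "homog (n - 2) (g + h)"
      by (simp_all only: ring_distribs ac_simps)
    then show ?thesis by blast
  qed
  have single: "?Q (single m c)" if m: "mdeg m = n" for m c
  proof -
    let ?k = "2 * lookup m 1 + lookup m 2"
    obtain g where g: "homog (n - 2) g" "mon X m = (f1 :: 'a poly3) * g + ubase n ?k" using mon_reduce[OF m] by blast
    have k: "?k \<le> 2 * n" using m by (simp add: mdeg_alt)
    have "cone (single m c) = monom c ?k"
      by (simp add: cone_def ins_single rhom_const mon_cpt smult_monom)
    then have "?s (single m c) = (\<Sum>k\<le>2 * n. if k = ?k then Cst c * ubase n k else 0)"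
      by (intro sum.cong) (auto simp: Cst_simps)
    then have "?s (single m c) = Cst c * ubase n ?k" using k by simp
    then have "single m c = f1 * (Cst c * g) + ?s (single m c)"
      by (simp add: single_eq_mon g(2) algebra_simps)
    then show ?thesis using homog_Cst_mult[OF g(1)] by blast
  qed
  have "?Q (\<Sum>m\<in>A. single m (lookup f m))"
    if "finite A" "A \<subseteq> keys f" for A
    using that
  proof (induction A)
    case empty
    show ?case by (intro exI[of _ 0]) (simp add: cone_simps Cst_simps)
  next
    case (insert m A)
    have "mdeg m = n" using insert assms by (auto simp: homog_def)
    from add[OF single[OF this] insert.IH] insert show ?case by simp
  qed
  from this[OF finite_keys order_refl] show ?thesis by (simp flip: poly3_expand)
qed

text \<open>The bound on n makes n - 2 a proper decrease, as the inductions on the degree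
  require.\<close>

lemma cone_eq_0:
  assumes "homog n f" "cone f = 0" "(f :: 'a::{field,finite} poly3) \<noteq> 0"
  obtains g where "homog (n - 2) g" "f = f1 * g" "2 \<le> n"
proof -
  obtain g where g: "homog (n - 2) g" "f = f1 * g"
    using cone_reduce[OF assms(1)] assms(2) by (auto simp: Cst_simps)
  have "homog (2 + (n - 2)) f" unfolding g(2) by (rule homog_mult[OF homog_f1 g(1)])
  from homog_unique[OF this assms(1,3)] have "2 \<le> n" by linarith
  with g show ?thesis by (rule that)
qed

lemma inv_polys_cancel:
  fixes g :: "'a::field poly3"
  assumes "f * g \<in> inv_polys" "f \<in> inv_polys" "f \<noteq> 0"
  shows "g \<in> inv_polys"
  unfolding inv_polys_iff
proof (intro allI impI)
  fix a b c d :: 'a assume det: "a * d - b * c = 1"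
  have "f * subst (linact (slm a b c d)) g = f * g"
    using assms(1,2) det unfolding inv_polys_iff by (metis subst_simps(4))
  then show "subst (linact (slm a b c d)) g = g" using assms(3) by simp
qed

text \<open>Lift the restriction of f to an element of the algebra and subtract it; the difference
  is \<open>f1\<close> times an invariant with the same symmetry and smaller degree.\<close>

lemma Aset_homog:
  fixes f :: "'a::{field,finite} poly3"
  assumes q: "odd CARD('a)"
    and "f \<in> inv_polys" "homog n f" "subst (linact refl_mat) f = f"
  shows "f \<in> Aset"
  using assms(2-4)
proof (induction n arbitrary: f rule: less_induct)
  case (less n)
  have "inv_form 1 (2 * n) (cone f)"
    by (rule inv_form_cone) (use less.prems in \<open>auto simp: Cst_simps\<close>)
  then obtain P where P: "P \<in> Aset" "homog n P" "cone P = cone f"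
    using inv_form_lift[OF q] by blast
  show ?case
  proof (cases "f = P")
    case False
    have "homog n (f - P)" "cone (f - P) = 0" "f - P \<noteq> 0"
      using less.prems P False by (auto simp: homog_diff cone_simps)
    then obtain g where g: "homog (n - 2) g" "f - P = f1 * g" "2 \<le> n" by (rule cone_eq_0)
    have fP: "f - P \<in> inv_polys" "subst (linact refl_mat) (f - P) = f - P"
      using less.prems P(1) by (auto simp: inv_polys_diff Aset_inv[OF q] Aset_refl[OF q] subst_simps)
    have "g \<in> inv_polys"
      using fP(1) unfolding g(2) by (rule inv_polys_cancel[OF _ f1_inv f1_neq_0])
    moreover have "subst (linact refl_mat) g = g"
      using fP(2) f1_neq_0[where 'a = 'a] unfolding g(2) by (simp add: subst_simps f1_refl)
    ultimately have "g \<in> Aset" using less.IH[of "n - 2" g] g by simp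
    moreover have "f = f1 * g + P" using g(2) by (simp add: algebra_simps)
    ultimately show ?thesis using P(1) by (simp add: Aset_add Aset_mult Aset_f)
  qed (use P in simp)
qed

section \<open>The reflection normalises the group\<close>

lemma refl_refl: "refl_mat ** refl_mat = mat 1"
  by (simp add: vec_eq_iff forall_3 matrix_matrix_mult_def sum_3 refl_mat_def mat_def)

lemma subst_refl_refl: "subst (linact refl_mat) (subst (linact refl_mat) f) = f"
  by (simp add: subst_linact_linact refl_refl linact_mat_1 subst_X_id)

text \<open>Conjugation by the reflection negates b and c and keeps the determinant.\<close>

lemma refl_slm: "refl_mat ** slm a b c e = slm a (- b) (- c) e ** refl_mat"
  by (simp add: vec_eq_iff forall_3 matrix_matrix_mult_def sum_3 refl_mat_def slm_def)

lemma inv_polys_refl: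
  assumes "f \<in> inv_polys" shows "subst (linact refl_mat) f \<in> inv_polys"
  unfolding inv_polys_iff
proof (intro allI impI)
  fix a b c d :: 'a assume det: "a * d - b * c = 1"
  have "subst (linact (slm a b c d)) (subst (linact refl_mat) f)
     = subst (linact refl_mat) (subst (linact (slm a (- b) (- c) d)) f)"
    by (simp add: subst_linact_linact refl_slm)
  also have "subst (linact (slm a (- b) (- c) d)) f = f"
    using assms det unfolding inv_polys_iff by simp
  finally show "subst (linact (slm a b c d)) (subst (linact refl_mat) f) = subst (linact refl_mat) f" .
qed

lemma Aset_sum: "(\<And>x. x \<in> A \<Longrightarrow> g x \<in> Aset) \<Longrightarrow> sum g A \<in> Aset"
  by (induction A rule: infinite_finite_induct) (auto simp: Aset_0 Aset_add)

lemma Aset_iff: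
  fixes f :: "'a::{field,finite} poly3"
  assumes q: "odd CARD('a)"
  shows "f \<in> Aset \<longleftrightarrow> f \<in> inv_polys \<and> subst (linact refl_mat) f = f"
proof
  assume f: "f \<in> inv_polys \<and> subst (linact refl_mat) f = f"
  obtain A where A: "finite A" "f = (\<Sum>n\<in>A. hcomp n f)" using sum_hcomp .
  have "hcomp n f \<in> Aset" for n
    by (rule Aset_homog[OF q _ homog_hcomp])
      (use f in \<open>auto simp: inv_polys_hcomp hcomp_subst[OF homog_linact, symmetric]\<close>)
  then have "(\<Sum>n\<in>A. hcomp n f) \<in> Aset" by (rule Aset_sum)
  then show "f \<in> Aset" using A(2) by simp
qed (simp add: Aset_inv[OF q] Aset_refl[OF q])

section \<open>Anti-invariants of the reflection\<close>

lemma prod_roots_dvd: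
  fixes p :: "'b::idom poly"
  assumes "finite S" "\<And>a. a \<in> S \<Longrightarrow> poly p a = 0"
  shows "(\<Prod>a\<in>S. [:- a, 1:]) dvd p"
  using assms
proof (induction S)
  case (insert a S)
  then obtain r where r: "p = (\<Prod>a\<in>S. [:- a, 1:]) * r" by (auto elim: dvdE)
  have "poly p a = 0" using insert.prems by simp
  moreover have "poly (\<Prod>a\<in>S. [:- a, 1:]) a \<noteq> 0"
    using insert.hyps by (auto simp: poly_prod)
  ultimately have "poly r a = 0" unfolding r by simp
  then have "[:- a, 1:] dvd r" by (simp add: poly_eq_0_iff_dvd)
  then have "(\<Prod>a\<in>S. [:- a, 1:]) * [:- a, 1:] dvd (\<Prod>a\<in>S. [:- a, 1:]) * r"
    by (rule mult_dvd_mono[OF dvd_refl])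
  moreover have "(\<Prod>a\<in>insert a S. [:- a, 1:]) = (\<Prod>a\<in>S. [:- a, 1:]) * [:- a, 1:]"
    by (subst prod.insert) (use insert.hyps in \<open>simp_all only: mult.commute simp_thms\<close>)
  ultimately show ?case by (simp only: r)
qed simp

text \<open>On the plane x_2 = 0 the reflection is trivial, so an anti-invariant equals its own
  negative there and is 0 in odd characteristic. A lower unipotent matrix with entry b carries the
  plane x_2 = b x_1 to x_2 = 0.\<close>

lemma anti_eval:
  fixes f :: "'a::{field,finite} poly3"
  assumes q: "odd CARD('a)" and inv: "f \<in> inv_polys" and anti: "subst (linact refl_mat) f = - f"
  shows "ins (\<lambda>c. [:c:]) (\<lambda>i. vector [x, smult b x, y] $ i) f = 0"
proof -
  let ?I = "ins (\<lambda>c. [:c:]) :: _ \<Rightarrow> 'a poly3 \<Rightarrow> 'a poly"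
  have zero: "?I (\<lambda>i. vector [x, 0, z] $ i) f = 0" for z
  proof -
    have "?I (\<lambda>i. vector [x, 0, z] $ i) (linact refl_mat j) = vector [x, 0, z] $ j" for j
      using exhaust_3[of j]
      by (auto simp: linact_refl rhom_simps[OF rhom_ins[OF rhom_const]] ins_X rhom_const)
    then have "?I (\<lambda>i. vector [x, 0, z] $ i) (subst (linact refl_mat) f) = ?I (\<lambda>i. vector [x, 0, z] $ i) f"
      by (simp add: ins_subst[OF rhom_const])
    then have "?I (\<lambda>i. vector [x, 0, z] $ i) f = - ?I (\<lambda>i. vector [x, 0, z] $ i) f"
      unfolding anti by (simp add: rhom_uminus[OF rhom_ins[OF rhom_const]])
    then have "2 * ?I (\<lambda>i. vector [x, 0, z] $ i) f = 0"
      unfolding eq_neg_iff_add_eq_0 by (simp only: mult_2)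
    moreover have "(2 :: 'a poly) \<noteq> 0"
      using two_neq_0[OF q] by (metis degree_0 numeral_poly pCons_eq_0_iff)
    ultimately show ?thesis by simp
  qed
  have "?I (\<lambda>i. vector [x, smult b x, y] $ i) (linact (slm 1 0 b 1) j)
     = vector [x, 0, smult (b\<^sup>2) x - smult (2 * b) (smult b x) + y] $ j" for j
    using exhaust_3[of j]
    by (auto simp: linact_slm rhom_simps[OF rhom_ins[OF rhom_const]] ins_X ins_Cst rhom_const ac_simps)
  then have "?I (\<lambda>i. vector [x, smult b x, y] $ i) (subst (linact (slm 1 0 b 1)) f) = 0"
    by (simp add: ins_subst[OF rhom_const] zero)
  moreover have "subst (linact (slm 1 0 b 1)) f = f"
    using inv unfolding inv_polys_iff by simp
  ultimately show ?thesis by simp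
qed

text \<open>An anti-invariant vanishes on the $q$ planes $x_2 = b x_1$; all of them pass through the
  point $z = 0$ of the cone.\<close>

lemma anti_order:
  fixes f :: "'a::{field,finite} poly3"
  assumes q: "odd CARD('a)" and inv: "f \<in> inv_polys" and anti: "subst (linact refl_mat) f = - f"
    and "cone f \<noteq> 0"
  shows "CARD('a) \<le> order 0 (cone f)"
proof -
  let ?h = "\<lambda>c. [:[:c:]:] :: 'a poly poly"
  have h: "rhom ?h" using rhom_comp[OF rhom_const rhom_const, where 'c = 'a] by simp
  \<comment> \<open>f at (z^2, T, 1), as a polynomial in T over F[z]: the plane x_2 = b x_1 becomes
    the root T = b z^2, and T = z gives the restriction to the cone.\<close>
  define Fp where "Fp = ins ?h (\<lambda>i::3. vector [[:monom 1 2:], [:0, 1:], 1] $ i) f"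
  have ev: "poly Fp x = ins (\<lambda>c. [:c:]) (\<lambda>i. vector [monom 1 2, x, 1] $ i) f" for x
  proof -
    have p: "rhom (\<lambda>r. poly r x)" by (rule rhomI) auto
    have "poly Fp x = ins (\<lambda>c. poly (?h c) x) (\<lambda>i::3. poly (vector [[:monom 1 2:], [:0, 1:], 1] $ i) x) f"
      unfolding Fp_def using rhom_eq_ins[OF rhom_comp[OF p rhom_ins[OF h]], of _ f]
      by (simp add: ins_Cst ins_X h)
    also have "(\<lambda>i::3. poly (vector [[:monom 1 2:], [:0, 1:], 1] $ i) x) = (\<lambda>i. vector [monom 1 2, x, 1] $ i)"
    proof
      fix i :: 3 show "poly (vector [[:monom 1 2:], [:0, 1:], 1] $ i) x = vector [monom 1 2, x, 1] $ i"
        using exhaust_3[of i] by auto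
    qed
    finally show ?thesis by simp
  qed
  let ?S = "(\<lambda>b::'a. monom b 2) ` UNIV"
  have "poly Fp a = 0" if aS: "a \<in> ?S" for a
  proof -
    from aS obtain b where "a = monom b 2" by blast
    then have b: "a = smult b (monom 1 2)" by (simp add: smult_monom)
    show ?thesis unfolding ev b by (rule anti_eval[OF q inv anti])
  qed
  then have "(\<Prod>a\<in>?S. [:- a, 1:]) dvd Fp" by (intro prod_roots_dvd) auto
  then obtain G where G: "Fp = (\<Prod>a\<in>?S. [:- a, 1:]) * G" by (elim dvdE)
  have inj: "inj (\<lambda>b::'a. monom b 2)" by (auto intro!: injI)
  have "cone f = poly Fp (monom 1 1)"
    unfolding ev cone_def cpt_def by simp
  also have "\<dots> = (\<Prod>b\<in>UNIV. monom 1 1 - monom b 2) * poly G (monom 1 1)"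
    by (simp add: G poly_prod prod.reindex[OF inj])
  \<comment> \<open>z - b z^2 = z (1 - b z), so each of the q planes contributes one zero at z =
    0.\<close>
  also have "(\<Prod>b::'a\<in>UNIV. monom 1 1 - monom b 2) = (\<Prod>b\<in>UNIV. [:0, 1:] * (1 - monom b 1))"
    by (rule prod.cong) (simp_all add: monom_altdef power2_eq_square algebra_simps)
  also have "\<dots> = [:0, 1:] ^ CARD('a) * (\<Prod>b\<in>UNIV. 1 - monom b 1)"
    by (simp only: prod.distrib prod_constant)
  finally have "[:- 0, 1:] ^ CARD('a) dvd cone f" by (simp add: mult.assoc)
  then show ?thesis using \<open>cone f \<noteq> 0\<close> order_divides[of "0::'a" "CARD('a)" "cone f"] by simp
qed

subsection \<open>The restriction of the Jacobian determinant\<close>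

lemma prime_elem_dvd_prodD: "prime_elem p \<Longrightarrow> p dvd prod g A \<Longrightarrow> \<exists>x\<in>A. p dvd g x"
  by (induction A rule: infinite_finite_induct)
    (auto simp: prime_elem_dvd_mult_iff prime_elem_not_unit)

lemma irreducible_quadratic:
  fixes b c :: "'a::field"
  assumes "\<nexists>s. b\<^sup>2 - 4 * c = s\<^sup>2"
  shows "irreducible [:c, b, 1:]"
proof (rule irreducibleI)
  have noroot: "poly [:c, b, 1:] x \<noteq> 0" for x
  proof
    assume "poly [:c, b, 1:] x = 0"
    then have "c + x * (b + x) = 0" by simp
    moreover have "(2 * x + b)\<^sup>2 - (b\<^sup>2 - 4 * c) = 4 * (c + x * (b + x))"
      by (simp add: power2_eq_square algebra_simps)
    ultimately have "b\<^sup>2 - 4 * c = (2 * x + b)\<^sup>2" by simp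
    then show False using assms by blast
  qed
  show "[:c, b, 1:] \<noteq> 0" by simp
  show "\<not> [:c, b, 1:] dvd 1" by (simp add: is_unit_iff_degree)
  fix u v assume uv: "[:c, b, 1:] = u * v"
  then have nz: "u \<noteq> 0" "v \<noteq> 0" by auto
  have "degree u + degree v = 2" using degree_mult_eq[OF nz] by (simp flip: uv)
  moreover have "degree u \<noteq> 1"
  proof
    assume "degree u = 1"
    then obtain x y where u: "u = [:x, y:]" "y \<noteq> 0"
      by (metis degree1_coeffs)
    then have "poly u (- x / y) = 0" by simp
    then show False using noroot[of "- x / y"] uv by (metis poly_mult mult_zero_left)
  qed
  ultimately have "degree u = 0 \<or> degree v = 0" by linarith
  then show "u dvd 1 \<or> v dvd 1" using nz by (auto simp: is_unit_iff_degree)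
qed

lemma card_L_pos:
  assumes "odd CARD('a::{field,finite})"
  shows "card (L :: ('a \<times> 'a) set) > 0"
  using card_L[OF assms] card_field_ge_3[OF assms] by (cases "card (L :: ('a \<times> 'a) set)") auto

text \<open>Write the restriction as m r with m one of the quadratics. A vanishing derivative would
  make m divide m' r; but m' is nonzero of smaller degree, as 2 \<noteq> 0, and r is a product of
  other monic irreducible quadratics.\<close>

lemma pderiv_cone_f3:
  assumes q: "odd CARD('a::{field,finite})"
  shows "pderiv (cone f3 :: 'a poly) \<noteq> 0"
proof
  assume 0: "pderiv (cone f3 :: 'a poly) = 0"
  obtain b c :: 'a where bc: "(b, c) \<in> L" using card_L_pos[OF q] by (metis card_gt_0_iff ex_in_conv surj_pair)
  let ?m = "\<lambda>(b, c). [:c, b, 1::'a:]"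
  define r where "r = (\<Prod>x\<in>L - {(b, c)}. ?m x)"
  have D: "cone f3 = [:c, b, 1:] * r"
    unfolding cone_f3 r_def using prod.remove[OF _ bc, of ?m] by simp
  have prime: "prime_elem [:c, b, 1:]"
    by (rule field_poly_irreducible_imp_prime, rule irreducible_quadratic) (use bc in \<open>auto simp: L_def\<close>)
  have "[:c, b, 1:] * pderiv r + r * pderiv [:c, b, 1:] = 0"
    using 0 unfolding D pderiv_mult .
  then have "[:c, b, 1:] dvd pderiv [:c, b, 1:] * r"
    by (metis dvd_0_right dvd_add_right_iff dvd_triv_left mult.commute)
  then have "[:c, b, 1:] dvd pderiv [:c, b, 1:] \<or> [:c, b, 1:] dvd r"
    using prime by (simp add: prime_elem_dvd_mult_iff)
  then show False
  proof
    assume "[:c, b, 1:] dvd pderiv [:c, b, 1:]"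
    moreover have "pderiv [:c, b, 1:] = [:b, 2:]" by (simp add: pderiv_pCons)
    ultimately have "degree [:c, b, 1:] \<le> degree [:b, 2:]"
      using two_neq_0[OF q] by (intro dvd_imp_degree_le) auto
    then show False using two_neq_0[OF q] by simp
  next
    assume "[:c, b, 1:] dvd r"
    then have "\<exists>x\<in>L - {(b, c)}. [:c, b, 1:] dvd ?m x"
      unfolding r_def by (rule prime_elem_dvd_prodD[OF prime])
    then obtain x where x: "x \<in> L - {(b, c)}" "[:c, b, 1:] dvd ?m x" by blast
    obtain b' c' where x': "x = (b', c')" by (rule prod.exhaust)
    then have bc': "(b', c') \<noteq> (b, c)" "[:c, b, 1:] dvd [:c', b', 1:]" using x by simp_all
    then obtain k where k: "[:c', b', 1:] = [:c, b, 1:] * k" by (elim dvdE)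
    then have "k \<noteq> 0" by auto
    then have "degree ([:c, b, 1:] * k) = 2 + degree k" by (subst degree_mult_eq) simp_all
    then have "degree k = 0" unfolding k[symmetric] by simp
    then obtain k0 where "k = [:k0:]" by (rule degree_eq_zeroE)
    then show False using k bc'(1) by simp
  qed
qed

lemma of_nat_card_poly3: "of_nat CARD('a::{field,finite}) = (0 :: 'a poly3)"
  using rhom_of_nat[OF rhom_Cst, of "CARD('a)", where 'a = 'a] by (simp add: of_nat_card_eq_0 Cst_simps)

lemma partial_f1: "partial 1 f1 = X 3" "partial 2 f1 = - 2 * X 2" "partial 3 f1 = X 1"
  by (simp_all add: f1_def partial_diff partial_mult partial_power partial_X)

text \<open>Derivatives of q-th powers vanish, so the gradient of \<open>f2\<close> is that of
  \<open>f1\<close> with every variable replaced by its q-th power.\<close>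

lemma partial_f2:
  "partial 1 f2 = (X 3 ^ CARD('a) :: 'a::{field,finite} poly3)"
  "partial 2 f2 = (- 2 * X 2 ^ CARD('a) :: 'a::{field,finite} poly3)"
  "partial 3 f2 = (X 1 ^ CARD('a) :: 'a::{field,finite} poly3)"
proof -
  have 2: "(2 :: 'a poly3) = Cst 2" by (simp add: Cst_simps)
  show "partial 1 f2 = (X 3 ^ CARD('a) :: 'a::{field,finite} poly3)"
    "partial 2 f2 = (- 2 * X 2 ^ CARD('a) :: 'a poly3)"
    "partial 3 f2 = (X 1 ^ CARD('a) :: 'a poly3)"
    unfolding f2_def 2
    by (simp_all add: partial_diff partial_add partial_mult partial_power partial_X of_nat_card_poly3)
qed

lemma of_nat_card_L:
  assumes q: "odd CARD('a::{field,finite})"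
  shows "of_nat (card (L :: ('a \<times> 'a) set)) = (0::'a)"
proof -
  have "of_nat (2 * card (L :: ('a \<times> 'a) set)) = (of_nat CARD('a) * of_nat (CARD('a) - 1) :: 'a)"
    unfolding card_L[OF q] by (rule of_nat_mult)
  then show ?thesis using two_neq_0[OF q] by (simp add: of_nat_card_eq_0)
qed

lemma f4_alt: "f4 = partial 1 f1 * (partial 2 f2 * partial 3 f3 - partial 3 f2 * partial 2 f3)
    - partial 2 f1 * (partial 1 f2 * partial 3 f3 - partial 3 f2 * partial 1 f3)
    + partial 3 f1 * (partial 1 f2 * partial 2 f3 - partial 2 f2 * partial 1 f3)"
  by (simp add: f4_def det_3 f123_simps algebra_simps)

lemma homog_f4:
  assumes q: "odd CARD('a::{field,finite})"
  shows "homog (CARD('a) + card (L :: ('a \<times> 'a) set)) (f4 :: 'a poly3)"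
proof -
  let ?l = "card (L :: ('a \<times> 'a) set)"
  have 1: "homog 1 (partial i f1 :: 'a poly3)" for i using homog_partial[OF homog_f1, of i] by simp
  have 2: "homog CARD('a) (partial i f2 :: 'a poly3)" for i using homog_partial[OF homog_f2, of i] by simp
  have 3: "homog (?l - 1) (partial i f3 :: 'a poly3)" for i using homog_partial[OF homog_f3, of i] .
  have "homog (1 + (CARD('a) + (?l - 1))) (f4 :: 'a poly3)"
    unfolding f4_alt by (intro homog_add homog_diff homog_mult 1 2 3)
  moreover have "1 + (CARD('a) + (?l - 1)) = CARD('a) + ?l" using card_L_pos[OF q] by simp
  ultimately show ?thesis by simp
qed

text \<open>Two linear relations hold between the partial derivatives of \<open>f3\<close> on the
  cone: the chain rule along the curve, and the Euler relation with right-hand side 0. They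
  eliminate two of the three partials; the third cancels from the determinant.\<close>

lemma cone_f4:
  assumes q: "odd CARD('a::{field,finite})"
  shows "cone (f4 :: 'a poly3) = - (upoly\<^sup>2 * pderiv (cone f3))"
proof -
  define A B C where "A = cone (partial 1 f3 :: 'a poly3)" and "B = cone (partial 2 f3 :: 'a poly3)"
    and "C = cone (partial 3 f3 :: 'a poly3)"
  define z where "z = monom (1::'a) 1"
  have z2: "monom 1 2 = z\<^sup>2" by (simp add: z_def monom_power)
  have zq: "monom 1 CARD('a) = z ^ CARD('a)" by (simp add: z_def monom_power)
  have D: "pderiv (cone f3) = 2 * z * A + B"
  proof -
    have "pderiv (cone f3) = (\<Sum>j\<in>UNIV. cone (partial j f3) * pderiv (cpt j :: 'a poly))"
      unfolding cone_def by (rule chain_rule[OF rhom_const]) (auto simp: pderiv_add pderiv_mult pderiv_pCons)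
    also have "\<dots> = 2 * z * A + B"
      by (simp add: sum_3 A_def B_def z_def pderiv_monom)
        (simp add: monom_altdef numeral_poly)
    finally show ?thesis .
  qed
  have E: "z\<^sup>2 * A + z * B + C = 0"
  proof -
    have "cone (\<Sum>j\<in>UNIV. X j * partial j f3) = cone (of_nat (card (L :: ('a \<times> 'a) set)) * f3 :: 'a poly3)"
      by (rule arg_cong[OF euler[OF homog_f3]])
    also have "\<dots> = of_nat (card (L :: ('a \<times> 'a) set)) * cone f3"
      by (simp add: cone_simps rhom_of_nat[OF rhom_cone])
    also have "of_nat (card (L :: ('a \<times> 'a) set)) = (0 :: 'a poly)"
      by (simp add: of_nat_poly of_nat_card_L[OF q])
    finally show ?thesis
      by (simp add: cone_simps sum_3 A_def B_def C_def z2 z_def[symmetric] del: One_nat_def)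
  qed
  have B: "B = pderiv (cone f3) - 2 * z * A" using D by simp
  have C: "C = - z\<^sup>2 * A - z * B" using E by (simp add: eq_neg_iff_add_eq_0 algebra_simps)
  have "cone (f4 :: 'a poly3) = (- 2 * z ^ CARD('a) * C - (z\<^sup>2) ^ CARD('a) * B)
     - (- 2 * z) * (C - (z\<^sup>2) ^ CARD('a) * A) + z\<^sup>2 * (B - (- 2 * z ^ CARD('a)) * A)"
    by (simp add: f4_alt partial_f1 partial_f2 cone_simps A_def B_def C_def z2 z_def[symmetric] del: One_nat_def)
  also have "\<dots> = - ((z ^ CARD('a) - z)\<^sup>2 * pderiv (cone f3))"
    unfolding C B by (simp add: power2_eq_square power_mult_distrib algebra_simps)
  finally show ?thesis by (simp add: upoly_def zq z_def)
qed

lemma f4_degree: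
  assumes q: "odd CARD('a::{field,finite})"
  shows "2 * (CARD('a) + card (L :: ('a \<times> 'a) set)) = CARD('a) * (CARD('a) + 1)"
proof -
  obtain k where "CARD('a) = Suc k" using card_field_gt_1[where 'a = 'a] by (cases "CARD('a)") auto
  then show ?thesis using card_L[OF q] by (simp add: algebra_simps)
qed

text \<open>The restriction is a nonzero form of degree q (q + 1) and divisible by the q-th power of
  a form of degree q + 1, so the cofactor is constant.\<close>

lemma cone_f4_power:
  assumes q: "odd CARD('a::{field,finite})"
  obtains \<kappa> where "\<kappa> \<noteq> 0" "cone (f4 :: 'a poly3) = smult \<kappa> (upoly ^ CARD('a))"
proof -
  let ?N = "CARD('a) * (CARD('a) + 1)"
  have nz: "cone (f4 :: 'a poly3) \<noteq> 0"
    using pderiv_cone_f3[OF q] upoly_neq_0[where 'a = 'a] by (simp add: cone_f4[OF q])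
  have "inv_form (- 1) (2 * (CARD('a) + card (L :: ('a \<times> 'a) set))) (cone (f4 :: 'a poly3))"
    by (rule inv_form_cone[OF f4_inv[OF q] homog_f4[OF q]]) (simp add: f4_refl[OF q] Cst_simps)
  then have "inv_form (- 1) ?N (cone (f4 :: 'a poly3))" unfolding f4_degree[OF q] .
  from inv_form_divide_power[OF q this nz anti_order[OF q f4_inv[OF q] f4_refl[OF q] nz]]
  obtain p where p: "cone (f4 :: 'a poly3) = upoly ^ CARD('a) * p"
    "inv_form ((- 1) ^ CARD('a) * - 1) (?N - CARD('a) * (CARD('a) + 1)) p" by blast
  then have "degree p = 0" by (simp add: inv_form_def)
  then obtain \<kappa> where "p = [:\<kappa>:]" by (metis degree_eq_zeroE)
  then show ?thesis using p(1) nz by (intro that[of \<kappa>]) auto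
qed

lemma f4_neq_0:
  assumes q: "odd CARD('a::{field,finite})"
  shows "(f4 :: 'a poly3) \<noteq> 0"
  using cone_f4_power[OF q] upoly_neq_0[where 'a = 'a] by (metis cone_simps(1) power_not_zero smult_eq_0_iff)

text \<open>The restriction of f is divisible by that of \<open>f4\<close>, and since q is odd, q
  divisions turn the sign - 1 into 1. So the quotient lifts to the algebra. Subtracting
  \<open>f4\<close> times the lift leaves a multiple of \<open>f1\<close>, to which induction
  applies.\<close>

lemma anti_homog:
  fixes f :: "'a::{field,finite} poly3"
  assumes q: "odd CARD('a)"
    and "f \<in> inv_polys" "homog n f" "subst (linact refl_mat) f = - f"
  shows "\<exists>h\<in>Aset. f = f4 * h"
  using assms(2-4)
proof (induction n arbitrary: f rule: less_induct)
  case (less n)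
  let ?D = "CARD('a) + card (L :: ('a \<times> 'a) set)"
  have cone0: "\<exists>h\<in>Aset. f = f4 * h"
    if f: "f \<in> inv_polys" "homog n f" "subst (linact refl_mat) f = - f" "cone f = 0" for f :: "'a poly3"
  proof (cases "f = 0")
    case True
    then show ?thesis by (intro bexI[of _ 0]) (auto simp: Aset_0)
  next
    case False
    from cone_eq_0[OF f(2,4) False] obtain g where g: "homog (n - 2) g" "f = f1 * g" "2 \<le> n" .
    have "g \<in> inv_polys"
      using f(1) unfolding g(2) by (rule inv_polys_cancel[OF _ f1_inv f1_neq_0])
    moreover have "f1 * subst (linact refl_mat) g = f1 * (- g)"
      using f(3) unfolding g(2) by (simp add: subst_simps f1_refl)
    then have "subst (linact refl_mat) g = - g" using f1_neq_0[where 'a = 'a] by (simp only: mult_cancel_left) simp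
    ultimately have "\<exists>h\<in>Aset. g = f4 * h" using less.IH[of "n - 2" g] g by simp
    then obtain h where h: "h \<in> Aset" "g = f4 * h" by blast
    then have "f = f4 * (f1 * h)" by (simp add: g(2) algebra_simps)
    then show ?thesis using Aset_mult[OF Aset_f(1) h(1)] by blast
  qed
  show ?case
  proof (cases "cone f = 0")
    case False
    have "inv_form (- 1) (2 * n) (cone f)"
      by (rule inv_form_cone) (use less.prems in \<open>auto simp: Cst_simps\<close>)
    from inv_form_divide_power[OF q this False anti_order[OF q less.prems(1,3) False]]
    obtain p where p: "cone f = upoly ^ CARD('a) * p" "CARD('a) * (CARD('a) + 1) \<le> 2 * n"
      "inv_form ((- 1) ^ CARD('a) * - 1) (2 * n - CARD('a) * (CARD('a) + 1)) p" by blast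
    have D: "2 * n - CARD('a) * (CARD('a) + 1) = 2 * (n - ?D)" "?D \<le> n"
      using f4_degree[OF q] p(2) by auto
    have "inv_form 1 (2 * (n - ?D)) p" using p(3) q unfolding D by simp
    then obtain P where P: "P \<in> Aset" "homog (n - ?D) P" "cone P = p" using inv_form_lift[OF q] by blast
    obtain \<kappa> :: 'a where \<kappa>: "\<kappa> \<noteq> 0" "cone f4 = smult \<kappa> (upoly ^ CARD('a))" using cone_f4_power[OF q] .
    define h where "h = Cst (1 / \<kappa>) * P"
    have h: "h \<in> Aset" "homog (n - ?D) h" using P by (auto simp: h_def Aset_mult Aset_Cst homog_Cst_mult)
    have "homog (?D + (n - ?D)) (f4 * h)" by (rule homog_mult[OF homog_f4[OF q] h(2)])
    then have hn: "homog n (f4 * h)" using D(2) by simp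
    have "\<exists>k\<in>Aset. f - f4 * h = f4 * k"
    proof (rule cone0)
      show "f - f4 * h \<in> inv_polys"
        by (rule inv_polys_diff[OF less.prems(1) inv_polys_mult[OF f4_inv[OF q] Aset_inv[OF q h(1)]]])
      show "homog n (f - f4 * h)" using less.prems(2) hn by (rule homog_diff)
      show "subst (linact refl_mat) (f - f4 * h) = - (f - f4 * h)"
        using less.prems(3) h(1) by (simp add: subst_simps f4_refl[OF q] Aset_refl[OF q])
      show "cone (f - f4 * h) = 0"
        using \<kappa>(1) by (simp add: cone_simps h_def \<kappa>(2) P(3) p(1))
    qed
    then obtain k where "k \<in> Aset" "f - f4 * h = f4 * k" by blast
    then have "f = f4 * (h + k)" "h + k \<in> Aset" using h by (auto simp: algebra_simps Aset_add)
    then show ?thesis by blast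
  qed (use cone0 less.prems in blast)
qed

section \<open>The ring of invariants\<close>

text \<open>The product would be both fixed and negated by the reflection.\<close>

lemma Aset_f4_0:
  fixes r :: "'a::{field,finite} poly3"
  assumes q: "odd CARD('a)" and "r \<in> Aset" "f4 * r \<in> Aset"
  shows "r = 0"
proof -
  have "subst (linact refl_mat) (f4 * r) = f4 * r" by (rule Aset_refl[OF q assms(3)])
  then have "f4 * r = - (f4 * r)" by (simp add: subst_simps f4_refl[OF q] Aset_refl[OF q assms(2)])
  then have "f4 * r = 0" by (rule poly3_eq_uminus_self[OF q])
  then show ?thesis using f4_neq_0[OF q] by simp
qed

lemma f4_square:
  assumes q: "odd CARD('a::{field,finite})"
  shows "f4 * f4 \<in> (Aset :: 'a poly3 set)"
  by (simp add: Aset_iff[OF q] inv_polys_mult f4_inv[OF q] subst_simps f4_refl[OF q])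

text \<open>Each homogeneous component is split into its symmetric and antisymmetric halves under
  the reflection, both of which are again invariant because the reflection normalises the
  group.\<close>

lemma inv_polys_decomp:
  fixes f :: "'a::{field,finite} poly3"
  assumes q: "odd CARD('a)" and f: "f \<in> inv_polys"
  obtains p r where "p \<in> Aset" "r \<in> Aset" "f = p + f4 * r"
proof -
  let ?T = "\<lambda>f. \<exists>p\<in>Aset. \<exists>r\<in>Aset. f = p + f4 * r"
  have add: "?T (x + y)" if xy: "?T x" "?T y" for x y :: "'a poly3"
  proof -
    from xy obtain p r p' r' where "p \<in> Aset" "r \<in> Aset" "x = p + f4 * r" "p' \<in> Aset" "r' \<in> Aset" "y = p' + f4 * r'"
      by blast
    then show ?thesis
      by (intro bexI[of _ "p + p'"] bexI[of _ "r + r'"]) (auto simp: algebra_simps Aset_add)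
  qed
  have hom: "?T (hcomp n f)" for n
  proof -
    let ?f = "hcomp n f" and ?s = "subst (linact refl_mat) :: 'a poly3 \<Rightarrow> _"
    have fi: "?f \<in> inv_polys" "homog n ?f" using f by (auto simp: inv_polys_hcomp homog_hcomp)
    have si: "?s ?f \<in> inv_polys" "homog n (?s ?f)"
      using fi by (auto simp: inv_polys_refl homog_subst[OF homog_linact])
    have h: "Cst (1 / 2 :: 'a) * 2 = 1"
      using two_neq_0[OF q] Cst_simps(4)[of "1 / 2" "2::'a"] by (simp add: Cst_simps)
    define p where "p = Cst (1 / 2) * (?f + ?s ?f)"
    define m where "m = Cst (1 / 2) * (?f - ?s ?f)"
    have "p \<in> Aset"
      by (rule Aset_homog[OF q, of _ n])
        (use fi si in \<open>auto simp: p_def inv_polys_mult inv_polys_Cst inv_polys_add homog_Cst_mult homog_add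
          subst_simps subst_refl_refl add.commute\<close>)
    moreover have "\<exists>r\<in>Aset. m = f4 * r"
      by (rule anti_homog[OF q, of _ n])
        (use fi si in \<open>simp_all add: m_def inv_polys_mult inv_polys_Cst inv_polys_diff homog_Cst_mult homog_diff
          subst_simps subst_refl_refl right_diff_distrib\<close>)
    moreover have "?f = p + m"
    proof -
      have "p + m = (Cst (1 / 2) * 2) * ?f" by (simp add: p_def m_def algebra_simps)
      then show ?thesis by (simp add: h)
    qed
    ultimately show ?thesis by blast
  qed
  obtain A where A: "finite A" "f = (\<Sum>n\<in>A. hcomp n f)" using sum_hcomp .
  have "?T (\<Sum>n\<in>A. hcomp n f)"
    using A(1)
  proof (induction A)
    case empty
    show ?case by (intro bexI[of _ 0]) (auto simp: Aset_0)
  qed (use add hom in auto)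
  then show ?thesis using that A(2) by auto
qed

section \<open>Components of differential forms\<close>

lemma UNIV_sets_3: "(UNIV :: 3 set set) = {{}, {1}, {2}, {3}, {1, 2}, {1, 3}, {2, 3}, {1, 2, 3}}"
proof -
  have "(UNIV :: 3 set set) = Pow {1, 2, 3}" by (simp flip: UNIV_3)
  also have "\<dots> = {{}, {1}, {2}, {3}, {1, 2}, {1, 3}, {2, 3}, {1, 2, 3}}"
    by (simp add: Pow_insert insert_commute)
  finally show ?thesis .
qed

lemma sets_3_distinct:
  "{1::3} \<noteq> {2}" "{1::3} \<noteq> {3}" "{2::3} \<noteq> {3}"
  "{1, 2::3} \<noteq> {1, 3}" "{1, 2::3} \<noteq> {2, 3}" "{1, 3::3} \<noteq> {2, 3}"
  by (auto simp: doubleton_eq_iff)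

lemma forall_sets_3: "(\<forall>I :: 3 set. P I) \<longleftrightarrow>
   P {} \<and> P {1} \<and> P {2} \<and> P {3} \<and> P {1, 2} \<and> P {1, 3} \<and> P {2, 3} \<and> P {1, 2, 3}"
proof -
  have "(\<forall>I :: 3 set. P I) \<longleftrightarrow> (\<forall>I \<in> UNIV. P I)" by simp
  also have "\<dots> \<longleftrightarrow> P {} \<and> P {1} \<and> P {2} \<and> P {3} \<and> P {1, 2} \<and> P {1, 3} \<and> P {2, 3} \<and> P {1, 2, 3}"
    unfolding UNIV_sets_3 by (simp only: ball_simps simp_thms)
  finally show ?thesis .
qed

lemma singleton_eq_3:
  "({i} = {j :: 3}) = (i = j)" "({i, j} = {k :: 3}) = (i = k \<and> j = k)" "({k :: 3} = {i, j}) = (i = k \<and> j = k)"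
  "({1, 2, 3 :: 3} = {i, j}) = False" "({i, j :: 3} = {1, 2, 3}) = False"
proof -
  show "({1, 2, 3 :: 3} = {i, j}) = False"
  proof
    assume "{1, 2, 3 :: 3} = {i, j}"
    then have "card {1, 2, 3 :: 3} \<le> 2" by (metis card_2_iff card_insert_if finite.emptyI finite.insertI card.empty insert_absorb2 One_nat_def Suc_1 le_SucI order_refl)
    then show False by simp
  qed simp
  then show "({i, j :: 3} = {1, 2, 3}) = False" by metis
qed auto

lemma sum_sets_3: "sum g (UNIV :: 3 set set) =
   g {} + g {1} + g {2} + g {3} + g {1, 2} + g {1, 3} + g {2, 3} + (g {1, 2, 3} :: 'b::comm_monoid_add)"
  unfolding UNIV_sets_3
  by (simp add: singleton_eq_3 sets_3_distinct sets_3_distinct[symmetric] add.assoc)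

lemma wedge_component:
  fixes \<omega> \<eta> :: "'a::comm_ring_1 form"
  shows "(\<omega> \<and>\<^sub>\<Omega> \<eta>) $ {} = \<omega> $ {} * \<eta> $ {}" (is ?thesis1)
    "(\<omega> \<and>\<^sub>\<Omega> \<eta>) $ {i} = \<omega> $ {} * \<eta> $ {i} + \<omega> $ {i} * \<eta> $ {}" (is ?thesis2)
    "(\<omega> \<and>\<^sub>\<Omega> \<eta>) $ {1, 2} = \<omega> $ {} * \<eta> $ {1, 2} + \<omega> $ {1} * \<eta> $ {2} - \<omega> $ {2} * \<eta> $ {1} + \<omega> $ {1, 2} * \<eta> $ {}" (is ?thesis3)
    "(\<omega> \<and>\<^sub>\<Omega> \<eta>) $ {1, 3} = \<omega> $ {} * \<eta> $ {1, 3} + \<omega> $ {1} * \<eta> $ {3} - \<omega> $ {3} * \<eta> $ {1} + \<omega> $ {1, 3} * \<eta> $ {}" (is ?thesis4)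
    "(\<omega> \<and>\<^sub>\<Omega> \<eta>) $ {2, 3} = \<omega> $ {} * \<eta> $ {2, 3} + \<omega> $ {2} * \<eta> $ {3} - \<omega> $ {3} * \<eta> $ {2} + \<omega> $ {2, 3} * \<eta> $ {}" (is ?thesis5)
    "(\<omega> \<and>\<^sub>\<Omega> \<eta>) $ {1, 2, 3} = \<omega> $ {} * \<eta> $ {1, 2, 3} + \<omega> $ {1} * \<eta> $ {2, 3} - \<omega> $ {2} * \<eta> $ {1, 3} + \<omega> $ {3} * \<eta> $ {1, 2}
       + \<omega> $ {1, 2} * \<eta> $ {3} - \<omega> $ {1, 3} * \<eta> $ {2} + \<omega> $ {2, 3} * \<eta> $ {1} + \<omega> $ {1, 2, 3} * \<eta> $ {}" (is ?thesis6)
proof -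
  have P: "Pow {a} = {{}, {a}}" "Pow {a, b} = {{}, {a}, {b}, {a, b}}" for a b :: 3 by auto
  have R: "{2,3} - {2::3} = {3}" "{2,3} - {3::3} = {2}" "{1,3} - {1::3} = {3}" "{1,3} - {3::3} = {1}"
    "{1,2} - {1::3} = {2}" "{1,2} - {2::3} = {1}"
    "{1,2,3} - {1::3} = {2,3}" "{1,2,3} - {2::3} = {1,3}" "{1,2,3} - {3::3} = {1,2}"
    "{1,2,3} - {1,2::3} = {3}" "{1,2,3} - {1,3::3} = {2}" "{1,2,3} - {2,3::3} = {1}" by auto
  have P3: "Pow {1, 2, 3 :: 3} = UNIV" unfolding UNIV_3[symmetric] by simp
  show ?thesis1 ?thesis2 ?thesis3 ?thesis4 ?thesis5
    by (simp_all add: wedge_def P R wedge_sign_def singleton_eq_3)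
  show ?thesis6
    unfolding wedge_def vec_lambda_beta P3 sum_sets_3
    by (simp add: R wedge_sign_def)
qed

lemma axis_sets_3:
  "axis {} x $ {} = x" "axis {} x $ insert i J = 0"
  "axis {i} x $ {} = 0" "axis {i} x $ {j} = (if i = j then x else 0)"
  "axis {i} x $ {1, 2} = 0" "axis {i} x $ {1, 3} = 0" "axis {i} x $ {2, 3} = 0" "axis {i :: 3} x $ {1, 2, 3} = 0"
  by (auto simp: axis_def)

definition vec1 :: "'a::comm_ring_1 form \<Rightarrow> 'a poly3^3" where
  "vec1 \<omega> = vector [\<omega> $ {1}, \<omega> $ {2}, \<omega> $ {3}]"

text \<open>The components of the $1$-form corresponding under $\phi$ to the $2$-form part.\<close>

definition vec2 :: "'a::comm_ring_1 form \<Rightarrow> 'a poly3^3" where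
  "vec2 \<omega> = vector [\<omega> $ {1, 2}, 2 * \<omega> $ {1, 3}, \<omega> $ {2, 3}]"

definition grad :: "'a::comm_ring_1 poly3 \<Rightarrow> 'a poly3^3" where
  "grad f = (\<chi> i. partial i f)"

text \<open>The coefficients of the image under \<open>phi\<close> of the product of two 1-forms
  with coefficient vectors a and b: a cross product adapted to the invariant form
  \<open>bil\<close>.\<close>

definition phi_wedge :: "'r::comm_ring_1^3 \<Rightarrow> 'r^3 \<Rightarrow> 'r^3" where
  "phi_wedge a b = vector [a $ 1 * b $ 2 - a $ 2 * b $ 1, 2 * (a $ 1 * b $ 3 - a $ 3 * b $ 1), a $ 2 * b $ 3 - a $ 3 * b $ 2]"

text \<open>The invariant symmetric bilinear form on $V^*$: the discriminant of binary quadratic forms.\<close>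

definition bil :: "'r::comm_ring_1^3 \<Rightarrow> 'r^3 \<Rightarrow> 'r" where
  "bil a b = a $ 2 * b $ 2 - 2 * a $ 1 * b $ 3 - 2 * a $ 3 * b $ 1"

text \<open>\<open>vec2\<close> records twice the component at {1, 3}, which determines this
  component because 2 is not a zero divisor.\<close>

lemma form_eqI:
  assumes q: "odd CARD('a::{field,finite})"
    and "\<omega> $ {} = \<eta> $ {}" "vec1 \<omega> = vec1 \<eta>" "vec2 \<omega> = vec2 \<eta>" "\<omega> $ {1, 2, 3} = (\<eta> :: 'a form) $ {1, 2, 3}"
  shows "\<omega> = \<eta>"
proof -
  have "2 * \<omega> $ {1, 3} = 2 * \<eta> $ {1, 3}" using assms(4) by (simp add: vec2_def vec_eq_iff forall_3)
  then have "\<omega> $ {1, 3} = \<eta> $ {1, 3}" using poly3_two_neq_0[OF q] by simp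
  then show ?thesis
    using assms unfolding vec_eq_iff[of \<omega>] forall_sets_3
    by (simp add: vec1_def vec2_def vec_eq_iff forall_3)
qed

lemma scalar_component:
  "scalar f $ {} = f" "scalar f $ {i} = 0" "scalar f $ {1, 2} = 0" "scalar f $ {1, 3} = 0"
  "scalar f $ {2, 3} = 0" "scalar f $ {1, 2, 3} = 0"
  by (simp_all add: scalar_def axis_sets_3)

lemma dx_component:
  "dx i $ {} = 0" "dx i $ {j} = (if i = j then 1 else 0)" "dx i $ {1, 2} = 0" "dx i $ {1, 3} = 0"
  "dx i $ {2, 3} = 0" "dx i $ {1, 2, 3} = 0"
  by (simp_all add: dx_def axis_sets_3)

lemma d_component:
  "d f $ {} = 0" "d f $ {i} = partial i f" "d f $ {1, 2} = 0" "d f $ {1, 3} = 0"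
  "d f $ {2, 3} = 0" "d f $ {1, 2, 3} = 0"
proof -
  show "d f $ {i} = partial i f"
    using exhaust_3[of i] by (auto simp: d_def dx_component sum_3)
qed (simp_all add: d_def dx_component)

lemma vec12_simps:
  "vec1 (\<omega> + \<eta>) = vec1 \<omega> + vec1 \<eta>" "vec1 (c *s \<omega>) = c *s vec1 \<omega>" "vec1 0 = 0"
  "vec2 (\<omega> + \<eta>) = vec2 \<omega> + vec2 \<eta>" "vec2 (c *s \<omega>) = c *s vec2 \<omega>" "vec2 0 = 0"
  by (simp_all add: vec1_def vec2_def vec_eq_iff forall_3 algebra_simps)

lemma v_scalar: "vec1 (scalar f) = 0" "vec2 (scalar f) = 0"
  by (simp_all add: vec1_def vec2_def vec_eq_iff forall_3 scalar_component)

lemma v_d: "vec1 (d f) = grad f" "vec2 (d f) = 0"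
  by (simp_all add: vec1_def vec2_def grad_def vec_eq_iff forall_3 d_component)

lemma dd_component:
  "(d f \<and>\<^sub>\<Omega> d g) $ {} = 0" "vec1 (d f \<and>\<^sub>\<Omega> d g) = 0" "vec2 (d f \<and>\<^sub>\<Omega> d g) = phi_wedge (grad f) (grad g)"
  "(d f \<and>\<^sub>\<Omega> d g) $ {1, 2, 3} = 0"
  by (simp_all add: vec1_def vec2_def vec_eq_iff forall_3 wedge_component d_component phi_wedge_def grad_def)

lemma phi_component:
  "phi \<omega> $ {} = 0" "vec1 (phi \<omega>) = vec2 \<omega>" "vec2 (phi \<omega>) = 0" "phi \<omega> $ {1, 2, 3} = 0"
  by (simp_all add: vec1_def vec2_def phi_def vec_eq_iff forall_3 dx_component Cst_simps)

lemma volume_component: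
  "(dx 1 \<and>\<^sub>\<Omega> dx 2 \<and>\<^sub>\<Omega> dx 3) $ {} = 0" "vec1 (dx 1 \<and>\<^sub>\<Omega> dx 2 \<and>\<^sub>\<Omega> dx 3) = 0"
  "vec2 (dx 1 \<and>\<^sub>\<Omega> dx 2 \<and>\<^sub>\<Omega> dx 3) = 0" "(dx 1 \<and>\<^sub>\<Omega> dx 2 \<and>\<^sub>\<Omega> dx 3) $ {1, 2, 3} = 1"
  by (simp_all add: vec1_def vec2_def vec_eq_iff forall_3 wedge_component dx_component)

lemma forms_of_degree_iff:
  "\<omega> \<in> forms_of_degree 1 \<longleftrightarrow> \<omega> $ {} = 0 \<and> \<omega> $ {1, 2} = 0 \<and> \<omega> $ {1, 3} = 0 \<and> \<omega> $ {2, 3} = 0 \<and> \<omega> $ {1, 2, 3} = 0"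
  "\<omega> \<in> forms_of_degree 2 \<longleftrightarrow> \<omega> $ {} = 0 \<and> \<omega> $ {1} = 0 \<and> \<omega> $ {2} = 0 \<and> \<omega> $ {3} = 0 \<and> \<omega> $ {1, 2, 3} = 0"
  unfolding forms_of_degree_def mem_Collect_eq forall_sets_3 by simp_all

lemma phi_inv_component:
  fixes f :: "'a::{field,finite} poly3"
  assumes q: "odd CARD('a)"
  shows "phi_inv (d f) $ {} = 0" "vec1 (phi_inv (d f)) = 0" "vec2 (phi_inv (d f)) = grad f"
    "phi_inv (d f) $ {1, 2, 3} = 0"
proof -
  have h: "2 * Cst (1 / 2 :: 'a) = 1"
    using two_neq_0[OF q] Cst_simps(4)[of "2::'a" "1 / 2"] by (simp add: Cst_simps)
  \<comment> \<open>An explicit preimage of \<open>d f\<close>, with 1/2 undoing the factor 2 of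
    \<open>phi\<close>; \<open>inv_into\<close> is controlled only on the image.\<close>
  define \<eta> :: "'a form" where
    "\<eta> = axis {1, 2} (partial 1 f) + axis {1, 3} (Cst (1 / 2) * partial 2 f) + axis {2, 3} (partial 3 f)"
  have comp: "\<eta> $ {} = 0" "\<eta> $ {i} = 0" "\<eta> $ {1, 2} = partial 1 f" "\<eta> $ {1, 3} = Cst (1 / 2) * partial 2 f"
    "\<eta> $ {2, 3} = partial 3 f" "\<eta> $ {1, 2, 3} = 0" for i
    using exhaust_3[of i] by (auto simp: \<eta>_def axis_def singleton_eq_3 sets_3_distinct sets_3_distinct[symmetric])
  have "\<eta> \<in> forms_of_degree 2" by (simp add: forms_of_degree_iff comp)
  moreover have "phi \<eta> = d f"
  proof (rule form_eqI[OF q])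
    have "2 * (Cst (1 / 2) * partial 2 f) = partial 2 f" using h by (simp flip: mult.assoc)
    then show "vec1 (phi \<eta>) = vec1 (d f)"
      by (simp add: phi_component vec2_def comp v_d grad_def vec_eq_iff forall_3)
  qed (simp_all add: phi_component d_component v_d)
  ultimately have im: "d f \<in> phi ` forms_of_degree 2" by (metis imageI)
  have "phi_inv (d f) \<in> forms_of_degree 2" unfolding phi_inv_def by (rule inv_into_into[OF im])
  then show "phi_inv (d f) $ {} = 0" "vec1 (phi_inv (d f)) = 0" "phi_inv (d f) $ {1, 2, 3} = 0"
    by (simp_all add: forms_of_degree_iff vec1_def vec_eq_iff forall_3)
  have "phi (phi_inv (d f)) = d f" unfolding phi_inv_def by (rule f_inv_into_f[OF im])
  then show "vec2 (phi_inv (d f)) = grad f" by (metis phi_component(2) v_d(1))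
qed

section \<open>Invariant vectors\<close>

text \<open>The action on coefficient vectors of 1-forms: coefficients are substituted, and the j-th
  basis form goes to row j of M.\<close>

definition vact :: "'a::comm_ring_1^3^3 \<Rightarrow> 'a poly3^3 \<Rightarrow> 'a poly3^3" where
  "vact M v = (\<chi> i. \<Sum>j\<in>UNIV. subst (linact M) (v $ j) * Cst (M $ j $ i))"

definition inv_vecs :: "('a::field poly3^3) set" where
  "inv_vecs = {v. \<forall>a b c d. a * d - b * c = 1 \<longrightarrow> vact (slm a b c d) v = v}"

lemma vact_add: "vact M (v + w) = vact M v + vact M w"
  and vact_smult: "vact M (c *s v) = subst (linact M) c *s vact M v"
  by (simp_all add: vact_def vec_eq_iff subst_simps ring_distribs sum.distrib sum_distrib_left mult.assoc)

lemma inv_vecs_0: "0 \<in> inv_vecs"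
  by (simp add: inv_vecs_def vact_def vec_eq_iff subst_simps)

lemma inv_vecs_add: "v \<in> inv_vecs \<Longrightarrow> w \<in> inv_vecs \<Longrightarrow> v + w \<in> inv_vecs"
  by (auto simp: inv_vecs_def vact_add)

lemma inv_vecs_smult: "c \<in> inv_polys \<Longrightarrow> v \<in> inv_vecs \<Longrightarrow> c *s v \<in> inv_vecs"
  by (auto simp: inv_vecs_def inv_polys_iff vact_smult)

lemma grad_vact: "grad (subst (linact M) f) = vact M (grad f)"
  by (simp add: grad_def vact_def vec_eq_iff partial_linact)

lemma grad_inv: "f \<in> inv_polys \<Longrightarrow> grad f \<in> inv_vecs"
  by (auto simp: inv_vecs_def inv_polys_iff simp flip: grad_vact)

text \<open>The rows of the matrix of $g$ are the images of $x_1, x_2, x_3$, so the following identities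
  express the equivariance of $\phi$ and the invariance of the bilinear form on basis vectors.\<close>

lemma slm_minors:
  fixes a b c e :: "'a::field"
  assumes "a * e - b * c = 1"
  shows "phi_wedge (slm a b c e $ 1) (slm a b c e $ 2) = slm a b c e $ 1"
    "phi_wedge (slm a b c e $ 1) (slm a b c e $ 3) = 2 *s slm a b c e $ 2"
    "phi_wedge (slm a b c e $ 2) (slm a b c e $ 3) = slm a b c e $ 3"
proof -
  have "phi_wedge (slm a b c e $ 1) (slm a b c e $ 2) = (a * e - b * c) *s slm a b c e $ 1"
    "phi_wedge (slm a b c e $ 1) (slm a b c e $ 3) = (a * e - b * c) *s (2 *s slm a b c e $ 2)"
    "phi_wedge (slm a b c e $ 2) (slm a b c e $ 3) = (a * e - b * c) *s slm a b c e $ 3"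
    by (simp_all add: phi_wedge_def slm_def vec_eq_iff forall_3 power2_eq_square algebra_simps)
  then show "phi_wedge (slm a b c e $ 1) (slm a b c e $ 2) = slm a b c e $ 1"
    "phi_wedge (slm a b c e $ 1) (slm a b c e $ 3) = 2 *s slm a b c e $ 2"
    "phi_wedge (slm a b c e $ 2) (slm a b c e $ 3) = slm a b c e $ 3"
    by (simp_all add: assms)
qed

lemma slm_bil:
  fixes a b c e :: "'a::field"
  assumes "a * e - b * c = 1"
  shows "bil (slm a b c e $ 1) (slm a b c e $ 1) = 0" "bil (slm a b c e $ 1) (slm a b c e $ 2) = 0"
    "bil (slm a b c e $ 1) (slm a b c e $ 3) = - 2" "bil (slm a b c e $ 2) (slm a b c e $ 2) = 1"
    "bil (slm a b c e $ 2) (slm a b c e $ 3) = 0" "bil (slm a b c e $ 3) (slm a b c e $ 3) = 0"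
proof -
  have "bil (slm a b c e $ 1) (slm a b c e $ 3) = - 2 * (a * e - b * c)\<^sup>2"
    "bil (slm a b c e $ 2) (slm a b c e $ 2) = (a * e - b * c)\<^sup>2"
    by (simp_all add: bil_def slm_def power2_eq_square algebra_simps)
  then show "bil (slm a b c e $ 1) (slm a b c e $ 3) = - 2" "bil (slm a b c e $ 2) (slm a b c e $ 2) = 1"
    by (simp_all add: assms)
  show "bil (slm a b c e $ 1) (slm a b c e $ 1) = 0" "bil (slm a b c e $ 1) (slm a b c e $ 2) = 0"
    "bil (slm a b c e $ 2) (slm a b c e $ 3) = 0" "bil (slm a b c e $ 3) (slm a b c e $ 3) = 0"
    by (simp_all add: bil_def slm_def power2_eq_square algebra_simps)
qed

lemma bil_sym: "bil v w = bil w v"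
  by (simp add: bil_def algebra_simps)

lemma bil_vact:
  assumes "a * e - b * c = 1"
  shows "bil (vact (slm a b c e) v) (vact (slm a b c e) w) = subst (linact (slm a b c e)) (bil v w)"
proof -
  define M where "M = slm a b c e"
  define s where "s = subst (linact M)"
  have B: "Cst (bil (M $ j) (M $ k)) = Cst (M $ j $ 2) * Cst (M $ k $ 2) - 2 * Cst (M $ j $ 1) * Cst (M $ k $ 3)
     - 2 * Cst (M $ j $ 3) * Cst (M $ k $ 1)" for j k
    by (simp add: bil_def Cst_simps)
  have "bil (vact M v) (vact M w) =
     (s (v $ 1) * s (w $ 1)) * Cst (bil (M $ 1) (M $ 1)) + (s (v $ 1) * s (w $ 2)) * Cst (bil (M $ 1) (M $ 2))
   + (s (v $ 1) * s (w $ 3)) * Cst (bil (M $ 1) (M $ 3)) + (s (v $ 2) * s (w $ 1)) * Cst (bil (M $ 2) (M $ 1))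
   + (s (v $ 2) * s (w $ 2)) * Cst (bil (M $ 2) (M $ 2)) + (s (v $ 2) * s (w $ 3)) * Cst (bil (M $ 2) (M $ 3))
   + (s (v $ 3) * s (w $ 1)) * Cst (bil (M $ 3) (M $ 1)) + (s (v $ 3) * s (w $ 2)) * Cst (bil (M $ 3) (M $ 2))
   + (s (v $ 3) * s (w $ 3)) * Cst (bil (M $ 3) (M $ 3))"
    unfolding B by (simp add: bil_def vact_def sum_3 s_def[symmetric] algebra_simps)
  also have "\<dots> = s (bil v w)"
    unfolding M_def bil_sym[of "slm a b c e $ 2" "slm a b c e $ 1"] bil_sym[of "slm a b c e $ 3" "slm a b c e $ 1"]
      bil_sym[of "slm a b c e $ 3" "slm a b c e $ 2"] slm_bil[OF assms]
    by (simp add: bil_def s_def subst_simps Cst_simps algebra_simps)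
  finally show ?thesis by (simp add: M_def s_def)
qed

lemma phi_wedge_vact:
  assumes "a * e - b * c = 1"
  shows "phi_wedge (vact (slm a b c e) v) (vact (slm a b c e) w) = vact (slm a b c e) (phi_wedge v w)"
proof -
  define M where "M = slm a b c e"
  define s where "s = subst (linact M)"
  let ?C = "\<lambda>v::'a^3. (\<chi> i. Cst (v $ i))"
  have C: "?C (phi_wedge x y) = phi_wedge (?C x) (?C y)" for x y
    by (simp add: phi_wedge_def vec_eq_iff forall_3 Cst_simps)
  have "phi_wedge (vact M v) (vact M w) =
     (s (v $ 1) * s (w $ 2) - s (v $ 2) * s (w $ 1)) *s ?C (phi_wedge (M $ 1) (M $ 2))
   + (s (v $ 1) * s (w $ 3) - s (v $ 3) * s (w $ 1)) *s ?C (phi_wedge (M $ 1) (M $ 3))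
   + (s (v $ 2) * s (w $ 3) - s (v $ 3) * s (w $ 2)) *s ?C (phi_wedge (M $ 2) (M $ 3))"
    unfolding C vec_eq_iff forall_3
    by (simp add: phi_wedge_def vact_def sum_3 s_def[symmetric]) (simp add: algebra_simps)
  also have "\<dots> = vact M (phi_wedge v w)"
    unfolding M_def slm_minors[OF assms] vec_eq_iff forall_3
    by (simp add: phi_wedge_def vact_def sum_3 s_def M_def subst_simps Cst_simps algebra_simps)
  finally show ?thesis by (simp add: M_def)
qed

lemma phi_wedge_inv: "v \<in> inv_vecs \<Longrightarrow> w \<in> inv_vecs \<Longrightarrow> phi_wedge v w \<in> inv_vecs"
  unfolding inv_vecs_def by (auto simp flip: phi_wedge_vact)

lemma bil_inv: "v \<in> inv_vecs \<Longrightarrow> w \<in> inv_vecs \<Longrightarrow> bil v w \<in> inv_polys"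
  unfolding inv_vecs_def inv_polys_iff by (auto simp flip: bil_vact)

lemma bil_linear:
  "bil (v + w) x = bil v x + bil w x" "bil (c *s v) x = c * bil v x"
  "bil x (v + w) = bil x v + bil x w" "bil x (c *s v) = c * bil x v" "bil 0 x = 0"
  by (simp_all add: bil_def algebra_simps)

subsection \<open>Invariant forms\<close>

lemma dual_to_form_component:
  fixes g :: "'a::field^2^2"
  assumes "det g = 1"
  shows "dual_to_form (dual_act g (dual_basis i)) $ {} = 0"
    "dual_to_form (dual_act g (dual_basis i)) $ {j} = Cst (slm (g $ 1 $ 1) (g $ 1 $ 2) (g $ 2 $ 1) (g $ 2 $ 2) $ i $ j)"
    "dual_to_form (dual_act g (dual_basis i)) $ {1, 2} = 0" "dual_to_form (dual_act g (dual_basis i)) $ {1, 3} = 0"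
    "dual_to_form (dual_act g (dual_basis i)) $ {2, 3} = 0" "dual_to_form (dual_act g (dual_basis i)) $ {1, 2, 3} = 0"
  using exhaust_3[of j]
  by (auto simp: dual_to_form_def dual_act_dual_basis[OF assms(1)] dx_component sum_3)

text \<open>Degrees 0 and 3 both carry the action on R, as the matrix has determinant 1. By
  \<open>slm_minors\<close> the 2-forms, read through \<open>phi\<close>, transform like
  1-forms.\<close>

lemma form_act_component:
  fixes g :: "'a::field^2^2"
  assumes g: "det g = 1"
  defines "M \<equiv> slm (g $ 1 $ 1) (g $ 1 $ 2) (g $ 2 $ 1) (g $ 2 $ 2)"
  shows "form_act g \<omega> $ {} = subst (linact M) (\<omega> $ {})" "vec1 (form_act g \<omega>) = vact M (vec1 \<omega>)"
    "vec2 (form_act g \<omega>) = vact M (vec2 \<omega>)" "form_act g \<omega> $ {1, 2, 3} = subst (linact M) (\<omega> $ {1, 2, 3})"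
proof -
  define \<alpha> where "\<alpha> = (\<lambda>i. dual_to_form (dual_act g (dual_basis i)))"
  define s where "s = subst (linact M)"
  have \<alpha>: "\<alpha> i $ {} = 0" "\<alpha> i $ {j} = Cst (M $ i $ j)" "\<alpha> i $ {1, 2} = 0" "\<alpha> i $ {1, 3} = 0"
    "\<alpha> i $ {2, 3} = 0" "\<alpha> i $ {1, 2, 3} = 0" for i j
    by (simp_all add: \<alpha>_def M_def dual_to_form_component[OF g])
  have s: "poly_act g = s" by (simp add: s_def poly_act_eq[OF g] M_def)
  have detg: "g $ 1 $ 1 * g $ 2 $ 2 - g $ 1 $ 2 * g $ 2 $ 1 = 1" using g by (simp add: det_2)
  have b: "basis_form_act g {} = scalar 1" "basis_form_act g {1} = \<alpha> 1 \<and>\<^sub>\<Omega> scalar 1"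
    "basis_form_act g {2} = \<alpha> 2 \<and>\<^sub>\<Omega> scalar 1" "basis_form_act g {3} = \<alpha> 3 \<and>\<^sub>\<Omega> scalar 1"
    "basis_form_act g {1, 2} = \<alpha> 1 \<and>\<^sub>\<Omega> (\<alpha> 2 \<and>\<^sub>\<Omega> scalar 1)" "basis_form_act g {1, 3} = \<alpha> 1 \<and>\<^sub>\<Omega> (\<alpha> 3 \<and>\<^sub>\<Omega> scalar 1)"
    "basis_form_act g {2, 3} = \<alpha> 2 \<and>\<^sub>\<Omega> (\<alpha> 3 \<and>\<^sub>\<Omega> scalar 1)"
    "basis_form_act g {1, 2, 3} = \<alpha> 1 \<and>\<^sub>\<Omega> (\<alpha> 2 \<and>\<^sub>\<Omega> (\<alpha> 3 \<and>\<^sub>\<Omega> scalar 1))"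
    by (simp_all add: basis_form_act_def \<alpha>_def)
  have f: "form_act g \<omega> $ K = s (\<omega> $ {}) * basis_form_act g {} $ K + s (\<omega> $ {1}) * basis_form_act g {1} $ K
     + s (\<omega> $ {2}) * basis_form_act g {2} $ K + s (\<omega> $ {3}) * basis_form_act g {3} $ K
     + s (\<omega> $ {1, 2}) * basis_form_act g {1, 2} $ K + s (\<omega> $ {1, 3}) * basis_form_act g {1, 3} $ K
     + s (\<omega> $ {2, 3}) * basis_form_act g {2, 3} $ K + s (\<omega> $ {1, 2, 3}) * basis_form_act g {1, 2, 3} $ K" for K
    by (simp only: form_act_def sum_sets_3 s vector_add_component vector_smult_component)
  note comp = f b wedge_component \<alpha> scalar_component
  show "form_act g \<omega> $ {} = subst (linact M) (\<omega> $ {})"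
    by (simp add: comp s_def)
  show "vec1 (form_act g \<omega>) = vact M (vec1 \<omega>)"
    unfolding vec_eq_iff forall_3
    by (simp add: vec1_def vact_def sum_3 comp s_def)
  have "form_act g \<omega> $ {1, 2, 3} = s (\<omega> $ {1, 2, 3}) * Cst (det M)"
    by (simp add: comp det_3 Cst_simps algebra_simps)
  then show "form_act g \<omega> $ {1, 2, 3} = subst (linact M) (\<omega> $ {1, 2, 3})"
    by (simp add: M_def det_slm detg Cst_simps s_def)
  let ?C = "\<lambda>v::'a^3. (\<chi> i. Cst (v $ i))"
  have C: "?C (phi_wedge x y) = phi_wedge (?C x) (?C y)" for x y
    by (simp add: phi_wedge_def vec_eq_iff forall_3 Cst_simps)
  have "vec2 (form_act g \<omega>) = s (\<omega> $ {1, 2}) *s ?C (phi_wedge (M $ 1) (M $ 2)) + s (\<omega> $ {1, 3}) *s ?C (phi_wedge (M $ 1) (M $ 3))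
     + s (\<omega> $ {2, 3}) *s ?C (phi_wedge (M $ 2) (M $ 3))"
    unfolding C vec_eq_iff forall_3
    by (simp add: vec2_def phi_wedge_def comp) (simp add: algebra_simps)
  also have "\<dots> = vact M (vec2 \<omega>)"
    unfolding M_def slm_minors[OF detg] vec_eq_iff forall_3
    by (simp add: vec2_def vact_def sum_3 s_def M_def subst_simps Cst_simps algebra_simps)
  finally show "vec2 (form_act g \<omega>) = vact M (vec2 \<omega>)" .
qed

lemma inv_forms_iff:
  fixes \<omega> :: "'a::{field,finite} form"
  assumes q: "odd CARD('a)"
  shows "\<omega> \<in> inv_forms \<longleftrightarrow>
    \<omega> $ {} \<in> inv_polys \<and> vec1 \<omega> \<in> inv_vecs \<and> vec2 \<omega> \<in> inv_vecs \<and> \<omega> $ {1, 2, 3} \<in> inv_polys"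
proof -
  let ?P = "\<lambda>M. subst (linact M) (\<omega> $ {}) = \<omega> $ {} \<and> vact M (vec1 \<omega>) = vec1 \<omega> \<and> vact M (vec2 \<omega>) = vec2 \<omega> \<and>
    subst (linact M) (\<omega> $ {1, 2, 3}) = \<omega> $ {1, 2, 3}"
  have "form_act g \<omega> = \<omega> \<longleftrightarrow> ?P (slm (g $ 1 $ 1) (g $ 1 $ 2) (g $ 2 $ 1) (g $ 2 $ 2))" if g: "det g = 1" for g
  proof -
    have "form_act g \<omega> = \<omega> \<longleftrightarrow> form_act g \<omega> $ {} = \<omega> $ {} \<and> vec1 (form_act g \<omega>) = vec1 \<omega> \<and> vec2 (form_act g \<omega>) = vec2 \<omega>
        \<and> form_act g \<omega> $ {1, 2, 3} = \<omega> $ {1, 2, 3}"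
      using form_eqI[OF q, of "form_act g \<omega>" \<omega>] by auto
    then show ?thesis unfolding form_act_component[OF g] .
  qed
  then have "\<omega> \<in> inv_forms \<longleftrightarrow> (\<forall>g::'a^2^2. det g = 1 \<longrightarrow> ?P (slm (g $ 1 $ 1) (g $ 1 $ 2) (g $ 2 $ 1) (g $ 2 $ 2)))"
    unfolding inv_forms_def mem_Collect_eq ball_PSL2 by blast
  also have "\<dots> \<longleftrightarrow> (\<forall>a b c d. a * d - b * c = 1 \<longrightarrow> ?P (slm a b c d))"
    by (rule ball_SL2_entries)
  finally show ?thesis
    unfolding inv_polys_iff inv_vecs_def mem_Collect_eq by blast
qed

section \<open>Invariant vectors over the algebra \<open>F[f\<^sub>1, f\<^sub>2, f\<^sub>3]\<close>\<close>

text \<open>\<open>D\<close> is the determinant with rows a, b, c. Under \<open>bil\<close>, the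
  three \<open>phi_wedge\<close> vectors are dual to a, b, c up to the factor - 2 D; the equations
  are the two expansions of v in these dual bases, cleared of denominators.\<close>

lemma cramer:
  fixes a b c v :: "'r::comm_ring_1^3"
  defines "D \<equiv> a $ 1 * (b $ 2 * c $ 3 - b $ 3 * c $ 2) - a $ 2 * (b $ 1 * c $ 3 - b $ 3 * c $ 1)
    + a $ 3 * (b $ 1 * c $ 2 - b $ 2 * c $ 1)"
  shows "bil (phi_wedge b c) v *s a + bil (phi_wedge c a) v *s b + bil (phi_wedge a b) v *s c = (- 2 * D) *s v"
    "bil v a *s phi_wedge b c + bil v b *s phi_wedge c a + bil v c *s phi_wedge a b = (- 2 * D) *s v"
  unfolding vec_eq_iff forall_3 D_def by (simp_all add: bil_def phi_wedge_def algebra_simps)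

lemma bil_phi_wedge:
  fixes a b c :: "'r::comm_ring_1^3"
  defines "D \<equiv> a $ 1 * (b $ 2 * c $ 3 - b $ 3 * c $ 2) - a $ 2 * (b $ 1 * c $ 3 - b $ 3 * c $ 1)
    + a $ 3 * (b $ 1 * c $ 2 - b $ 2 * c $ 1)"
  shows "bil (phi_wedge b c) a = - 2 * D" "bil (phi_wedge c a) b = - 2 * D" "bil (phi_wedge a b) c = - 2 * D"
    "bil (phi_wedge b c) b = 0" "bil (phi_wedge b c) c = 0"
  unfolding D_def by (simp_all add: bil_def phi_wedge_def algebra_simps)

lemma f4_grad: "f4 = grad f1 $ 1 * (grad f2 $ 2 * grad f3 $ 3 - grad f2 $ 3 * grad f3 $ 2)
    - grad f1 $ 2 * (grad f2 $ 1 * grad f3 $ 3 - grad f2 $ 3 * grad f3 $ 1)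
    + grad f1 $ 3 * (grad f2 $ 1 * grad f3 $ 2 - grad f2 $ 2 * grad f3 $ 1)"
  by (simp add: f4_alt grad_def)

lemmas cramer_f4 = cramer[where a = "grad f1" and b = "grad f2" and c = "grad f3", folded f4_grad]
lemmas bil_phi_wedge_f4 = bil_phi_wedge(1-3)[where a = "grad f1" and b = "grad f2" and c = "grad f3", folded f4_grad]
  bil_phi_wedge(4,5)

lemma refl_component:
  "refl_mat $ 1 $ 1 = 1" "refl_mat $ 1 $ 2 = 0" "refl_mat $ 1 $ 3 = 0" "refl_mat $ 2 $ 1 = 0" "refl_mat $ 2 $ 2 = - 1"
  "refl_mat $ 2 $ 3 = 0" "refl_mat $ 3 $ 1 = 0" "refl_mat $ 3 $ 2 = 0" "refl_mat $ 3 $ 3 = 1"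
  by (simp_all add: refl_mat_def)

text \<open>The reflection negates just the second component of such a gradient, and in
  \<open>bil\<close> the index 2 occurs only in the product of second components.\<close>

lemma bil_grad_Aset:
  fixes f g :: "'a::{field,finite} poly3"
  assumes q: "odd CARD('a)" and "f \<in> Aset" "g \<in> Aset"
  shows "bil (grad f) (grad g) \<in> Aset"
proof -
  have p: "subst (linact refl_mat) (partial 1 f) = partial 1 f" "subst (linact refl_mat) (partial 2 f) = - partial 2 f"
    "subst (linact refl_mat) (partial 3 f) = partial 3 f" if "f \<in> Aset" for f :: "'a poly3"
    using partial_linact[of 1 refl_mat f] partial_linact[of 2 refl_mat f] partial_linact[of 3 refl_mat f]
    by (simp_all add: Aset_refl[OF q that] sum_3 refl_component Cst_simps) (metis minus_minus)
  have "bil (grad f) (grad g) \<in> inv_polys"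
    using assms by (intro bil_inv grad_inv Aset_inv[OF q])
  moreover have "subst (linact refl_mat) (bil (grad f) (grad g)) = bil (grad f) (grad g)"
    using assms by (simp add: bil_def grad_def subst_simps p)
  ultimately show ?thesis by (simp add: Aset_iff[OF q])
qed

text \<open>Pairing with \<open>grad f1\<close> isolates \<open>p1\<close>: the terms with r lie in
  the algebra and the rest is - 2 p_1 f_4, so \<open>Aset_f4_0\<close> applies; likewise for
  \<open>p2\<close> and \<open>p3\<close>. Pairing what is left with the \<open>phi_wedge\<close>
  vectors isolates each r.\<close>

lemma inv_vecs_unique:
  fixes r1 r2 r3 p1 p2 p3 :: "'a::{field,finite} poly3"
  assumes q: "odd CARD('a)"
    and A: "r1 \<in> Aset" "r2 \<in> Aset" "r3 \<in> Aset" "p1 \<in> Aset" "p2 \<in> Aset" "p3 \<in> Aset"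
    and 0: "r1 *s grad f1 + r2 *s grad f2 + r3 *s grad f3
     + p1 *s phi_wedge (grad f2) (grad f3) + p2 *s phi_wedge (grad f3) (grad f1) + p3 *s phi_wedge (grad f1) (grad f2) = 0"
  shows "r1 = 0 \<and> r2 = 0 \<and> r3 = 0 \<and> p1 = 0 \<and> p2 = 0 \<and> p3 = 0"
proof -
  have two: "x = 0" if "x * (- 2 * f4) = 0" for x :: "'a poly3"
    using that f4_neq_0[OF q] poly3_two_neq_0[OF q] by simp
  have p0: "p = 0" if p: "p \<in> Aset" "f \<in> Aset"
    "r1 * bil (grad f1) (grad f) + r2 * bil (grad f2) (grad f) + r3 * bil (grad f3) (grad f) + p * (- 2 * f4) = 0"
    for p f :: "'a poly3"
  proof -
    have "f4 * (2 * p) = r1 * bil (grad f1) (grad f) + r2 * bil (grad f2) (grad f) + r3 * bil (grad f3) (grad f)"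
      using p(3) by (simp add: algebra_simps)
    also have "\<dots> \<in> Aset"
      by (intro Aset_add Aset_mult A bil_grad_Aset[OF q] p Aset_f)
    finally have "f4 * (2 * p) \<in> Aset" .
    moreover have "2 * p \<in> Aset" unfolding mult_2 by (rule Aset_add[OF p(1) p(1)])
    ultimately have "2 * p = 0" by (intro Aset_f4_0[OF q])
    then show "p = 0" using poly3_two_neq_0[OF q] by simp
  qed
  have "bil (r1 *s grad f1 + r2 *s grad f2 + r3 *s grad f3
     + p1 *s phi_wedge (grad f2) (grad f3) + p2 *s phi_wedge (grad f3) (grad f1) + p3 *s phi_wedge (grad f1) (grad f2)) x = 0" for x
    by (simp only: 0 bil_linear)
  note e = this[unfolded bil_linear]
  have "p1 = 0" by (rule p0[OF A(4) Aset_f(1)]) (use e[of "grad f1"] in \<open>simp add: bil_phi_wedge_f4\<close>)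
  moreover have "p2 = 0" by (rule p0[OF A(5) Aset_f(2)]) (use e[of "grad f2"] in \<open>simp add: bil_phi_wedge_f4\<close>)
  moreover have "p3 = 0" by (rule p0[OF A(6) Aset_f(3)]) (use e[of "grad f3"] in \<open>simp add: bil_phi_wedge_f4\<close>)
  ultimately have r: "r1 *s grad f1 + r2 *s grad f2 + r3 *s grad f3 = 0" using 0 by simp
  have "bil x (r1 *s grad f1 + r2 *s grad f2 + r3 *s grad f3) = 0" for x
    by (simp only: r bil_linear bil_sym[of x])
  note e' = this[unfolded bil_linear]
  have "r1 = 0" using e'[of "phi_wedge (grad f2) (grad f3)"] by - (rule two, simp only: bil_phi_wedge_f4 mult_zero_right add_0_left add_0_right)
  moreover have "r2 = 0" using e'[of "phi_wedge (grad f3) (grad f1)"] by - (rule two, simp only: bil_phi_wedge_f4 mult_zero_right add_0_left add_0_right)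
  moreover have "r3 = 0" using e'[of "phi_wedge (grad f1) (grad f2)"] by - (rule two, simp only: bil_phi_wedge_f4 mult_zero_right add_0_left add_0_right)
  ultimately show ?thesis using \<open>p1 = 0\<close> \<open>p2 = 0\<close> \<open>p3 = 0\<close> by simp
qed

lemma vec_smult_cancel:
  fixes c :: "'r::idom"
  shows "c \<noteq> 0 \<Longrightarrow> c *s x = c *s y \<Longrightarrow> x = y"
  by (simp add: vec_eq_iff)

lemma inv_vecs_exist:
  fixes v :: "'a::{field,finite} poly3^3"
  assumes q: "odd CARD('a)" and v: "v \<in> inv_vecs"
  shows "\<exists>r1\<in>Aset. \<exists>r2\<in>Aset. \<exists>r3\<in>Aset. \<exists>p1\<in>Aset. \<exists>p2\<in>Aset. \<exists>p3\<in>Aset.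
    v = r1 *s grad f1 + r2 *s grad f2 + r3 *s grad f3
     + p1 *s phi_wedge (grad f2) (grad f3) + p2 *s phi_wedge (grad f3) (grad f1) + p3 *s phi_wedge (grad f1) (grad f2)"
proof -
  define a1 a2 a3 where "a1 = grad (f1 :: 'a poly3)" and "a2 = grad (f2 :: 'a poly3)" and "a3 = grad (f3 :: 'a poly3)"
  note cramer' = cramer_f4[where 'a = 'a, folded a1_def a2_def a3_def]
  have aI: "a1 \<in> inv_vecs" "a2 \<in> inv_vecs" "a3 \<in> inv_vecs"
    unfolding a1_def a2_def a3_def by (intro grad_inv f1_inv f2_inv[OF q] f3_inv)+
  have bA: "bil x y \<in> Aset" if "x \<in> {a1, a2, a3}" "y \<in> {a1, a2, a3}" for x y
    using that by (auto simp: a1_def a2_def a3_def bil_grad_Aset[OF q] Aset_f)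
  obtain s1 r1 where 1: "s1 \<in> Aset" "r1 \<in> Aset" "bil (phi_wedge a2 a3) v = s1 + f4 * r1"
    by (rule inv_polys_decomp[OF q bil_inv[OF phi_wedge_inv[OF aI(2,3)] v]])
  obtain s2 r2 where 2: "s2 \<in> Aset" "r2 \<in> Aset" "bil (phi_wedge a3 a1) v = s2 + f4 * r2"
    by (rule inv_polys_decomp[OF q bil_inv[OF phi_wedge_inv[OF aI(3,1)] v]])
  obtain s3 r3 where 3: "s3 \<in> Aset" "r3 \<in> Aset" "bil (phi_wedge a1 a2) v = s3 + f4 * r3"
    by (rule inv_polys_decomp[OF q bil_inv[OF phi_wedge_inv[OF aI(1,2)] v]])
  note rI = 1(2)[THEN Aset_inv[OF q]] 2(2)[THEN Aset_inv[OF q]] 3(2)[THEN Aset_inv[OF q]]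
  \<comment> \<open>Up to the factor - 2 of Cramer's rule, v with the \<open>f4\<close>-multiples in
    its coefficients removed, so that \<open>f4\<close> times w has coefficients \<open>s1\<close>,
    \<open>s2\<close>, \<open>s3\<close> in the algebra.\<close>
  define w where "w = (- 2) *s v + ((- r1) *s a1 + (- r2) *s a2 + (- r3) *s a3)"
  have "2 \<in> (inv_polys :: 'a poly3 set)" using inv_polys_Cst[of "2 :: 'a"] by (simp only: Cst_simps)
  then have w: "w \<in> inv_vecs"
    unfolding w_def by (intro inv_vecs_add inv_vecs_smult v aI inv_polys_uminus rI)
  have fv: "(- 2 * f4) *s v = (s1 + f4 * r1) *s a1 + (s2 + f4 * r2) *s a2 + (s3 + f4 * r3) *s a3"
    unfolding 1(3)[symmetric] 2(3)[symmetric] 3(3)[symmetric] by (rule cramer'(1)[symmetric])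
  have "f4 *s w = (- 2 * f4) *s v - ((f4 * r1) *s a1 + (f4 * r2) *s a2 + (f4 * r3) *s a3)"
    unfolding w_def vec_eq_iff forall_3 by (simp add: algebra_simps)
  also have "\<dots> = s1 *s a1 + s2 *s a2 + s3 *s a3"
    unfolding fv vec_eq_iff forall_3 by (simp add: algebra_simps)
  finally have fw: "f4 *s w = s1 *s a1 + s2 *s a2 + s3 *s a3" .
  have h: "\<exists>p\<in>Aset. bil w x = f4 * p" if x: "x \<in> {a1, a2, a3}" for x
  proof -
    have xI: "x \<in> inv_vecs" using x aI by auto
    obtain u p where up: "u \<in> Aset" "p \<in> Aset" "bil w x = u + f4 * p"
      by (rule inv_polys_decomp[OF q bil_inv[OF w xI]])
    have "f4 * bil w x = s1 * bil a1 x + s2 * bil a2 x + s3 * bil a3 x"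
      using arg_cong[OF fw, of "\<lambda>y. bil y x"] by (simp add: bil_linear)
    also have "\<dots> \<in> Aset" by (intro Aset_add Aset_mult 1 2 3 bA) (use x in auto)
    finally have fb: "f4 * bil w x \<in> Aset" .
    \<comment> \<open>As the square of \<open>f4\<close> lies in the algebra, so does f_4 u, and
      then u = 0.\<close>
    have "f4 * bil w x - (f4 * f4) * p \<in> Aset"
      by (rule Aset_diff[OF fb Aset_mult[OF f4_square[OF q] up(2)]])
    then have "f4 * u \<in> Aset" by (simp add: up(3) algebra_simps)
    then have "u = 0" using Aset_f4_0[OF q up(1)] by simp
    then show ?thesis using up by auto
  qed
  obtain p1 where p1: "p1 \<in> Aset" "bil w a1 = f4 * p1" using h[of a1] by auto
  obtain p2 where p2: "p2 \<in> Aset" "bil w a2 = f4 * p2" using h[of a2] by auto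
  obtain p3 where p3: "p3 \<in> Aset" "bil w a3 = f4 * p3" using h[of a3] by auto
  have "f4 *s ((- 2) *s w) = (- 2 * f4) *s w"
    by (simp add: vec_eq_iff algebra_simps)
  also have "\<dots> = (f4 * p1) *s phi_wedge a2 a3 + (f4 * p2) *s phi_wedge a3 a1 + (f4 * p3) *s phi_wedge a1 a2"
    by (rule cramer'(2)[of w, unfolded p1(2) p2(2) p3(2), symmetric])
  also have "\<dots> = f4 *s (p1 *s phi_wedge a2 a3 + p2 *s phi_wedge a3 a1 + p3 *s phi_wedge a1 a2)"
    by (simp add: vec_eq_iff algebra_simps)
  finally have "f4 *s ((- 2) *s w) = f4 *s (p1 *s phi_wedge a2 a3 + p2 *s phi_wedge a3 a1 + p3 *s phi_wedge a1 a2)" .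
  then have w2: "(- 2) *s w = p1 *s phi_wedge a2 a3 + p2 *s phi_wedge a3 a1 + p3 *s phi_wedge a1 a2"
    by (rule vec_smult_cancel[OF f4_neq_0[OF q]])
  \<comment> \<open>Cramer's factor - 2 has entered twice, once in w and once in its expansion, so
    what is known is 4 v.\<close>
  define k :: 'a where "k = 1 / 4"
  have "(4::'a) \<noteq> 0" using two_neq_0[OF q] by (metis mult_2 mult_eq_0_iff numeral_Bit0)
  then have "k * 4 = 1" by (simp add: k_def)
  then have k: "Cst k * 4 = 1" using Cst_simps(4)[of k 4] by (simp add: Cst_simps)
  have v4: "4 *s v = p1 *s phi_wedge a2 a3 + p2 *s phi_wedge a3 a1 + p3 *s phi_wedge a1 a2 + (- 2) *s (r1 *s a1 + r2 *s a2 + r3 *s a3)"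
    unfolding w2[symmetric] w_def vec_eq_iff forall_3 by (simp add: algebra_simps)
  have "v = (Cst k * 4) *s v" by (simp add: k)
  also have "\<dots> = Cst k *s (4 *s v)" by (simp add: vec_eq_iff mult.assoc)
  also have "\<dots> = (Cst (- 2 * k) * r1) *s a1 + (Cst (- 2 * k) * r2) *s a2 + (Cst (- 2 * k) * r3) *s a3
     + (Cst k * p1) *s phi_wedge a2 a3 + (Cst k * p2) *s phi_wedge a3 a1 + (Cst k * p3) *s phi_wedge a1 a2"
    unfolding v4 vec_eq_iff forall_3 by (simp add: Cst_simps algebra_simps)
  finally show ?thesis
    unfolding a1_def a2_def a3_def using 1 2 3 p1 p2 p3 Aset_mult Aset_Cst by blast
qed

section \<open>The module of invariant forms\<close>

definition subring_set :: "'r::comm_ring_1 set \<Rightarrow> bool" where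
  "subring_set S \<longleftrightarrow> 1 \<in> S \<and> (\<forall>x\<in>S. \<forall>y\<in>S. x - y \<in> S \<and> x * y \<in> S)"

lemma subring_setD:
  assumes "subring_set S"
  shows "0 \<in> S" "1 \<in> S" "x \<in> S \<Longrightarrow> - x \<in> S" "x \<in> S \<Longrightarrow> y \<in> S \<Longrightarrow> x + y \<in> S"
    "x \<in> S \<Longrightarrow> y \<in> S \<Longrightarrow> x * y \<in> S"
proof -
  have 1: "1 \<in> S" and diff: "\<And>x y. x \<in> S \<Longrightarrow> y \<in> S \<Longrightarrow> x - y \<in> S"
    and mult: "\<And>x y. x \<in> S \<Longrightarrow> y \<in> S \<Longrightarrow> x * y \<in> S"
    using assms by (auto simp: subring_set_def)
  have 0: "0 \<in> S" using diff[OF 1 1] by simp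
  have um: "- x \<in> S" if "x \<in> S" for x using diff[OF 0 that] by simp
  have "x + y \<in> S" if "x \<in> S" "y \<in> S" for x y using diff[OF that(1) um[OF that(2)]] by simp
  then show "0 \<in> S" "1 \<in> S" "x \<in> S \<Longrightarrow> - x \<in> S" "x \<in> S \<Longrightarrow> y \<in> S \<Longrightarrow> x + y \<in> S"
    "x \<in> S \<Longrightarrow> y \<in> S \<Longrightarrow> x * y \<in> S"
    using 0 1 um mult by auto
qed

lemma ring_on_simps [simp]:
  "carrier (ring_on S) = S" "x \<otimes>\<^bsub>ring_on S\<^esub> y = x * y" "x \<oplus>\<^bsub>ring_on S\<^esub> y = x + y"
  "\<one>\<^bsub>ring_on S\<^esub> = 1" "\<zero>\<^bsub>ring_on S\<^esub> = 0"
  by (simp_all add: ring_on_def)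

lemma cring_ring_on:
  assumes "subring_set S" shows "cring (ring_on S)"
proof (rule cringI)
  note S = subring_setD[OF assms]
  show "abelian_group (ring_on S)"
    by (rule abelian_groupI) (auto simp: S algebra_simps intro!: bexI[of _ "- _"])
  show "comm_monoid (ring_on S)"
    by (rule comm_monoidI) (auto simp: S algebra_simps)
qed (auto simp: algebra_simps)

lemma subring_inv_polys: "subring_set (inv_polys :: 'a::field poly3 set)"
  using inv_polys_Cst[of "1::'a"] by (auto simp: subring_set_def inv_polys_diff inv_polys_mult Cst_simps)

lemma subring_Aset: "subring_set Aset"
  by (auto simp: subring_set_def Aset_1 Aset_diff Aset_mult)

lemma RG_simps [simp]: "carrier RG = inv_polys" "x \<otimes>\<^bsub>RG\<^esub> y = x * y" "x \<oplus>\<^bsub>RG\<^esub> y = x + y"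
  "\<one>\<^bsub>RG\<^esub> = 1" "\<zero>\<^bsub>RG\<^esub> = 0"
  by (simp_all add: RG_def)

lemma cring_RG: "cring RG"
  unfolding RG_def by (rule cring_ring_on[OF subring_inv_polys])

lemma OmegaG_simps [simp]:
  "carrier OmegaG = inv_forms" "\<zero>\<^bsub>OmegaG\<^esub> = 0" "\<omega> \<oplus>\<^bsub>OmegaG\<^esub> \<eta> = \<omega> + \<eta>" "f \<odot>\<^bsub>OmegaG\<^esub> \<omega> = f *s \<omega>"
  by (simp_all add: OmegaG_def)

lemma inv_forms_0:
  assumes q: "odd CARD('a::{field,finite})"
  shows "(0 :: 'a form) \<in> inv_forms"
proof -
  have "(0 :: 'a poly3) \<in> inv_polys" using inv_polys_Cst[of "0::'a"] by (simp add: Cst_simps)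
  then show ?thesis by (simp add: inv_forms_iff[OF q] vec12_simps inv_vecs_0)
qed

lemma inv_forms_add:
  assumes q: "odd CARD('a::{field,finite})"
  shows "\<omega> \<in> inv_forms \<Longrightarrow> \<eta> \<in> inv_forms \<Longrightarrow> \<omega> + \<eta> \<in> (inv_forms :: 'a form set)"
  by (auto simp: inv_forms_iff[OF q] vec12_simps inv_polys_add inv_vecs_add)

lemma inv_forms_smult:
  assumes q: "odd CARD('a::{field,finite})"
  shows "f \<in> inv_polys \<Longrightarrow> \<omega> \<in> inv_forms \<Longrightarrow> f *s \<omega> \<in> (inv_forms :: 'a form set)"
  by (auto simp: inv_forms_iff[OF q] vec12_simps inv_polys_mult inv_vecs_smult)

lemma abelian_group_OmegaG:
  assumes q: "odd CARD('a::{field,finite})"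
  shows "abelian_group (OmegaG :: ('a poly3, 'a form) module)"
proof (rule abelian_groupI)
  have "- 1 \<in> (inv_polys :: 'a poly3 set)" using inv_polys_Cst[of "- 1 :: 'a"] by (simp add: Cst_simps)
  then have um: "- 1 *s \<omega> \<in> inv_forms" if "\<omega> \<in> inv_forms" for \<omega> :: "'a form"
    by (rule inv_forms_smult[OF q _ that])
  show "\<exists>\<eta>\<in>carrier OmegaG. \<eta> \<oplus>\<^bsub>OmegaG\<^esub> \<omega> = \<zero>\<^bsub>OmegaG\<^esub>" if "\<omega> \<in> carrier OmegaG" for \<omega> :: "'a form"
    using um that by (intro bexI[of _ "- 1 *s \<omega>"]) (auto simp: vec_eq_iff)
qed (auto simp: inv_forms_add[OF q] inv_forms_0[OF q] algebra_simps)

lemma module_OmegaG: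
  assumes q: "odd CARD('a::{field,finite})" and "subring_set S" "S \<subseteq> inv_polys"
  shows "Module.module (ring_on S) (OmegaG :: ('a poly3, 'a form) module)"
proof (rule moduleI)
  show "cring (ring_on S)" by (rule cring_ring_on[OF assms(2)])
  show "abelian_group (OmegaG :: ('a poly3, 'a form) module)" by (rule abelian_group_OmegaG[OF q])
qed (use assms(3) in \<open>auto simp: inv_forms_smult[OF q] vector_sadd_rdistrib vector_add_ldistrib vector_smult_assoc\<close>)

lemma finsum_OmegaG:
  assumes q: "odd CARD('a::{field,finite})"
    and "finite I" "\<And>i. i \<in> I \<Longrightarrow> g i \<in> (inv_forms :: 'a form set)"
  shows "finsum OmegaG g I = sum g I"
  using assms(2,3)
proof (induction I)
  case empty
  interpret abelian_group "OmegaG :: ('a poly3, 'a form) module" by (rule abelian_group_OmegaG[OF q])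
  show ?case by simp
next
  case (insert i I)
  interpret abelian_group "OmegaG :: ('a poly3, 'a form) module" by (rule abelian_group_OmegaG[OF q])
  show ?case using insert by (subst finsum_insert) auto
qed

lemma inv_forms_sum:
  assumes q: "odd CARD('a::{field,finite})"
    and "\<And>i. i \<in> I \<Longrightarrow> g i \<in> (inv_forms :: 'a form set)"
  shows "sum g I \<in> inv_forms"
  using assms(2) by (induction I rule: infinite_finite_induct) (auto simp: inv_forms_0[OF q] inv_forms_add[OF q])

subsection \<open>The basis\<close>

definition gens :: "'a::{field,finite} form list" where
  "gens = [scalar 1, scalar f4,
      d f1, d f2, d f3,
      phi (d f2 \<and>\<^sub>\<Omega> d f3), phi (d f3 \<and>\<^sub>\<Omega> d f1), phi (d f1 \<and>\<^sub>\<Omega> d f2),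
      phi_inv (d f1), phi_inv (d f2), phi_inv (d f3),
      d f2 \<and>\<^sub>\<Omega> d f3, d f3 \<and>\<^sub>\<Omega> d f1, d f1 \<and>\<^sub>\<Omega> d f2,
      dx 1 \<and>\<^sub>\<Omega> dx 2 \<and>\<^sub>\<Omega> dx 3, f4 *s (dx 1 \<and>\<^sub>\<Omega> dx 2 \<and>\<^sub>\<Omega> dx 3)]"

lemma length_gens: "length gens = 16"
  by (simp add: gens_def)

lemma gens_inv:
  assumes q: "odd CARD('a::{field,finite})"
  shows "set gens \<subseteq> (inv_forms :: 'a form set)"
proof -
  have 01: "(0 :: 'a poly3) \<in> inv_polys" "(1 :: 'a poly3) \<in> inv_polys"
    using subring_setD[OF subring_inv_polys] by blast+
  show ?thesis
    unfolding gens_def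
    by (simp add: inv_forms_iff[OF q] scalar_component v_scalar d_component v_d dd_component phi_component
        phi_inv_component[OF q] volume_component vec12_simps 01 inv_vecs_0 f4_inv[OF q]
        grad_inv f1_inv f2_inv[OF q] f3_inv phi_wedge_inv)
qed

lemma sum_16: "(\<Sum>i<16. g i) = g 0 + g 1 + g 2 + g 3 + g 4 + g 5 + g 6 + g 7 + g 8 + g 9 + g 10 + g 11
   + g 12 + g 13 + g 14 + (g (15::nat) :: 'b::comm_monoid_add)"
  by (simp add: eval_nat_numeral lessThan_Suc add.commute add.left_commute)

lemma forall_less_16: "(\<forall>i<16. P (i::nat)) \<longleftrightarrow> P 0 \<and> P 1 \<and> P 2 \<and> P 3 \<and> P 4 \<and> P 5 \<and> P 6 \<and> P 7 \<and> P 8 \<and> P 9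
   \<and> P 10 \<and> P 11 \<and> P 12 \<and> P 13 \<and> P 14 \<and> P 15"
  by (simp add: eval_nat_numeral All_less_Suc conj_commute conj_left_commute)

definition lin :: "(nat \<Rightarrow> 'a poly3) \<Rightarrow> 'a::{field,finite} form" where
  "lin c = (\<Sum>i<16. c i *s (gens ! i))"

lemma gens_nth:
  "gens ! 0 = scalar 1" "gens ! 1 = scalar f4" "gens ! 2 = d f1" "gens ! 3 = d f2" "gens ! 4 = d f3"
  "gens ! 5 = phi (d f2 \<and>\<^sub>\<Omega> d f3)" "gens ! 6 = phi (d f3 \<and>\<^sub>\<Omega> d f1)" "gens ! 7 = phi (d f1 \<and>\<^sub>\<Omega> d f2)"
  "gens ! 8 = phi_inv (d f1)" "gens ! 9 = phi_inv (d f2)" "gens ! 10 = phi_inv (d f3)"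
  "gens ! 11 = d f2 \<and>\<^sub>\<Omega> d f3" "gens ! 12 = d f3 \<and>\<^sub>\<Omega> d f1" "gens ! 13 = d f1 \<and>\<^sub>\<Omega> d f2"
  "gens ! 14 = dx 1 \<and>\<^sub>\<Omega> dx 2 \<and>\<^sub>\<Omega> dx 3" "gens ! 15 = f4 *s (dx 1 \<and>\<^sub>\<Omega> dx 2 \<and>\<^sub>\<Omega> dx 3)"
  by (simp_all add: gens_def)

lemma lin_component:
  fixes c :: "nat \<Rightarrow> 'a::{field,finite} poly3"
  assumes q: "odd CARD('a)"
  shows "lin c $ {} = c 0 + f4 * c 1"
    "vec1 (lin c) = c 2 *s grad f1 + c 3 *s grad f2 + c 4 *s grad f3
       + c 5 *s phi_wedge (grad f2) (grad f3) + c 6 *s phi_wedge (grad f3) (grad f1) + c 7 *s phi_wedge (grad f1) (grad f2)"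
    "vec2 (lin c) = c 8 *s grad f1 + c 9 *s grad f2 + c 10 *s grad f3
       + c 11 *s phi_wedge (grad f2) (grad f3) + c 12 *s phi_wedge (grad f3) (grad f1) + c 13 *s phi_wedge (grad f1) (grad f2)"
    "lin c $ {1, 2, 3} = c 14 + f4 * c 15"
proof -
  note comps = lin_def sum_16 gens_nth gens_nth(2)[unfolded One_nat_def] vec12_simps scalar_component v_scalar d_component v_d dd_component
    phi_component phi_inv_component[OF q] volume_component
  show "lin c $ {} = c 0 + f4 * c 1" "lin c $ {1, 2, 3} = c 14 + f4 * c 15"
    by (simp_all add: comps)
  show "vec1 (lin c) = c 2 *s grad f1 + c 3 *s grad f2 + c 4 *s grad f3
       + c 5 *s phi_wedge (grad f2) (grad f3) + c 6 *s phi_wedge (grad f3) (grad f1) + c 7 *s phi_wedge (grad f1) (grad f2)"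
    "vec2 (lin c) = c 8 *s grad f1 + c 9 *s grad f2 + c 10 *s grad f3
       + c 11 *s phi_wedge (grad f2) (grad f3) + c 12 *s phi_wedge (grad f3) (grad f1) + c 13 *s phi_wedge (grad f1) (grad f2)"
    by (simp_all add: comps)
qed

lemma lin_eq_0:
  fixes c :: "nat \<Rightarrow> 'a::{field,finite} poly3"
  assumes q: "odd CARD('a)" and c: "\<And>i. i < 16 \<Longrightarrow> c i \<in> Aset" and 0: "lin c = 0" and "i < 16"
  shows "c i = 0"
proof -
  have scal: "x = 0 \<and> y = 0" if xy: "x \<in> Aset" "y \<in> Aset" "x + f4 * y = 0" for x y :: "'a poly3"
  proof -
    have "f4 * y = - x" using xy(3) by (simp add: eq_neg_iff_add_eq_0 add.commute)
    then have "f4 * y \<in> Aset" using Aset_uminus[OF xy(1)] by simp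
    then have "y = 0" by (rule Aset_f4_0[OF q xy(2)])
    then show ?thesis using xy(3) by simp
  qed
  have "c 0 = 0 \<and> c 1 = 0"
    by (rule scal) (use lin_component(1)[OF q, of c] 0 in \<open>auto simp: c\<close>)
  moreover have "c 14 = 0 \<and> c 15 = 0"
    by (rule scal) (use lin_component(4)[OF q, of c] 0 in \<open>auto simp: c\<close>)
  moreover have "c 2 = 0 \<and> c 3 = 0 \<and> c 4 = 0 \<and> c 5 = 0 \<and> c 6 = 0 \<and> c 7 = 0"
    by (rule inv_vecs_unique[OF q _ _ _ _ _ _ lin_component(2)[OF q, of c, unfolded 0 vec12_simps, symmetric]])
      (simp_all add: c)
  moreover have "c 8 = 0 \<and> c 9 = 0 \<and> c 10 = 0 \<and> c 11 = 0 \<and> c 12 = 0 \<and> c 13 = 0"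
    by (rule inv_vecs_unique[OF q _ _ _ _ _ _ lin_component(3)[OF q, of c, unfolded 0 vec12_simps, symmetric]])
      (simp_all add: c)
  ultimately have "\<forall>i<16. c i = 0" unfolding forall_less_16 by simp
  then show ?thesis using \<open>i < 16\<close> by blast
qed

lemma lin_exists:
  fixes \<omega> :: "'a::{field,finite} form"
  assumes q: "odd CARD('a)" and \<omega>: "\<omega> \<in> inv_forms"
  shows "\<exists>c. (\<forall>i<16. c i \<in> Aset) \<and> \<omega> = lin c"
proof -
  note \<omega> = \<omega>[unfolded inv_forms_iff[OF q]]
  obtain c0 c1 where 0: "c0 \<in> Aset" "c1 \<in> Aset" "\<omega> $ {} = c0 + f4 * c1"
    using inv_polys_decomp[OF q, of "\<omega> $ {}"] \<omega> by blast
  obtain c14 c15 where 3: "c14 \<in> Aset" "c15 \<in> Aset" "\<omega> $ {1, 2, 3} = c14 + f4 * c15"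
    using inv_polys_decomp[OF q, of "\<omega> $ {1, 2, 3}"] \<omega> by blast
  have "vec1 \<omega> \<in> inv_vecs" using \<omega> by blast
  from inv_vecs_exist[OF q this] obtain c2 c3 c4 c5 c6 c7 where 1: "c2 \<in> Aset" "c3 \<in> Aset" "c4 \<in> Aset" "c5 \<in> Aset" "c6 \<in> Aset" "c7 \<in> Aset"
    "vec1 \<omega> = c2 *s grad f1 + c3 *s grad f2 + c4 *s grad f3
       + c5 *s phi_wedge (grad f2) (grad f3) + c6 *s phi_wedge (grad f3) (grad f1) + c7 *s phi_wedge (grad f1) (grad f2)"
    by blast
  have "vec2 \<omega> \<in> inv_vecs" using \<omega> by blast
  from inv_vecs_exist[OF q this] obtain c8 c9 c10 c11 c12 c13 where 2: "c8 \<in> Aset" "c9 \<in> Aset" "c10 \<in> Aset" "c11 \<in> Aset" "c12 \<in> Aset" "c13 \<in> Aset"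
    "vec2 \<omega> = c8 *s grad f1 + c9 *s grad f2 + c10 *s grad f3
       + c11 *s phi_wedge (grad f2) (grad f3) + c12 *s phi_wedge (grad f3) (grad f1) + c13 *s phi_wedge (grad f1) (grad f2)"
    by blast
  define c where "c = (\<lambda>i. [c0, c1, c2, c3, c4, c5, c6, c7, c8, c9, c10, c11, c12, c13, c14, c15] ! i)"
  have nth: "c 0 = c0" "c 1 = c1" "c 2 = c2" "c 3 = c3" "c 4 = c4" "c 5 = c5" "c 6 = c6" "c 7 = c7" "c 8 = c8"
    "c 9 = c9" "c 10 = c10" "c 11 = c11" "c 12 = c12" "c 13 = c13" "c 14 = c14" "c 15 = c15"
    by (simp_all add: c_def)
  have "\<forall>i<16. c i \<in> Aset"
    unfolding forall_less_16 nth using 0 1 2 3 by blast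
  moreover have "\<omega> = lin c"
    by (rule form_eqI[OF q]) (simp_all only: lin_component[OF q] nth 0 1 2 3)
  ultimately show ?thesis by blast
qed

lemma lin_diff: "lin (\<lambda>i. c i - e i) = lin c - lin e"
  by (simp add: lin_def vec.scale_left_diff_distrib sum_subtractf vector_sub_rdistrib)

lemma finsum_gens:
  fixes c :: "nat \<Rightarrow> 'a::{field,finite} poly3"
  assumes q: "odd CARD('a)" and "\<And>i. i < 16 \<Longrightarrow> c i \<in> inv_polys"
  shows "(\<Oplus>\<^bsub>OmegaG\<^esub>i\<in>{..<length gens}. c i \<odot>\<^bsub>OmegaG\<^esub> (gens ! i)) = lin c"
proof -
  have "gens ! i \<in> (inv_forms :: 'a form set)" if "i < 16" for i
    using gens_inv[OF q] that nth_mem[of i gens] by (auto simp: length_gens)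
  then show ?thesis
    unfolding length_gens lin_def OmegaG_simps
    by (intro finsum_OmegaG[OF q]) (auto intro: inv_forms_smult[OF q] assms(2))
qed

lemma Aset_algebra: "\<A> = ring_on Aset"
  by (simp add: \<A>_def Aset_def)

theorem freely_generated_OmegaG:
  assumes q: "odd CARD('a::{field,finite})"
  shows "freely_generated_by \<A> (OmegaG :: ('a poly3, 'a form) module) gens"
  unfolding freely_generated_by_def Aset_algebra ring_on_simps
proof (intro conjI ballI)
  show "Module.module (ring_on Aset) (OmegaG :: ('a poly3, 'a form) module)"
    by (rule module_OmegaG[OF q subring_Aset]) (auto simp: Aset_inv[OF q])
  show "set gens \<subseteq> carrier (OmegaG :: ('a poly3, 'a form) module)"
    using gens_inv[OF q] by simp
  fix \<omega> :: "'a form" assume "\<omega> \<in> carrier OmegaG"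
  then have "\<omega> \<in> inv_forms" by simp
  then obtain c where c: "\<And>i. i < 16 \<Longrightarrow> c i \<in> Aset" "\<omega> = lin c" using lin_exists[OF q] by blast
  let ?n = "length (gens :: 'a form list)"
  let ?c = "restrict c {..<?n}"
  show "\<exists>!c. c \<in> {..<?n} \<rightarrow>\<^sub>E Aset \<and> \<omega> = (\<Oplus>\<^bsub>OmegaG\<^esub>i\<in>{..<?n}. c i \<odot>\<^bsub>OmegaG\<^esub> (gens ! i))"
  proof (rule ex1I[of _ ?c])
    have "lin ?c = lin c"
      unfolding lin_def by (rule sum.cong) (auto simp: length_gens)
    then have "\<omega> = (\<Oplus>\<^bsub>OmegaG\<^esub>i\<in>{..<?n}. ?c i \<odot>\<^bsub>OmegaG\<^esub> (gens ! i))"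
      using c by (subst finsum_gens[OF q]) (auto simp: length_gens Aset_inv[OF q])
    then show "?c \<in> {..<?n} \<rightarrow>\<^sub>E Aset \<and> \<omega> = (\<Oplus>\<^bsub>OmegaG\<^esub>i\<in>{..<?n}. ?c i \<odot>\<^bsub>OmegaG\<^esub> (gens ! i))"
      using c(1) by (auto simp: length_gens)
  next
    fix e :: "nat \<Rightarrow> 'a poly3"
    assume e: "e \<in> {..<?n} \<rightarrow>\<^sub>E Aset \<and> \<omega> = (\<Oplus>\<^bsub>OmegaG\<^esub>i\<in>{..<?n}. e i \<odot>\<^bsub>OmegaG\<^esub> (gens ! i))"
    then have eA: "e i \<in> Aset" if "i < 16" for i using that by (auto simp: length_gens)
    then have "lin e = lin c"
      using e c(2) by (subst (asm) finsum_gens[OF q]) (auto simp: Aset_inv[OF q])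
    then have 0: "lin (\<lambda>i. e i - c i) = 0" by (simp add: lin_diff)
    have "e i - c i = 0" if "i < 16" for i
      by (rule lin_eq_0[OF q _ 0 that]) (auto simp: Aset_diff eA c(1))
    then show "e = ?c"
      using e by (auto simp: length_gens fun_eq_iff PiE_def extensional_def)
  qed
qed

lemma fin_gen_OmegaG:
  assumes q: "odd CARD('a::{field,finite})"
  shows "fin_gen_module RG (OmegaG :: ('a poly3, 'a form) module)"
  unfolding fin_gen_module_def RG_def
proof (intro conjI exI[of _ "set gens"])
  show "Module.module (ring_on inv_polys) (OmegaG :: ('a poly3, 'a form) module)"
    by (rule module_OmegaG[OF q subring_inv_polys]) simp
  show "\<forall>m\<in>carrier OmegaG. \<exists>c\<in>set gens \<rightarrow> carrier (ring_on inv_polys).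
     m = (\<Oplus>\<^bsub>OmegaG\<^esub>b\<in>set gens. c b \<odot>\<^bsub>OmegaG\<^esub> (b :: 'a form))"
  proof
    fix \<omega> :: "'a form" assume "\<omega> \<in> carrier OmegaG"
    then have "\<omega> \<in> inv_forms" by simp
    then obtain c where c: "\<And>i. i < 16 \<Longrightarrow> c i \<in> Aset" "\<omega> = lin c" using lin_exists[OF q] by blast
    \<comment> \<open>Generators are counted here as a set, so coefficients at equal list members
      are added.\<close>
    let ?fib = "\<lambda>b :: 'a form. {i \<in> {..<16}. gens ! i = b}"
    define e where "e b = (\<Sum>i\<in>?fib b. c i)" for b
    have eI: "e b \<in> inv_polys" for b
      unfolding e_def by (rule Aset_inv[OF q], rule Aset_sum) (auto simp: c(1))
    have im: "set gens = (\<lambda>i. gens ! i) ` {..<16}"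
      by (auto simp: set_conv_nth length_gens)
    have "\<omega> = (\<Sum>b\<in>set gens. \<Sum>i\<in>?fib b. c i *s (gens ! i))"
      unfolding c(2) lin_def im by (rule sum.image_gen) simp
    also have "\<dots> = (\<Sum>b\<in>set gens. e b *s b)"
    proof (rule sum.cong)
      fix b :: "'a form"
      have "(\<Sum>i\<in>?fib b. c i *s (gens ! i)) = (\<Sum>i\<in>?fib b. c i *s b)" by (rule sum.cong) auto
      also have "\<dots> = e b *s b" by (simp add: e_def vec_eq_iff sum_distrib_right)
      finally show "(\<Sum>i\<in>?fib b. c i *s (gens ! i)) = e b *s b" .
    qed simp
    also have "\<dots> = (\<Oplus>\<^bsub>OmegaG\<^esub>b\<in>set gens. e b \<odot>\<^bsub>OmegaG\<^esub> b)"
      unfolding OmegaG_simps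
      by (rule finsum_OmegaG[OF q, symmetric]) (use gens_inv[OF q] eI in \<open>auto intro: inv_forms_smult[OF q]\<close>)
    finally show "\<exists>c\<in>set gens \<rightarrow> carrier (ring_on inv_polys).
       \<omega> = (\<Oplus>\<^bsub>OmegaG\<^esub>b\<in>set gens. c b \<odot>\<^bsub>OmegaG\<^esub> (b :: 'a form))"
      using eI by (intro bexI[of _ e]) auto
  qed
qed (use gens_inv[OF q] in auto)

section \<open>Algebraic independence along chains of ideals\<close>

fun monl :: "'r::comm_ring_1 list \<Rightarrow> nat list \<Rightarrow> 'r" where
  "monl (a # as) (e # es) = a ^ e * monl as es"
| "monl _ _ = 1"

lemma subring_set_sum:
  assumes "subring_set S" "\<And>x. x \<in> A \<Longrightarrow> g x \<in> S" shows "sum g A \<in> S"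
  using assms(2) by (induction A rule: infinite_finite_induct) (auto simp: subring_setD[OF assms(1)])

lemma subring_set_power: "subring_set S \<Longrightarrow> x \<in> S \<Longrightarrow> x ^ n \<in> S"
  by (induction n) (auto simp: subring_setD)

lemma subring_set_monl: "subring_set S \<Longrightarrow> set as \<subseteq> S \<Longrightarrow> monl as e \<in> S"
  by (induction as e rule: monl.induct) (auto simp: subring_setD subring_set_power)

text \<open>The lowest terms with respect to the lexicographic order are split off one variable at a time;
  both chains of primes and regular sequences provide the hypotheses.\<close>

lemma chain_independent:
  fixes I :: "nat \<Rightarrow> 'a::field poly3 set"
  assumes T: "subring_set T" "\<And>c. Cst c \<in> T" and "set as \<subseteq> T"
    and diff: "\<And>i x y. i \<le> length as \<Longrightarrow> x \<in> I i \<Longrightarrow> y \<in> I i \<Longrightarrow> x - y \<in> I i"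
    and mult: "\<And>i x y. i \<le> length as \<Longrightarrow> x \<in> I i \<Longrightarrow> y \<in> T \<Longrightarrow> x * y \<in> I i"
    and mono: "\<And>i. i < length as \<Longrightarrow> I i \<subseteq> I (Suc i)"
    and mem: "\<And>i. i < length as \<Longrightarrow> as ! i \<in> I (Suc i)"
    and reg: "\<And>i x. i < length as \<Longrightarrow> x \<in> T \<Longrightarrow> as ! i * x \<in> I i \<Longrightarrow> x \<in> I i"
    and const: "\<And>c. Cst c \<in> I (length as) \<Longrightarrow> c = 0"
    and E: "finite E" "\<And>e. e \<in> E \<Longrightarrow> length e = length as"
    and sum: "(\<Sum>e\<in>E. Cst (c e) * monl as e) \<in> I 0"
  shows "\<forall>e\<in>E. c e = 0"
  using assms(3-)
proof (induction as arbitrary: I E c)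
  case Nil
  show ?case
  proof
    fix e assume e: "e \<in> E"
    then have "e = []" "E = {[]}" using Nil.prems(9) by auto
    then show "c e = 0" using Nil.prems(7,10) by simp
  qed
next
  case (Cons a as)
  note prems = Cons.prems
  show ?case
  proof (rule ccontr)
    assume "\<not> (\<forall>e\<in>E. c e = 0)"
    define E' where "E' = {e \<in> E. c e \<noteq> 0}"
    have E': "finite E'" "E' \<noteq> {}" using \<open>\<not> (\<forall>e\<in>E. c e = 0)\<close> prems(8) by (auto simp: E'_def)
    \<comment> \<open>With k the least exponent of a that occurs, the relation reads a^k (S_1 + a
      S_2), where S_1 involves only the remaining elements.\<close>
    define k where "k = Min (hd ` E')"
    have k: "k \<le> hd e" if "e \<in> E'" for e using that E' by (auto simp: k_def)
    have "k \<in> hd ` E'" unfolding k_def by (rule Min_in) (use E' in auto)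
    have cons: "e = hd e # tl e" "length (tl e) = length as" if "e \<in> E'" for e
      using prems(9)[of e] that by (cases e; auto simp: E'_def)+
    define E1 where "E1 = {e \<in> E'. hd e = k}"
    define E2 where "E2 = {e \<in> E'. hd e \<noteq> k}"
    define S1 where "S1 = (\<Sum>e\<in>E1. Cst (c e) * monl as (tl e))"
    define S2 where "S2 = (\<Sum>e\<in>E2. Cst (c e) * (a ^ (hd e - Suc k) * monl as (tl e)))"
    have aT: "a \<in> T" "set as \<subseteq> T" using prems(1) by auto
    have S: "S1 \<in> T" "S2 \<in> T"
      unfolding S1_def S2_def
      by (auto intro!: subring_set_sum[OF T(1)] subring_setD(5)[OF T(1)] T(2) subring_set_monl[OF T(1)]
          subring_set_power[OF T(1)] aT)
    have m: "monl (a # as) e = a ^ hd e * monl as (tl e)" if "e \<in> E'" for e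
      using cons(1)[OF that] by (metis monl.simps(1))
    have "(\<Sum>e\<in>E. Cst (c e) * monl (a # as) e) = (\<Sum>e\<in>E'. Cst (c e) * monl (a # as) e)"
      by (rule sum.mono_neutral_right) (use prems(8) in \<open>auto simp: E'_def Cst_simps\<close>)
    also have "\<dots> = (\<Sum>e\<in>E1. Cst (c e) * monl (a # as) e) + (\<Sum>e\<in>E2. Cst (c e) * monl (a # as) e)"
    proof -
      have "E' = E1 \<union> E2" "E1 \<inter> E2 = {}" "finite E1" "finite E2" using E' by (auto simp: E1_def E2_def)
      then show ?thesis by (simp add: sum.union_disjoint)
    qed
    also have "(\<Sum>e\<in>E1. Cst (c e) * monl (a # as) e) = a ^ k * S1"
      unfolding S1_def sum_distrib_left
      by (rule sum.cong) (auto simp: E1_def m algebra_simps)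
    also have "(\<Sum>e\<in>E2. Cst (c e) * monl (a # as) e) = a ^ k * (a * S2)"
      unfolding S2_def sum_distrib_left
    proof (rule sum.cong)
      fix e assume e: "e \<in> E2"
      then have "hd e = k + Suc (hd e - Suc k)" using k[of e] by (auto simp: E2_def)
      then have "a ^ hd e = a ^ k * (a * a ^ (hd e - Suc k))" by (metis power_add power_Suc)
      then show "Cst (c e) * monl (a # as) e = a ^ k * (a * (Cst (c e) * (a ^ (hd e - Suc k) * monl as (tl e))))"
        using e by (simp add: m E2_def algebra_simps)
    qed simp
    finally have "a ^ k * (S1 + a * S2) \<in> I 0" using prems(10) by (simp add: ring_distribs)
    moreover have y: "S1 + a * S2 \<in> T" using S aT by (simp add: subring_setD[OF T(1)])
    \<comment> \<open>a is a nonzerodivisor modulo the first ideal, so its powers cancel.\<close>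
    have "a ^ j * (S1 + a * S2) \<in> I 0 \<Longrightarrow> S1 + a * S2 \<in> I 0" for j
    proof (induction j)
      case (Suc j)
      have "a ^ j * (S1 + a * S2) \<in> T"
        using y aT by (simp add: subring_setD[OF T(1)] subring_set_power[OF T(1)])
      moreover have "a * (a ^ j * (S1 + a * S2)) \<in> I 0" using Suc.prems by (simp add: mult.assoc)
      ultimately have "a ^ j * (S1 + a * S2) \<in> I 0" using prems(6)[of 0] by simp
      then show ?case by (rule Suc.IH)
    qed simp
    ultimately have "S1 + a * S2 \<in> I 0" by blast
    \<comment> \<open>The next ideal contains a, so S_1 alone is a relation there.\<close>
    then have "S1 + a * S2 \<in> I 1" using prems(4)[of 0] by auto
    moreover have "a * S2 \<in> I 1" using prems(3)[of 1 a S2] prems(5)[of 0] S by simp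
    ultimately have "S1 + a * S2 - a * S2 \<in> I 1" using prems(2)[of 1 "S1 + a * S2" "a * S2"] by simp
    then have S1: "S1 \<in> I 1" by simp
    have "inj_on tl E1"
      by (rule inj_onI) (metis (mono_tags, lifting) E1_def cons(1) mem_Collect_eq)
    moreover have "k # tl e = e" if "e \<in> E1" for e
      using that cons(1)[of e] by (simp add: E1_def)
    ultimately have "(\<Sum>e\<in>tl ` E1. Cst (c (k # e)) * monl as e) = S1"
      by (simp add: S1_def sum.reindex)
    then have sum': "(\<Sum>e\<in>tl ` E1. Cst (c (k # e)) * monl as e) \<in> I (Suc 0)" using S1 by simp
    have "\<forall>e\<in>tl ` E1. c (k # e) = 0"
    proof (rule Cons.IH[of "\<lambda>i. I (Suc i)"])
      show "x - y \<in> I (Suc i)" if "i \<le> length as" "x \<in> I (Suc i)" "y \<in> I (Suc i)" for i x y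
        using prems(2)[of "Suc i" x y] that by simp
      show "x * y \<in> I (Suc i)" if "i \<le> length as" "x \<in> I (Suc i)" "y \<in> T" for i x y
        using prems(3)[of "Suc i" x y] that by simp
      show "I (Suc i) \<subseteq> I (Suc (Suc i))" if "i < length as" for i
        using prems(4)[of "Suc i"] that by simp
      show "as ! i \<in> I (Suc (Suc i))" if "i < length as" for i
        using prems(5)[of "Suc i"] that by simp
      show "x \<in> I (Suc i)" if "i < length as" "x \<in> T" "as ! i * x \<in> I (Suc i)" for i x
        using prems(6)[of "Suc i" x] that by simp
      show "c = 0" if "Cst c \<in> I (Suc (length as))" for c
        using prems(7)[of c] that by simp
      show "finite (tl ` E1)" using E' by (simp add: E1_def)
      show "length e = length as" if "e \<in> tl ` E1" for e
        using that cons(2) by (auto simp: E1_def)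
    qed (use aT sum' in auto)
    moreover obtain e where "e \<in> E1" using \<open>k \<in> hd ` E'\<close> by (auto simp: E1_def)
    ultimately have "c (k # tl e) = 0" by blast
    then have "c e = 0" using \<open>e \<in> E1\<close> \<open>\<And>e. e \<in> E1 \<Longrightarrow> k # tl e = e\<close> by simp
    then show False using \<open>e \<in> E1\<close> by (simp add: E1_def E'_def)
  qed
qed

subsection \<open>Four polynomials in three variables are algebraically dependent\<close>

definition bounded_by :: "nat \<Rightarrow> 'a::comm_ring_1 poly3 \<Rightarrow> bool" where
  "bounded_by D p \<longleftrightarrow> (\<forall>m\<in>keys p. \<forall>i. lookup m i \<le> D)"

lemma bounded_by_mono: "bounded_by D p \<Longrightarrow> D \<le> D' \<Longrightarrow> bounded_by D' p"
  unfolding bounded_by_def by (meson order_trans)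

lemma bounded_by_mult: "bounded_by D p \<Longrightarrow> bounded_by D' r \<Longrightarrow> bounded_by (D + D') (p * r)"
  using keys_mult[of p r] by (fastforce simp: bounded_by_def lookup_add intro: add_mono)

lemma bounded_by_add: "bounded_by D p \<Longrightarrow> bounded_by D r \<Longrightarrow> bounded_by D (p + r)"
  using keys_add[of p r] by (auto simp: bounded_by_def)

lemma bounded_by_sum: "(\<And>x. x \<in> A \<Longrightarrow> bounded_by D (g x)) \<Longrightarrow> bounded_by D (sum g A)"
  by (induction A rule: infinite_finite_induct) (auto intro: bounded_by_add simp: bounded_by_def[of _ 0])

lemma bounded_by_Cst: "bounded_by 0 (Cst c)"
  by (auto simp: bounded_by_def Cst_def)

lemma bounded_by_power: "bounded_by D p \<Longrightarrow> bounded_by (k * D) (p ^ k)"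
proof (induction k)
  case 0
  show ?case using bounded_by_Cst[of 1] by (simp add: Cst_simps)
qed (auto dest: bounded_by_mult)

lemma bounded_by_exists: "\<exists>D. bounded_by D p"
proof (intro exI)
  show "bounded_by (\<Sum>m\<in>keys p. mdeg m) p"
    unfolding bounded_by_def
  proof (intro ballI allI)
    fix m i assume m: "m \<in> keys p"
    have "lookup m i \<le> mdeg m"
      unfolding mdeg_def by (rule member_le_sum) auto
    also have "\<dots> \<le> (\<Sum>m\<in>keys p. mdeg m)"
      by (rule member_le_sum) (use m in auto)
    finally show "lookup m i \<le> (\<Sum>m\<in>keys p. mdeg m)" .
  qed
qed

lemma bounded_by_list: "\<exists>D. \<forall>p\<in>set as. bounded_by D p"
proof (induction as)
  case (Cons p as)
  then obtain D where "\<forall>p\<in>set as. bounded_by D p" by blast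
  moreover obtain D' where "bounded_by D' p" using bounded_by_exists by blast
  ultimately have "bounded_by (max D D') r" if "r \<in> set (p # as)" for r
    using that bounded_by_mono[of D r "max D D'"] bounded_by_mono[of D' r "max D D'"] by auto
  then show ?case by blast
qed simp

lemma bounded_by_monl:
  "\<lbrakk>\<forall>p\<in>set as. bounded_by D p; set e \<subseteq> {..N}\<rbrakk> \<Longrightarrow> bounded_by (length as * (N * D)) (monl as e)"
proof (induction as e rule: monl.induct)
  case (1 a as e es)
  have "bounded_by (e * D) (a ^ e)" using 1 by (intro bounded_by_power) auto
  then have "bounded_by (N * D) (a ^ e)" using 1 by (auto elim!: bounded_by_mono)
  moreover have "bounded_by (length as * (N * D)) (monl as es)" using 1 by auto
  ultimately show ?case using bounded_by_mult by fastforce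
qed (use bounded_by_Cst[of 1] in \<open>auto simp: Cst_simps elim!: bounded_by_mono\<close>)

lemma card_bounded_by:
  "finite {p :: 'a::{field,finite} poly3. bounded_by D p}"
  "card {p :: 'a::{field,finite} poly3. bounded_by D p} \<le> CARD('a) ^ ((D + 1) ^ 3)"
proof -
  define M where "M = {m :: 3 \<Rightarrow>\<^sub>0 nat. \<forall>i. lookup m i \<le> D}"
  let ?t = "\<lambda>m :: 3 \<Rightarrow>\<^sub>0 nat. (lookup m 1, lookup m 2, lookup m 3)"
  have inj: "inj_on ?t M"
  proof (rule inj_onI)
    fix m n assume t: "?t m = ?t n"
    show "m = n"
    proof (rule poly_mapping_eqI)
      fix k show "lookup m k = lookup n k" using t exhaust_3[of k] by auto
    qed
  qed
  have sub: "?t ` M \<subseteq> {..D} \<times> {..D} \<times> {..D}" by (auto simp: M_def)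
  have M: "finite M" using inj sub by (meson finite_SigmaI finite_atMost finite_imageD finite_subset)
  have "card M \<le> card ({..D} \<times> {..D} \<times> {..D})"
    by (rule card_inj_on_le[OF inj sub]) simp
  then have cM: "card M \<le> (D + 1) ^ 3" by (simp add: card_cartesian_product power3_eq_cube algebra_simps)
  let ?B = "{p :: 'a poly3. bounded_by D p}" and ?r = "\<lambda>p :: 'a poly3. restrict (lookup p) M"
  have inj': "inj_on ?r ?B"
  proof (rule inj_onI)
    fix p r :: "'a poly3" assume p: "p \<in> ?B" "r \<in> ?B" and eq: "?r p = ?r r"
    show "p = r"
    proof (rule poly_mapping_eqI)
      fix m show "lookup p m = lookup r m"
      proof (cases "m \<in> M")
        case True
        then show ?thesis using fun_cong[OF eq, of m] by simp
      next
        case False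
        then have "m \<notin> keys p" "m \<notin> keys r"
          using p by (auto simp: bounded_by_def M_def)
        then show ?thesis by (simp add: in_keys_iff)
      qed
    qed
  qed
  have sub': "?r ` ?B \<subseteq> M \<rightarrow>\<^sub>E UNIV" by auto
  have fin: "finite (M \<rightarrow>\<^sub>E (UNIV :: 'a set))" by (rule finite_PiE) (use M in auto)
  show "finite ?B" using inj' sub' fin by (meson finite_imageD finite_subset)
  have "card ?B \<le> card (M \<rightarrow>\<^sub>E (UNIV :: 'a set))" by (rule card_inj_on_le[OF inj' sub' fin])
  also have "\<dots> = CARD('a) ^ card M" by (rule card_funcsetE[OF M])
  also have "\<dots> \<le> CARD('a) ^ ((D + 1) ^ 3)"
    using cM card_field_gt_1[where 'a = 'a] by (intro power_increasing) auto
  finally show "card ?B \<le> CARD('a) ^ ((D + 1) ^ 3)" .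
qed

text \<open>There are more coefficient families on the box of exponents up to N than polynomials
  that such combinations can reach, so two families collide; their difference is the
  relation.\<close>

lemma algebraic_relation:
  fixes as :: "'a::{field,finite} poly3 list"
  assumes len: "length as = 4"
  shows "\<exists>E c. finite E \<and> (\<forall>e\<in>E. length e = 4) \<and> (\<Sum>e\<in>E. Cst (c e) * monl as e) = 0 \<and> (\<exists>e\<in>E. c e \<noteq> 0)"
proof -
  obtain D where D: "\<forall>p\<in>set as. bounded_by D p" using bounded_by_list by blast
  \<comment> \<open>Chosen so that (4 N D + 1)^3 \<le> ((4 D + 1)(N + 1))^3 = N (N + 1)^3 < (N +
    1)^4.\<close>
  define N where "N = (4 * D + 1) ^ 3"
  define K where "K = 4 * (N * D)"
  define E where "E = {e :: nat list. set e \<subseteq> {..N} \<and> length e = 4}"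
  have E: "finite E" "card E = (N + 1) ^ 4"
    by (simp_all add: E_def finite_lists_length_eq card_lists_length_eq)
  define \<Phi> where "\<Phi> c = (\<Sum>e\<in>E. Cst (c e) * monl as e)" for c :: "nat list \<Rightarrow> 'a"
  have \<Phi>: "bounded_by K (\<Phi> c)" for c
    unfolding \<Phi>_def
  proof (rule bounded_by_sum)
    fix e assume "e \<in> E"
    then have "bounded_by K (monl as e)"
      using bounded_by_monl[OF D, of e N] by (simp add: E_def K_def len)
    then show "bounded_by K (Cst (c e) * monl as e)"
      using bounded_by_mult[OF bounded_by_Cst] by fastforce
  qed
  let ?F = "E \<rightarrow>\<^sub>E (UNIV :: 'a set)"
  have "\<not> inj_on \<Phi> ?F"
  proof
    assume inj: "inj_on \<Phi> ?F"
    have "CARD('a) ^ card E = card ?F" by (rule card_funcsetE[OF E(1), symmetric])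
    also have "\<dots> \<le> card {p :: 'a poly3. bounded_by K p}"
      by (rule card_inj_on_le[OF inj]) (use \<Phi> card_bounded_by in auto)
    also have "\<dots> \<le> CARD('a) ^ ((K + 1) ^ 3)" by (rule card_bounded_by)
    finally have "(N + 1) ^ 4 \<le> (K + 1) ^ 3"
      unfolding E(2) using card_field_gt_1[where 'a = 'a] by (simp add: power_increasing_iff)
    also have "\<dots> \<le> ((4 * D + 1) * (N + 1)) ^ 3"
      by (rule power_mono) (simp_all add: K_def algebra_simps)
    also have "\<dots> = N * (N + 1) ^ 3" unfolding power_mult_distrib N_def ..
    also have "\<dots> < (N + 1) * (N + 1) ^ 3" by simp
    also have "\<dots> = (N + 1) ^ 4" by (simp add: eval_nat_numeral)
    finally show False by simp
  qed
  then obtain c e where ce: "c \<in> ?F" "e \<in> ?F" "\<Phi> c = \<Phi> e" "c \<noteq> e" unfolding inj_on_def by blast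
  have "(\<Sum>x\<in>E. Cst (c x - e x) * monl as x) = \<Phi> c - \<Phi> e"
    by (simp add: \<Phi>_def Cst_simps left_diff_distrib sum_subtractf)
  moreover have "\<exists>x\<in>E. c x - e x \<noteq> 0"
    using PiE_ext[OF ce(1,2)] ce(4) by auto
  ultimately show ?thesis
    using E(1) ce(3) by (intro exI[of _ E] exI[of _ "\<lambda>x. c x - e x"]) (auto simp: E_def)
qed

lemma no_chain_of_length_4:
  fixes I :: "nat \<Rightarrow> 'a::{field,finite} poly3 set"
  assumes "subring_set T" "\<And>c. Cst c \<in> T" "set as \<subseteq> T" and len: "length as = 4"
    and "\<And>i x y. i \<le> 4 \<Longrightarrow> x \<in> I i \<Longrightarrow> y \<in> I i \<Longrightarrow> x - y \<in> I i"
    and "\<And>i x y. i \<le> 4 \<Longrightarrow> x \<in> I i \<Longrightarrow> y \<in> T \<Longrightarrow> x * y \<in> I i"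
    and "\<And>i. i < 4 \<Longrightarrow> I i \<subseteq> I (Suc i)"
    and "\<And>i. i < 4 \<Longrightarrow> as ! i \<in> I (Suc i)"
    and "\<And>i x. i < 4 \<Longrightarrow> x \<in> T \<Longrightarrow> as ! i * x \<in> I i \<Longrightarrow> x \<in> I i"
    and "\<And>c. Cst c \<in> I 4 \<Longrightarrow> c = 0" and "0 \<in> I 0"
  shows False
proof -
  obtain E and c :: "nat list \<Rightarrow> 'a" where E: "finite E" "\<forall>e\<in>E. length e = 4"
    "(\<Sum>e\<in>E. Cst (c e) * monl as e) = 0" "\<exists>e\<in>E. c e \<noteq> 0"
    using algebraic_relation[OF len] by blast
  have "\<forall>e\<in>E. c e = 0"
    by (rule chain_independent[of T as I]) (use assms E in auto)
  then show False using E(4) by blast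
qed

section \<open>Krull dimension of the ring of invariants\<close>

lemma krull_dim_surj:
  assumes h: "ring_hom_ring R S h" and R: "cring R" and surj: "h ` carrier R = carrier S"
  shows "krull_dim S \<le> krull_dim R"
  unfolding krull_dim_def
proof (rule Sup_subset_mono, rule subsetI)
  interpret h: ring_hom_ring R S h by (rule h)
  fix x assume "x \<in> {enat n |n. \<exists>P. (\<forall>i\<le>n. primeideal (P i) S) \<and> (\<forall>i<n. P i \<subset> P (Suc i))}"
  then obtain n P where n: "x = enat n" and P: "\<And>i. i \<le> n \<Longrightarrow> primeideal (P i) S" "\<And>i. i < n \<Longrightarrow> P i \<subset> P (Suc i)"
    by blast
  let ?P = "\<lambda>i. {r \<in> carrier R. h r \<in> P i}"
  have "primeideal (?P i) R" if "i \<le> n" for i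
    by (rule h.primeideal_vimage[OF R P(1)[OF that]])
  moreover have "?P i \<subset> ?P (Suc i)" if i: "i < n" for i
  proof -
    obtain y where y: "y \<in> P (Suc i)" "y \<notin> P i" using P(2)[OF i] by blast
    interpret p: primeideal "P (Suc i)" S using P(1)[of "Suc i"] i by simp
    obtain r where "r \<in> carrier R" "y = h r" using p.Icarr[OF y(1)] surj by blast
    then show ?thesis using y P(2)[OF i] by auto
  qed
  ultimately show "x \<in> {enat n |n. \<exists>P. (\<forall>i\<le>n. primeideal (P i) R) \<and> (\<forall>i<n. P i \<subset> P (Suc i))}"
    unfolding n mem_Collect_eq by (intro exI[of _ n] exI[of _ ?P] conjI allI impI refl)
qed

lemma krull_dim_iso:
  assumes "R \<simeq> S" "cring R" "cring S"
  shows "krull_dim R = krull_dim S"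
proof (rule antisym)
  have le: "krull_dim S' \<le> krull_dim R'" if "h \<in> ring_iso R' S'" "cring R'" "cring S'" for R' S' h
  proof (rule krull_dim_surj)
    show "ring_hom_ring R' S' h"
      using that by (intro ring_hom_ringI2) (auto simp: ring_iso_def cring_def)
    show "h ` carrier R' = carrier S'" using that(1) by (auto simp: ring_iso_def bij_betw_def)
  qed (rule that)
  obtain h where h: "h \<in> ring_iso R S" using assms(1) by (auto simp: is_ring_iso_def)
  show "krull_dim S \<le> krull_dim R" by (rule le[OF h assms(2,3)])
  show "krull_dim R \<le> krull_dim S"
    by (rule le[OF ring_iso_set_sym[OF _ h] assms(3,2)]) (use assms(2) in \<open>simp add: cring_def\<close>)
qed

text \<open>The contraction of the zero ideal of a domain; this supplies all the primes of the chain
  of length 3.\<close>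

lemma primeideal_kernel:
  fixes \<phi> :: "'a::field poly3 \<Rightarrow> 'b::idom"
  assumes "rhom \<phi>"
  shows "primeideal {p \<in> inv_polys. \<phi> p = 0} RG"
proof -
  let ?B = "ring_on (UNIV :: 'b set)"
  have cB: "cring ?B" by (rule cring_ring_on) (simp add: subring_set_def)
  have "domain ?B"
    by (rule domain.intro[OF cB], rule domain_axioms.intro) auto
  then have z: "primeideal {0} ?B" using domain.zeroprimeideal by fastforce
  have "ring_hom_ring RG ?B \<phi>"
    by (rule ring_hom_ringI2)
      (use cring_RG cB assms in \<open>auto simp: cring_def rhom_def intro!: ring_hom_memI\<close>)
  then show ?thesis
    using ring_hom_ring.primeideal_vimage[OF _ cring_RG z] by simp
qed

text \<open>The chain consists of 0 and the invariants vanishing on the plane x_1 = 0, on the line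
  x_1 = x_2 = 0, and at the origin. The invariants \<open>g\<close>, \<open>f1\<close> and
  \<open>f3\<close> witness strictness in turn.\<close>

lemma krull_dim_RG_ge:
  assumes q: "odd CARD('a::{field,finite})"
  shows "3 \<le> krull_dim (RG :: 'a poly3 ring)"
proof -
  let ?h = "\<lambda>c. [:[:c:]:] :: 'a poly poly"
  have h: "rhom ?h" using rhom_comp[OF rhom_const rhom_const, where 'c = 'a] by simp
  define \<phi> where "\<phi> = ins ?h (\<lambda>i. vector [0, [:0, 1:], [:[:0, 1:]:]] $ i)"
  have \<phi>: "rhom \<phi>" unfolding \<phi>_def by (rule rhom_ins[OF h])
  note \<phi>s = rhom_simps[OF \<phi>]
  have \<phi>X: "\<phi> (X 1) = 0" "\<phi> (X 2) = [:0, 1:]" "\<phi> (X 3) = [:[:0, 1:]:]" "\<phi> (Cst c) = [:[:c:]:]" for c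
    by (simp_all add: \<phi>_def ins_X ins_Cst h)
  have ev: "rhom (\<lambda>p. poly p (0 :: 'a poly))" "rhom (\<lambda>p. poly p (0 :: 'a))" by (auto intro!: rhomI)
  have \<phi>2: "rhom (\<lambda>p. poly (\<phi> p) 0)" by (rule rhom_comp[OF ev(1) \<phi>])
  have \<phi>3: "rhom (\<lambda>p. poly (poly (\<phi> p) 0) 0)" by (rule rhom_comp[OF ev(2) \<phi>2])
  define P where "P = (\<lambda>i::nat. if i = 0 then {p \<in> inv_polys. p = 0} else if i = 1 then {p \<in> inv_polys. \<phi> p = 0}
    else if i = 2 then {p \<in> inv_polys. poly (\<phi> p) 0 = 0} else {p \<in> inv_polys. poly (poly (\<phi> p) 0) 0 = 0})"
  have "primeideal (P i) RG" for i
    unfolding P_def using primeideal_kernel[OF rhom_id] primeideal_kernel[OF \<phi>] primeideal_kernel[OF \<phi>2]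
      primeideal_kernel[OF \<phi>3] by auto
  moreover have "P i \<subset> P (Suc i)" if "i < 3" for i
  proof -
    \<comment> \<open>On x_1 = 0 one has f_1 = - x_2^2 and f_2 = - 2 x_2^(q + 1). With 2 k = q + 1,
      which needs q odd, 2 (- 1)^k f_1^k cancels f_2.\<close>
    define k where "k = (CARD('a) + 1) div 2"
    have k: "2 * k = CARD('a) + 1" using q by (simp add: k_def)
    then have k2: "k \<ge> 2" using card_field_ge_3[OF q] by linarith
    define g :: "'a poly3" where "g = f2 + Cst (2 * (- 1) ^ k) * f1 ^ k"
    have gI: "g \<in> inv_polys" unfolding g_def by (intro inv_polys_add inv_polys_mult inv_polys_power inv_polys_Cst f1_inv f2_inv[OF q])
    have "\<phi> g = - 2 * [:0, 1:] ^ (2 * k) + [:[:2 * (- 1) ^ k:]:] * (- ([:0, 1:]\<^sup>2)) ^ k"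
      using card_field_gt_1[where 'a = 'a] by (simp add: g_def f2_def f1_def \<phi>s \<phi>X k power_0_left)
    also have "(- ([:0, 1:]\<^sup>2)) ^ k = (- 1) ^ k * ([:0, 1:] :: 'a poly poly) ^ (2 * k)"
      unfolding power_mult by (rule power_minus)
    also have "[:[:2 * (- 1) ^ k:]:] * ((- 1) ^ k * ([:0, 1:] :: 'a poly poly) ^ (2 * k)) = 2 * [:0, 1:] ^ (2 * k)"
    proof -
      have "[:[:2 * (- 1) ^ k:]:] = (2 * (- 1) ^ k :: 'a poly poly)"
        using rhom_mult[OF h, of 2 "(- 1) ^ k"] rhom_power[OF h, of "- 1" k] rhom_uminus[OF h, of 1] rhom_one[OF h] rhom_numeral[OF h, of "num.Bit0 num.One"]
        by simp
      moreover have "(- 1) ^ k * (- 1) ^ k = (1 :: 'a poly poly)" by (simp flip: power_mult_distrib)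
      ultimately show ?thesis by (simp add: mult.assoc flip: mult.assoc[of "(- 1) ^ k" "(- 1) ^ k"])
    qed
    finally have g0: "\<phi> g = 0" by simp
    have "g \<noteq> 0"
    proof
      assume "g = 0"
      \<comment> \<open>At (z, 0, 1) this is z^q + z + 2 (- 1)^k z^k, where z has coefficient 1
        because k and q exceed 1.\<close>
      let ?e = "ins (\<lambda>c. [:c:]) (\<lambda>i. vector [monom 1 1, 0, 1] $ i) :: 'a poly3 \<Rightarrow> 'a poly"
      note es = rhom_simps[OF rhom_ins[OF rhom_const]]
      have "?e g = monom 1 CARD('a) + monom 1 1 + [:2 * (- 1) ^ k:] * monom 1 k"
        by (simp add: g_def f2_def f1_def es ins_X ins_Cst rhom_const monom_power)
      then have "coeff (?e g) 1 = 1" using k2 card_field_ge_3[OF q] by simp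
      then show False using \<open>g = 0\<close> by (simp add: es)
    qed
    have f1: "\<phi> f1 \<noteq> 0" "poly (\<phi> f1) 0 = 0" by (simp_all add: f1_def \<phi>s \<phi>X)
    have f3: "poly (\<phi> f3) 0 = (\<Prod>(b, c)\<in>L. [:0, c::'a:])"
      by (simp add: f3_def \<phi>s \<phi>X split_def poly_prod)
    have "poly (\<phi> f3) 0 \<noteq> 0" unfolding f3 by (auto simp: L_def)
    moreover have "poly (poly (\<phi> f3) 0) 0 = 0"
      unfolding f3 using card_L_pos[OF q] by (auto simp: poly_prod split_def card_gt_0_iff)
    moreover have "poly (\<phi> (0 :: 'a poly3)) 0 = 0" by (simp add: \<phi>s)
    ultimately show ?thesis
      using that gI g0 \<open>g \<noteq> 0\<close> f1 f1_inv[where 'a = 'a] f3_inv[where 'a = 'a]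
      by (auto simp: P_def psubset_eq numeral_2_eq_2 less_Suc_eq eval_nat_numeral \<phi>s)
  qed
  ultimately have "enat 3 \<in> {enat n |n. \<exists>P. (\<forall>i\<le>n. primeideal (P i) (RG :: 'a poly3 ring)) \<and> (\<forall>i<n. P i \<subset> P (Suc i))}"
    unfolding mem_Collect_eq by (intro exI[of _ 3] exI[of _ P] conjI allI impI refl)
  then have "enat 3 \<le> krull_dim (RG :: 'a poly3 ring)" unfolding krull_dim_def by (rule Sup_upper)
  then show ?thesis by (simp add: numeral_eq_enat)
qed

text \<open>Elements picked from the successive differences of five primes are nonzerodivisors
  modulo the smaller prime, which is excluded by \<open>no_chain_of_length_4\<close>.\<close>

lemma krull_dim_RG_le: "krull_dim (RG :: 'a::{field,finite} poly3 ring) \<le> 3"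
  unfolding krull_dim_def
proof (rule Sup_least)
  fix x assume "x \<in> {enat n |n. \<exists>P. (\<forall>i\<le>n. primeideal (P i) (RG :: 'a poly3 ring)) \<and> (\<forall>i<n. P i \<subset> P (Suc i))}"
  then obtain n P where x: "x = enat n" and P: "\<And>i. i \<le> n \<Longrightarrow> primeideal (P i) (RG :: 'a poly3 ring)"
    "\<And>i. i < n \<Longrightarrow> P i \<subset> P (Suc i)" by blast
  have "n \<le> 3"
  proof (rule ccontr)
    assume "\<not> n \<le> 3"
    then have n: "4 \<le> n" by simp
    have "\<exists>a. a \<in> P (Suc i) \<and> a \<notin> P i" if "i < 4" for i using P(2)[of i] that n by auto
    then obtain a where a: "\<And>i. i < 4 \<Longrightarrow> a i \<in> P (Suc i) \<and> a i \<notin> P i" by metis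
    have P': "primeideal (P i) (RG :: 'a poly3 ring)" if "i \<le> 4" for i using P(1) n that by simp
    have aT: "a i \<in> inv_polys" if "i < 4" for i
    proof -
      interpret p: primeideal "P (Suc i)" "RG :: 'a poly3 ring" using P' that by simp
      show ?thesis using p.Icarr a[OF that] by simp
    qed
    let ?as = "map a [0..<4]"
    have nth: "?as ! i = a i" if "i < 4" for i using that by (subst nth_map) auto
    show False
    proof (rule no_chain_of_length_4[of inv_polys ?as P])
      show "set ?as \<subseteq> inv_polys" using aT by auto
      fix i :: nat and x y assume i: "i \<le> 4"
      interpret p: primeideal "P i" "RG :: 'a poly3 ring" using P'[OF i] .
      show "x - y \<in> P i" if "x \<in> P i" "y \<in> P i"
      proof -
        have "y \<in> inv_polys" using p.Icarr[OF that(2)] by simp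
        have "- 1 \<in> (inv_polys :: 'a poly3 set)" using subring_setD[OF subring_inv_polys] by blast
        then have "y * (- 1) \<in> P i" using p.I_r_closed[OF that(2), of "- 1"] by simp
        then show ?thesis using additive_subgroup.a_closed[OF p.additive_subgroup_axioms that(1), of "y * (- 1)"] by simp
      qed
      show "x * y \<in> P i" if "x \<in> P i" "y \<in> inv_polys"
        using p.I_r_closed[OF that(1), of y] that(2) by simp
    next
      fix i :: nat assume "i < 4"
      then show "P i \<subseteq> P (Suc i)" using P(2)[of i] n by auto
      show "?as ! i \<in> P (Suc i)" using a \<open>i < 4\<close> by (simp only: nth)
      fix x assume x: "x \<in> inv_polys" "?as ! i * x \<in> P i"
      interpret p: primeideal "P i" "RG :: 'a poly3 ring" using P' \<open>i < 4\<close> by simp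
      show "x \<in> P i" using p.I_prime[of "a i" x] x a[OF \<open>i < 4\<close>] aT[OF \<open>i < 4\<close>] by (auto simp only: nth[OF \<open>i < 4\<close>] RG_simps)
    next
      interpret p: primeideal "P 4" "RG :: 'a poly3 ring" using P' by simp
      fix c assume c: "Cst c \<in> P 4"
      show "c = 0"
      proof (rule ccontr)
        assume "c \<noteq> 0"
        then have "Cst c * Cst (1 / c) = 1" using Cst_simps(4)[of c "1 / c"] by (simp add: Cst_simps)
        then have "1 \<in> P 4" using p.I_r_closed[OF c, of "Cst (1 / c)"] inv_polys_Cst[of "1 / c"] by simp
        then have "x \<in> P 4" if "x \<in> inv_polys" for x using p.I_r_closed[of 1 x] that by simp
        then show False using p.I_notcarr p.Icarr by auto
      qed
    next
      interpret p: primeideal "P 0" "RG :: 'a poly3 ring" using P' by simp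
      show "0 \<in> P 0" using additive_subgroup.zero_closed[OF p.additive_subgroup_axioms] by simp
    qed (auto simp: subring_inv_polys inv_polys_Cst)
  qed
  then show "x \<le> 3" by (simp add: x numeral_eq_enat)
qed

text \<open>The form 1 is invariant, so the annihilator is 0 and the dimension is that of
  R^G.\<close>

lemma module_dim_OmegaG:
  assumes q: "odd CARD('a::{field,finite})"
  shows "module_dim RG (OmegaG :: ('a poly3, 'a form) module) = 3"
proof -
  have s: "scalar 1 \<in> (inv_forms :: 'a form set)" using gens_inv[OF q] by (simp add: gens_def)
  have "annihilator RG (OmegaG :: ('a poly3, 'a form) module) = {\<zero>\<^bsub>RG\<^esub>}"
  proof -
    have "f = 0" if "f *s scalar 1 = (0 :: 'a form)" for f
      using arg_cong[OF that, of "\<lambda>\<omega>. \<omega> $ {}"] by (simp add: scalar_component)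
    moreover have "0 \<in> (inv_polys :: 'a poly3 set)" using subring_setD[OF subring_inv_polys] by blast
    ultimately show ?thesis unfolding annihilator_def using s by auto
  qed
  moreover have "krull_dim ((RG :: 'a poly3 ring) Quot {\<zero>\<^bsub>RG\<^esub>}) = krull_dim (RG :: 'a poly3 ring)"
  proof (rule krull_dim_iso)
    interpret R: cring "RG :: 'a poly3 ring" by (rule cring_RG)
    show "(RG :: 'a poly3 ring) Quot {\<zero>\<^bsub>RG\<^esub>} \<simeq> (RG :: 'a poly3 ring)" by (rule R.FactRing_zeroideal)
    show "cring ((RG :: 'a poly3 ring) Quot {\<zero>\<^bsub>RG :: 'a poly3 ring\<^esub>})"
      by (rule ideal.quotient_is_cring[OF R.zeroideal cring_RG])
  qed (rule cring_RG)
  ultimately show ?thesis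
    unfolding module_dim_def using antisym[OF krull_dim_RG_le krull_dim_RG_ge[OF q]] by simp
qed

section \<open>Depth\<close>

lemma lookup_0_eq_ins: "lookup p 0 = ins (\<lambda>c. c) (\<lambda>i. 0) p"
proof (induction p rule: poly3_induct)
  case (single m c)
  have "mon (\<lambda>i. 0 :: 'a) m = (if m = 0 then 1 else 0)"
  proof (cases "m = 0")
    case False
    then obtain i where "lookup m i \<noteq> 0" by (metis lookup_zero poly_mapping_eqI)
    then have "mon (\<lambda>i. 0 :: 'a) m = 0"
      using exhaust_3[of i] by (auto simp: mon_def prod_3 power_0_left)
    then show ?thesis using False by simp
  qed simp
  then show ?case by (auto simp: ins_single rhom_id lookup_single when_def)
qed (simp add: lookup_add ins_add rhom_id)

lemma lookup_0_mult: "lookup (p * r :: 'a::comm_ring_1 poly3) 0 = lookup p 0 * lookup r 0"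
  by (simp add: lookup_0_eq_ins ins_mult rhom_id)

lemma lookup_Cst_0: "lookup (Cst c) 0 = c"
  by (simp add: Cst_def)

section \<open>The upper bound for the depth\<close>

lemma seq_times_OmegaG:
  assumes q: "odd CARD('a::{field,finite})" and as: "set as \<subseteq> (inv_polys :: 'a poly3 set)"
  shows "seq_times as OmegaG = {(\<Sum>i<length as. (as ! i) *s m i) | m. \<forall>i<length as. m i \<in> inv_forms}"
proof -
  have eq: "(\<Oplus>\<^bsub>OmegaG\<^esub>i\<in>{..<length as}. (as ! i) \<odot>\<^bsub>OmegaG\<^esub> m i) = (\<Sum>i<length as. (as ! i) *s m i)"
    if "\<forall>i<length as. m i \<in> inv_forms" for m
    unfolding OmegaG_simps
    by (rule finsum_OmegaG[OF q]) (use that as nth_mem in \<open>auto intro!: inv_forms_smult[OF q]\<close>)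
  show ?thesis
    unfolding seq_times_def OmegaG_simps(1)
  proof (intro Collect_cong iff_exI)
    fix \<eta> and m :: "nat \<Rightarrow> 'a form"
    show "(\<eta> = (\<Oplus>\<^bsub>OmegaG\<^esub>i\<in>{..<length as}. (as ! i) \<odot>\<^bsub>OmegaG\<^esub> m i) \<and> (\<forall>i<length as. m i \<in> inv_forms)) =
      (\<eta> = (\<Sum>i<length as. (as ! i) *s m i) \<and> (\<forall>i<length as. m i \<in> inv_forms))"
    proof (cases "\<forall>i<length as. m i \<in> inv_forms")
      case True
      show ?thesis unfolding eq[OF True] ..
    qed blast
  qed
qed

lemma seq_times_OmegaGI:
  assumes q: "odd CARD('a::{field,finite})" and as: "set as \<subseteq> (inv_polys :: 'a poly3 set)"
    and "\<omega> = (\<Sum>i<length as. (as ! i) *s m i)" "\<And>i. m i \<in> inv_forms"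
  shows "\<omega> \<in> seq_times as OmegaG"
  unfolding seq_times_OmegaG[OF q as] mem_Collect_eq using assms(3,4) by (intro exI[of _ m]) simp

lemma scalar_inv:
  assumes q: "odd CARD('a::{field,finite})"
  shows "f \<in> inv_polys \<Longrightarrow> scalar f \<in> (inv_forms :: 'a form set)"
  by (simp add: inv_forms_iff[OF q] scalar_component v_scalar inv_vecs_0 subring_setD[OF subring_inv_polys])

text \<open>Regularity on invariant forms passes to the summand R^G of 0-forms. The ideals generated
  by initial segments of the sequence then form a forbidden chain; they contain no nonzero constant,
  since the sequence has zero constant terms.\<close>

lemma depth_le:
  assumes q: "odd CARD('a::{field,finite})"
  shows "depth RG_plus (OmegaG :: ('a poly3, 'a form) module) \<le> 3"
  unfolding depth_def
proof (rule Sup_least)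
  fix x assume "x \<in> {enat (length as) |as. set as \<subseteq> RG_plus \<and> regular_sequence as (OmegaG :: ('a poly3, 'a form) module)}"
  then obtain as where x: "x = enat (length as)" and as: "set as \<subseteq> (RG_plus :: 'a poly3 set)"
    and reg: "regular_sequence as (OmegaG :: ('a poly3, 'a form) module)" by blast
  have asI: "set as \<subseteq> inv_polys" using as by (auto simp: RG_plus_def)
  note S = subring_setD[OF subring_inv_polys]
  have "length as \<le> 3"
  proof (rule ccontr)
    assume "\<not> length as \<le> 3"
    then have len: "4 \<le> length as" by simp
    have aI: "as ! i \<in> inv_polys" "lookup (as ! i) 0 = 0" if "i < 4" for i
    proof -
      have "as ! i \<in> set as" using that len by simp
      then have "as ! i \<in> RG_plus" using as by blast
      then show "as ! i \<in> inv_polys" "lookup (as ! i) 0 = 0" by (auto simp: RG_plus_def)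
    qed
    define I where "I i = {\<Sum>j<i. as ! j * y j | y. \<forall>j. y j \<in> inv_polys}" for i :: nat
    have II: "x \<in> I i" if "x = (\<Sum>j<i. as ! j * y j)" "\<And>j. y j \<in> inv_polys" for x y i
      unfolding I_def mem_Collect_eq using that by (intro exI[of _ y]) simp
    show False
    proof (rule no_chain_of_length_4[of inv_polys "take 4 as" I])
      show "set (take 4 as) \<subseteq> inv_polys" using asI set_take_subset by fast
      show "length (take 4 as) = 4" using len by simp
      show "x - y \<in> I i" if xy: "x \<in> I i" "y \<in> I i" for i x y
      proof -
        from xy obtain u v where "x = (\<Sum>j<i. as ! j * u j)" "y = (\<Sum>j<i. as ! j * v j)"
          "\<forall>j. u j \<in> inv_polys" "\<forall>j. v j \<in> inv_polys" by (auto simp: I_def)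
        then show ?thesis
          by (intro II[where y = "\<lambda>j. u j - v j"]) (simp_all add: sum_subtractf right_diff_distrib inv_polys_diff)
      qed
      show "x * y \<in> I i" if xy: "x \<in> I i" "y \<in> inv_polys" for i x y
      proof -
        from xy obtain u where "x = (\<Sum>j<i. as ! j * u j)" "\<forall>j. u j \<in> inv_polys" by (auto simp: I_def)
        then show ?thesis
          using xy(2) by (intro II[where y = "\<lambda>j. u j * y"]) (simp_all add: sum_distrib_right mult.assoc inv_polys_mult)
      qed
      show "I i \<subseteq> I (Suc i)" for i
      proof
        fix x assume "x \<in> I i"
        then obtain u where "x = (\<Sum>j<i. as ! j * u j)" "\<forall>j. u j \<in> inv_polys" by (auto simp: I_def)
        then show "x \<in> I (Suc i)"
          by (intro II[where y = "u(i := 0)"]) (simp_all add: S)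
      qed
      show "take 4 as ! i \<in> I (Suc i)" if "i < 4" for i
      proof -
        have "as ! i \<in> I (Suc i)"
          by (rule II[where y = "(\<lambda>j. 0)(i := 1)"]) (simp_all add: S)
        then show ?thesis using that by simp
      qed
      show "x \<in> I i" if i: "i < 4" and x: "x \<in> inv_polys" "take 4 as ! i * x \<in> I i" for i x
      proof -
        have iM: "scalar f \<in> (inv_forms :: 'a form set)" if "f \<in> inv_polys" for f
          using that by (rule scalar_inv[OF q])
        have tk: "set (take i as) \<subseteq> inv_polys" using asI set_take_subset by fast
        obtain u where u: "as ! i * x = (\<Sum>j<i. as ! j * u j)" "\<forall>j. u j \<in> inv_polys"
          using x i by (auto simp: I_def)
        have "(as ! i) *s scalar x = (\<Sum>j<i. (as ! j) *s scalar (u j))"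
          unfolding vec_eq_iff using u(1) by (auto simp: scalar_def axis_def sum_component intro!: sum.neutral[symmetric])
        then have "(as ! i) *s scalar x = (\<Sum>j<length (take i as). (take i as ! j) *s scalar (u j))"
          using i len by simp
        then have "(as ! i) *s scalar x \<in> seq_times (take i as) OmegaG"
          by (rule seq_times_OmegaGI[OF q tk]) (use iM u(2) in auto)
        then have "scalar x \<in> seq_times (take i as) OmegaG"
          using reg i len iM[OF x(1)] unfolding regular_sequence_def by simp
        then obtain m where "scalar x = (\<Sum>j<length (take i as). (take i as ! j) *s m j)"
          "\<forall>j<length (take i as). m j \<in> inv_forms"
          unfolding seq_times_OmegaG[OF q tk] by blast
        moreover have "length (take i as) = i" using i len by simp
        ultimately have m: "scalar x = (\<Sum>j<i. (as ! j) *s m j)" "\<forall>j<i. m j \<in> inv_forms" by simp_all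
        \<comment> \<open>The 0-form components of the coefficients show that x already lies in the
          ideal of R^G; beyond i they are set to 0 to stay invariant.\<close>
        define y where "y = (\<lambda>j. if j < i then m j $ {} else 0)"
        have "x = scalar x $ {}" by (simp add: scalar_component)
        also have "\<dots> = (\<Sum>j<i. as ! j * y j)" unfolding m(1) by (simp add: y_def)
        finally have "x = (\<Sum>j<i. as ! j * y j)" .
        moreover have "y j \<in> inv_polys" for j
          using m(2) by (simp add: y_def S inv_forms_iff[OF q])
        ultimately show ?thesis by (rule II)
      qed
      show "c = 0" if c: "Cst c \<in> I 4" for c
      proof -
        obtain y where "Cst c = (\<Sum>j<4. as ! j * y j)" using c by (auto simp: I_def)
        then have "c = lookup (\<Sum>j<4. as ! j * y j) 0" by (metis lookup_Cst_0)
        then show ?thesis by (simp add: lookup_sum lookup_0_mult aI)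
      qed
      show "0 \<in> I 0" by (rule II[where y = "\<lambda>_. 0"]) (simp_all add: S)
    qed (simp_all add: subring_inv_polys inv_polys_Cst)
  qed
  then show "x \<le> 3" by (simp add: x numeral_eq_enat)
qed

subsection \<open>The regular sequence \<open>f\<^sub>1, f\<^sub>2, f\<^sub>3\<close>\<close>

text \<open>Algebraic independence from \<open>chain_independent\<close>, with the ideals of
  polynomials that are 0, vanish on the cone, vanish on its line t = 0, vanish at the origin. Each
  of \<open>f1\<close>, \<open>f2\<close>, \<open>f3\<close> lies in the next ideal but not in the
  one before.\<close>

lemma subst_f123_inj:
  fixes P :: "'a::{field,finite} poly3"
  assumes q: "odd CARD('a)" and 0: "subst f123 P = 0"
  shows "P = 0"
proof -
  let ?h = "\<lambda>c. [:[:c:]:] :: 'a poly poly"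
  have h: "rhom ?h" using rhom_comp[OF rhom_const rhom_const, where 'c = 'a] by simp
  let ?s = "[:[:0, 1:]:] :: 'a poly poly" and ?t = "[:0, 1:] :: 'a poly poly"
  define \<phi> where "\<phi> = ins ?h (\<lambda>i. vector [?s * ?s, ?s * ?t, ?t * ?t] $ i)"
  have \<phi>: "rhom \<phi>" unfolding \<phi>_def by (rule rhom_ins[OF h])
  note \<phi>s = rhom_simps[OF \<phi>]
  have \<phi>X: "\<phi> (X 1) = ?s * ?s" "\<phi> (X 2) = ?s * ?t" "\<phi> (X 3) = ?t * ?t" "\<phi> (Cst c) = [:[:c:]:]" for c
    unfolding \<phi>_def ins_X[OF h] ins_Cst[OF h] vector_3 by (rule refl)+
  have ev: "rhom (\<lambda>p. poly p (x :: 'a poly))" "rhom (\<lambda>p. poly p (y :: 'a))" for x y by (auto intro!: rhomI)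
  \<comment> \<open>Both parameters of the cone are kept so that t = 0 makes sense; t = 1 gives back
    \<open>cone\<close>, where \<open>f2\<close> is known to be nonzero.\<close>
  have \<phi>1: "poly (\<phi> p) 1 = cone p" for p
  proof (rule rhom_ext[OF rhom_comp[OF ev(1) \<phi>] rhom_cone])
    show "poly (\<phi> (X i)) 1 = cone (X i)" for i
      using exhaust_3[of i] by (auto simp: \<phi>X monom_altdef power2_eq_square)
  qed (simp add: \<phi>X)
  define I where "I = (\<lambda>i::nat. if i = 0 then {0} else if i = 1 then {p. \<phi> p = 0}
    else if i = 2 then {p. poly (\<phi> p) 0 = 0} else {p. poly (poly (\<phi> p) 0) 0 = 0})"
  let ?as = "[f1, f2, f3] :: 'a poly3 list"
  have f1: "\<phi> f1 = 0" by (simp only: f1_def \<phi>s \<phi>X power2_eq_square) (simp only: ac_simps diff_self)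
  have "cone (f2 :: 'a poly3) \<noteq> 0" using upoly_neq_0[where 'a = 'a] by (simp add: cone_f2)
  then have f2: "\<phi> f2 \<noteq> 0" using \<phi>1[of f2] by auto
  have f2': "poly (\<phi> f2) 0 = 0"
    using card_field_gt_1[where 'a = 'a] by (simp add: f2_def \<phi>s \<phi>X poly_power power_0_left)
  have f3: "poly (\<phi> f3) 0 = (\<Prod>x\<in>(L :: ('a \<times> 'a) set). [:0, 0, 1:])"
    by (simp add: f3_def \<phi>s \<phi>X split_def poly_prod)
  have f3': "poly (\<phi> f3) 0 \<noteq> 0" "poly (poly (\<phi> f3) 0) 0 = 0"
    unfolding f3 using card_L_pos[OF q] by (auto simp: poly_prod card_gt_0_iff)
  let ?e = "\<lambda>m :: 3 \<Rightarrow>\<^sub>0 nat. [lookup m 1, lookup m 2, lookup m 3]"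
  have inj: "inj_on ?e A" for A
  proof (rule inj_onI)
    fix m n assume t: "?e m = ?e n"
    show "m = n"
    proof (rule poly_mapping_eqI)
      fix k show "lookup m k = lookup n k" using t exhaust_3[of k] by auto
    qed
  qed
  define c where "c = (\<lambda>e. lookup P (the_inv_into UNIV ?e e))"
  have c: "c (?e m) = lookup P m" for m
    by (simp add: c_def the_inv_into_f_f[OF inj])
  have "subst f123 P = (\<Sum>m\<in>keys P. Cst (c (?e m)) * monl ?as (?e m))"
    unfolding subst_eq_ins ins_def c by (simp add: mon_def prod_3 f123_simps mult.assoc)
  also have "\<dots> = (\<Sum>e\<in>?e ` keys P. Cst (c e) * monl ?as e)"
    by (subst sum.reindex[OF inj]) simp
  finally have sum: "(\<Sum>e\<in>?e ` keys P. Cst (c e) * monl ?as e) = 0" using 0 by simp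
  have less3: "i = 0 \<or> i = 1 \<or> i = 2" if "i < 3" for i :: nat using that by linarith
  have "\<forall>e\<in>?e ` keys P. c e = 0"
  proof (rule chain_independent[of UNIV ?as I])
    show "x - y \<in> I i" if "x \<in> I i" "y \<in> I i" for i x y
      using that by (auto simp: I_def \<phi>s split: if_splits)
    show "x * y \<in> I i" if "x \<in> I i" for i x y
      using that by (auto simp: I_def \<phi>s split: if_splits)
    show "I i \<subseteq> I (Suc i)" if "i < length ?as" for i
      using less3[of i] that by (auto simp: I_def \<phi>s)
    show "?as ! i \<in> I (Suc i)" if "i < length ?as" for i
      using less3[of i] that f1 f2' f3' by (auto simp: I_def)
    show "x \<in> I i" if "i < length ?as" "?as ! i * x \<in> I i" for i x
      using less3[of i] that f2 f3' f1_neq_0[where 'a = 'a] by (auto simp: I_def \<phi>s)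
    show "c = 0" if "Cst c \<in> I (length ?as)" for c
      using that by (simp add: I_def \<phi>X)
    show "(\<Sum>e\<in>?e ` keys P. Cst (c e) * monl ?as e) \<in> I 0"
      using sum by (simp add: I_def)
  qed (auto simp: subring_set_def)
  then have "lookup P m = 0" if "m \<in> keys P" for m
    using c that by fastforce
  then show ?thesis by (intro poly_mapping_eqI) (auto simp: in_keys_iff)
qed

text \<open>A polynomial that vanishes on x_1 = 0 is a multiple of x_1; with its analogue for x_1 =
  x_2 = 0 this makes the variables a regular sequence.\<close>

lemma subst_kill_X1: "\<exists>y. p - subst (\<lambda>i. if i = 1 then 0 else X i) p = X 1 * y"
proof (induction p rule: poly3_ring_induct)
  case (Cst c)
  show ?case by (intro exI[of _ 0]) simp
next
  case (X i)
  show ?case by (intro exI[of _ "if i = 1 then 1 else 0"]) auto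
next
  case (add p r)
  let ?k = "subst (\<lambda>i. if i = 1 then 0 else X i)"
  from add obtain y z where yz: "p - ?k p = X 1 * y" "r - ?k r = X 1 * z" by blast
  have "p + r - ?k (p + r) = (p - ?k p) + (r - ?k r)" by (simp add: subst_simps)
  also have "\<dots> = X 1 * (y + z)" unfolding yz by (simp add: algebra_simps)
  finally show ?case by blast
next
  case (mult p r)
  let ?k = "subst (\<lambda>i. if i = 1 then 0 else X i)"
  from mult obtain y z where yz: "p - ?k p = X 1 * y" "r - ?k r = X 1 * z" by blast
  have "p * r - ?k (p * r) = (p - ?k p) * r + ?k p * (r - ?k r)" by (simp add: subst_simps algebra_simps)
  also have "\<dots> = X 1 * (y * r + ?k p * z)" unfolding yz by (simp add: algebra_simps)
  finally show ?case by blast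
qed

lemma subst_kill_X12: "\<exists>y z. p - subst (\<lambda>i. if i = 3 then X i else 0) p = X 1 * y + X 2 * z"
proof (induction p rule: poly3_ring_induct)
  case (Cst c)
  show ?case by (intro exI[of _ 0]) simp
next
  case (X i)
  show ?case
    using exhaust_3[of i] by (intro exI[of _ "if i = 1 then 1 else 0"] exI[of _ "if i = 2 then 1 else 0"]) auto
next
  case (add p r)
  let ?k = "subst (\<lambda>i. if i = 3 then X i else 0)"
  from add obtain y z y' z' where yz: "p - ?k p = X 1 * y + X 2 * z" "r - ?k r = X 1 * y' + X 2 * z'" by blast
  have "p + r - ?k (p + r) = (p - ?k p) + (r - ?k r)" by (simp add: subst_simps)
  also have "\<dots> = X 1 * (y + y') + X 2 * (z + z')" unfolding yz by (simp add: algebra_simps)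
  finally show ?case by blast
next
  case (mult p r)
  let ?k = "subst (\<lambda>i. if i = 3 then X i else 0)"
  from mult obtain y z y' z' where yz: "p - ?k p = X 1 * y + X 2 * z" "r - ?k r = X 1 * y' + X 2 * z'" by blast
  have "p * r - ?k (p * r) = (p - ?k p) * r + ?k p * (r - ?k r)" by (simp add: subst_simps algebra_simps)
  also have "\<dots> = X 1 * (y * r + ?k p * y') + X 2 * (z * r + ?k p * z')"
    unfolding yz by (simp add: algebra_simps)
  finally show ?case by blast
qed

text \<open>By algebraic independence the relation can be read in the polynomial ring, with the
  variables in place of \<open>f1\<close>, \<open>f2\<close>, \<open>f3\<close>. Setting the earlier
  variables to 0 kills the right-hand side, and the remaining variable cancels.\<close>

lemma Aset_regular:
  fixes a :: "'a::{field,finite} poly3"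
  assumes q: "odd CARD('a)" and i: "i < 3" and a: "a \<in> Aset" and b: "\<And>j. j < i \<Longrightarrow> b j \<in> Aset"
    and eq: "[f1, f2, f3] ! i * a = (\<Sum>j<i. [f1, f2, f3] ! j * b j)"
  shows "\<exists>y. (\<forall>j. y j \<in> Aset) \<and> a = (\<Sum>j<i. [f1, f2, f3] ! j * y j)"
proof -
  let ?S = "subst f123 :: 'a poly3 \<Rightarrow> 'a poly3"
  have S_inj: "p = r" if "?S p = ?S r" for p r
    using subst_f123_inj[OF q, of "p - r"] that by (simp add: subst_simps)
  have SA: "?S p \<in> Aset" for p by (simp add: Aset_def)
  obtain p where p: "a = ?S p" using a by (auto simp: Aset_def)
  consider "i = 0" | "i = 1" | "i = 2" using i by linarith
  then show ?thesis
  proof cases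
    case 1
    then have "a = 0" using eq f1_neq_0[where 'a = 'a] by simp
    then show ?thesis using 1 by (intro exI[of _ "\<lambda>j. 0"]) (simp add: Aset_0)
  next
    case 2
    obtain r where "b 0 = ?S r" using b[of 0] 2 by (auto simp: Aset_def)
    then have "?S (X 2 * p) = ?S (X 1 * r)" using eq 2 by (simp add: subst_simps f123_simps p)
    then have "X 2 * p = X 1 * r" by (rule S_inj)
    from arg_cong[OF this, of "subst (\<lambda>i. if i = 1 then 0 else X i)"]
    have "subst (\<lambda>i. if i = 1 then 0 else X i) p = 0" by (simp add: subst_simps X_neq_0)
    then obtain y where "p = X 1 * y" using subst_kill_X1[of p] by auto
    then have "a = f1 * ?S y" by (simp add: p subst_simps f123_simps)
    then show ?thesis using 2 SA by (intro exI[of _ "\<lambda>j. ?S y"]) simp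
  next
    case 3
    obtain r r' where "b 0 = ?S r" "b 1 = ?S r'" using b[of 0] b[of 1] 3 by (auto simp: Aset_def)
    then have "?S (X 3 * p) = ?S (X 1 * r + X 2 * r')"
      using eq 3 by (simp add: subst_simps f123_simps p numeral_2_eq_2)
    then have "X 3 * p = X 1 * r + X 2 * r'" by (rule S_inj)
    from arg_cong[OF this, of "subst (\<lambda>i. if i = 3 then X i else 0)"]
    have "subst (\<lambda>i. if i = 3 then X i else 0) p = 0" by (simp add: subst_simps X_neq_0)
    then obtain y z where "p = X 1 * y + X 2 * z" using subst_kill_X12[of p] by auto
    then have "a = f1 * ?S y + f2 * ?S z" by (simp add: p subst_simps f123_simps)
    then show ?thesis
      using 3 SA by (intro exI[of _ "\<lambda>j. if j = 0 then ?S y else ?S z"]) (simp add: numeral_2_eq_2)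
  qed
qed

lemma lin_smult: "lin (\<lambda>k. a * c k) = a *s lin c"
  by (simp add: lin_def vec_eq_iff sum_distrib_left mult.assoc)

lemma lin_sum: "lin (\<lambda>k. \<Sum>j\<in>J. c j k) = (\<Sum>j\<in>J. lin (c j))"
proof -
  have "lin (\<lambda>k. \<Sum>j\<in>J. c j k) = (\<Sum>i<16. \<Sum>j\<in>J. c j i *s gens ! i)"
    unfolding lin_def by (simp add: vec_eq_iff sum_distrib_right)
  also have "\<dots> = (\<Sum>j\<in>J. lin (c j))"
    unfolding lin_def by (rule sum.swap)
  finally show ?thesis .
qed

lemma lin_inv:
  assumes q: "odd CARD('a::{field,finite})" and "\<And>i. i < 16 \<Longrightarrow> c i \<in> (inv_polys :: 'a poly3 set)"
  shows "lin c \<in> inv_forms"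
  unfolding lin_def
proof (rule inv_forms_sum[OF q])
  fix i :: nat assume "i \<in> {..<16}"
  then show "c i *s gens ! i \<in> inv_forms"
    using gens_inv[OF q] nth_mem[of i gens] assms(2) by (auto simp: length_gens intro!: inv_forms_smult[OF q])
qed

lemma lookup_f_0:
  assumes q: "odd CARD('a::{field,finite})"
  shows "lookup (f1 :: 'a poly3) 0 = 0" "lookup (f2 :: 'a poly3) 0 = 0"
    "lookup (f3 :: 'a poly3) 0 = 0"
proof -
  have "lookup f 0 = 0" if "homog n f" "n > 0" for n and f :: "'a poly3"
    using that mdeg_zero by (metis homog_def in_keys_iff less_irrefl)
  then show "lookup (f1 :: 'a poly3) 0 = 0" "lookup (f2 :: 'a poly3) 0 = 0"
    "lookup (f3 :: 'a poly3) 0 = 0"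
    using homog_f1[where 'a = 'a] homog_f2[where 'a = 'a] homog_f3[where 'a = 'a] card_L_pos[OF q] by auto
qed

text \<open>Coordinates in the free basis are unique, so regularity over the algebra carries over
  coordinate by coordinate. The quotient is nonzero because the 0-form 1 has constant term 1 and the
  three invariants have none.\<close>

lemma regular_f123:
  assumes q: "odd CARD('a::{field,finite})"
  shows "regular_sequence [f1, f2, f3] (OmegaG :: ('a poly3, 'a form) module)"
  unfolding regular_sequence_def
proof (intro conjI allI impI ballI)
  let ?as = "[f1, f2, f3] :: 'a poly3 list"
  have asI: "set ?as \<subseteq> inv_polys" by (simp add: f1_inv f2_inv[OF q] f3_inv)
  have asA: "?as ! j \<in> Aset" if "j < 3" for j
    using that Aset_f by (auto simp: less_Suc_eq eval_nat_numeral)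
  show "seq_times ?as OmegaG \<noteq> carrier (OmegaG :: ('a poly3, 'a form) module)"
  proof
    assume "seq_times ?as OmegaG = carrier (OmegaG :: ('a poly3, 'a form) module)"
    moreover have "scalar 1 \<in> (inv_forms :: 'a form set)" using gens_inv[OF q] by (simp add: gens_def)
    ultimately have "scalar 1 \<in> seq_times ?as (OmegaG :: ('a poly3, 'a form) module)" by simp
    then obtain m where "scalar 1 = (\<Sum>i<length ?as. (?as ! i) *s m i)"
      unfolding seq_times_OmegaG[OF q asI] by blast
    then have e: "scalar 1 = f1 *s m 0 + (f2 *s m (Suc 0) + f3 *s m (Suc (Suc 0)))" by simp
    have "1 = f1 * m 0 $ {} + (f2 * m (Suc 0) $ {} + f3 * m (Suc (Suc 0)) $ {})"
      using arg_cong[OF e, of "\<lambda>\<omega>. \<omega> $ {}"] by (simp add: scalar_component)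
    from arg_cong[OF this, of "\<lambda>p. lookup p 0"] have "lookup (1 :: 'a poly3) 0 = 0"
      by (simp only: lookup_add lookup_0_mult lookup_f_0[OF q] mult_zero_left add_0)
    then show False by simp
  qed
  fix i and \<omega> :: "'a form"
  assume i: "i < length ?as" and \<omega>: "\<omega> \<in> carrier OmegaG"
    and mem: "(?as ! i) \<odot>\<^bsub>OmegaG\<^esub> \<omega> \<in> seq_times (take i ?as) OmegaG"
  have i3: "i < 3" using i by simp
  have tk: "set (take i ?as) \<subseteq> inv_polys" "length (take i ?as) = i" using asI set_take_subset[of i ?as] i by auto
  obtain m where "(?as ! i) *s \<omega> = (\<Sum>j<i. (take i ?as ! j) *s m j)" and mI: "\<forall>j<i. m j \<in> inv_forms"
    using mem unfolding OmegaG_simps(4) seq_times_OmegaG[OF q tk(1)] tk(2) by blast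
  then have m: "(?as ! i) *s \<omega> = (\<Sum>j<i. (?as ! j) *s m j)" "\<forall>j<i. m j \<in> inv_forms"
    by simp_all
  obtain c where c: "\<forall>k<16. c k \<in> Aset" "\<omega> = lin c" using lin_exists[OF q, of \<omega>] \<omega> by auto
  have "\<forall>j<i. \<exists>e. (\<forall>k<16. e k \<in> Aset) \<and> m j = lin e" using lin_exists[OF q] m(2) by blast
  then obtain e where e: "\<forall>j<i. (\<forall>k<16. e j k \<in> Aset) \<and> m j = lin (e j)" by metis
  have "(\<Sum>j<i. (?as ! j) *s m j) = lin (\<lambda>k. \<Sum>j<i. ?as ! j * e j k)"
    unfolding lin_sum lin_smult using e by (intro sum.cong) auto
  then have "lin (\<lambda>k. ?as ! i * c k - (\<Sum>j<i. ?as ! j * e j k)) = 0"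
    unfolding lin_diff lin_smult using m(1) c(2) by simp
  then have "?as ! i * c k - (\<Sum>j<i. ?as ! j * e j k) = 0" if "k < 16" for k
  proof (rule lin_eq_0[OF q _ _ that, rotated])
    fix k :: nat assume "k < 16"
    then show "?as ! i * c k - (\<Sum>j<i. ?as ! j * e j k) \<in> Aset"
      using c(1) e i3 by (intro Aset_diff Aset_mult Aset_sum asA) auto
  qed
  then have eq: "?as ! i * c k = (\<Sum>j<i. ?as ! j * e j k)" if "k < 16" for k using that by simp
  have "\<exists>y. (\<forall>j. y j \<in> Aset) \<and> c k = (\<Sum>j<i. ?as ! j * y j)" if "k < 16" for k
    by (rule Aset_regular[OF q i3 _ _ eq[OF that]]) (use c(1) e that in auto)
  then have "\<forall>k\<in>{..<16}. \<exists>y. (\<forall>j. y j \<in> Aset) \<and> c k = (\<Sum>j<i. ?as ! j * y j)" by simp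
  from bchoice[OF this] obtain y
    where "\<forall>k\<in>{..<16}. (\<forall>j. y k j \<in> Aset) \<and> c k = (\<Sum>j<i. ?as ! j * y k j)" ..
  then have y: "(\<forall>j. y k j \<in> Aset) \<and> c k = (\<Sum>j<i. ?as ! j * y k j)" if "k < 16" for k
    using that by blast
  have "\<omega> = lin (\<lambda>k. \<Sum>j<i. ?as ! j * y k j)"
    unfolding c(2) lin_def by (rule sum.cong) (use y in auto)
  also have "\<dots> = (\<Sum>j<i. (?as ! j) *s lin (\<lambda>k. y k j))"
    unfolding lin_sum lin_smult ..
  finally have "\<omega> = (\<Sum>j<length (take i ?as). (take i ?as ! j) *s lin (\<lambda>k. y k j))"
    unfolding tk(2) by simp
  moreover have "lin (\<lambda>k. y k j) \<in> inv_forms" for j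
    by (rule lin_inv[OF q]) (use y Aset_inv[OF q] in blast)
  ultimately show "\<omega> \<in> seq_times (take i ?as) OmegaG"
    by (rule seq_times_OmegaGI[OF q tk(1)])
qed

lemma depth_ge:
  assumes q: "odd CARD('a::{field,finite})"
  shows "3 \<le> depth RG_plus (OmegaG :: ('a poly3, 'a form) module)"
proof -
  have "set [f1, f2, f3] \<subseteq> (RG_plus :: 'a poly3 set)"
    using lookup_f_0[OF q] by (simp add: RG_plus_def f1_inv f2_inv[OF q] f3_inv)
  then have "enat (length ([f1, f2, f3] :: 'a poly3 list)) \<le> depth RG_plus (OmegaG :: ('a poly3, 'a form) module)"
    unfolding depth_def using regular_f123[OF q] by (intro Sup_upper) blast
  then show ?thesis by (simp add: numeral_eq_enat numeral_3_eq_3)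
qed

theorem theorem1p5:
  assumes "odd CARD('a::{field,finite})"
  shows "cohen_macaulay RG RG_plus (OmegaG :: ('a poly3, 'a form) module) \<and>
    freely_generated_by \<A> (OmegaG :: ('a poly3, 'a form) module)
     [scalar 1, scalar f4,
      d f1, d f2, d f3,
      phi (d f2 \<and>\<^sub>\<Omega> d f3), phi (d f3 \<and>\<^sub>\<Omega> d f1), phi (d f1 \<and>\<^sub>\<Omega> d f2),
      phi_inv (d f1), phi_inv (d f2), phi_inv (d f3),
      d f2 \<and>\<^sub>\<Omega> d f3, d f3 \<and>\<^sub>\<Omega> d f1, d f1 \<and>\<^sub>\<Omega> d f2,
      dx 1 \<and>\<^sub>\<Omega> dx 2 \<and>\<^sub>\<Omega> dx 3, f4 *s (dx 1 \<and>\<^sub>\<Omega> dx 2 \<and>\<^sub>\<Omega> dx 3)]"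
  using freely_generated_OmegaG[OF assms] fin_gen_OmegaG[OF assms] module_dim_OmegaG[OF assms]
    antisym[OF depth_le[OF assms] depth_ge[OF assms]]
  by (simp add: cohen_macaulay_def gens_def)

end
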